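(* For each integer $q\geq 5$ there exists $\Delta_0\in\mathbb{N}$ such that for each integer $\Delta\geq\Delta_0$ and each $w\in[w_c,1)$, where $w_c=\max\{0,1-\tfrac{q}{\Delta}\}$, the $q$-state anti-ferromagnetic Potts model with edge interaction parameter $w$ has a unique Gibbs measure on the infinite $\Delta$-regular tree $\mathbb{T}_\Delta$.
   Context: For a positive integer $q$ write $[q]=\{1,\dots,q\}$. For a finite graph $G=(V,E)$ and $w\in(0,1)$, the $q$-state Potts measure on maps $\phi:V\to[q]$ is $\Pr_{G;q,w}[\mathbf{\Phi}=\phi]=\dfrac{w^{m(\phi)}}{\sum_{\sigma:V\to[q]}w^{m(\sigma)}}$, where $m(\sigma)$ is the number of edges $\{u,v\}\in E$ with $\sigma(u)=\sigma(v)$. Let $\mathbb{T}_\Delta=(V,E)$ be the infinite $\Delta$-regular tree. Equip the set of maps $\phi:V\to[q]$ with the sigma-algebra generated by the sets $\{\phi:V\to[q] : \phi\!\restriction_U=\sigma\}$, with $U\subset V$ finite and $\sigma:U\to[q]$. For finite $U\subset V$ let $\partial U$ be the set of vertices in $U$ that have a neighbor in $V\setminus U$, and $U^\circ=U\setminus\partial U$; let $\mathbb{T}_\Delta[U]$ be the finite subgraph induced by $U$. A probability measure $\mu$ on this sigma-algebra is a Gibbs measure for the $q$-state anti-ferromagnetic Potts model on $\mathbb{T}_\Delta$ at $w\in(0,1)$ if for all finite $U\subset V$ and $\mu$-almost every $\phi:V\to[q]$, $$\Pr_\mu[\mathbf{\Phi}\!\restriction_{U^\circ}=\phi\!\restriction_{U^\circ}\mid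 \mathbf{\Phi}\!\restriction_{V\setminus U^\circ}=\phi\!\restriction_{V\setminus U^\circ}]=\Pr_{\mathbb{T}_\Delta[U];q,w}[\mathbf{\Phi}\!\restriction_{U^\circ}=\phi\!\restriction_{U^\circ}\mid \mathbf{\Phi}\!\restriction_{\partial U}=\phi\!\restriction_{\partial U}].$$ *)

theory Defs
  imports "HOL-Probability.Probability"
begin

text \<open>A simple graph is a vertex set \<open>V\<close> with a set \<open>E\<close> of two-element subsets of \<open>V\<close>.\<close>

section \<open>The infinite regular tree\<close>

text \<open>
  The infinite \<open>\<Delta>\<close>-regular tree is unique up to isomorphism. We use the following model: vertices
  are the words over the alphabet \<open>{0, \<dots>, \<Delta> - 1}\<close> without two equal consecutive letters, and a
  word is joined to the words obtained from it by prepending one letter. So the parent of a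
  nonempty word is its tail, the root \<open>[]\<close> has \<open>\<Delta>\<close> children, and every other vertex has
  \<open>\<Delta> - 1\<close> children. The lemmas of this section show that the graph is \<open>\<Delta>\<close>-regular, connected,
  acyclic and (for \<open>\<Delta> \<ge> 2\<close>) infinite.
\<close>

definition tree_verts :: "nat \<Rightarrow> nat list set" where
  "tree_verts \<Delta> = {v. set v \<subseteq> {..<\<Delta>} \<and> distinct_adj v}"

definition tree_edges :: "nat \<Rightarrow> nat list set set" where
  "tree_edges \<Delta> = {{v, i # v} | i v. v \<in> tree_verts \<Delta> \<and> i # v \<in> tree_verts \<Delta>}"

lemma Nil_in_tree_verts: "[] \<in> tree_verts \<Delta>"
  by (simp add: tree_verts_def)

lemma tree_verts_tl: "i # v \<in> tree_verts \<Delta> \<Longrightarrow> v \<in> tree_verts \<Delta>"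
  by (auto simp: tree_verts_def dest: distinct_adj_ConsD)

lemma tree_edges_iff:
  "{u, v} \<in> tree_edges \<Delta> \<longleftrightarrow>
     u \<in> tree_verts \<Delta> \<and> v \<in> tree_verts \<Delta> \<and> ((\<exists>i. v = i # u) \<or> (\<exists>i. u = i # v))"
  by (auto simp: tree_edges_def doubleton_eq_iff)

lemma tree_edges_simple:
  "e \<in> tree_edges \<Delta> \<Longrightarrow> e \<subseteq> tree_verts \<Delta> \<and> card e = 2"
  by (auto simp: tree_edges_def)

lemma tree_regular:
  assumes "v \<in> tree_verts \<Delta>"
  shows "finite {u. {u, v} \<in> tree_edges \<Delta>}" "card {u. {u, v} \<in> tree_edges \<Delta>} = \<Delta>"
proof -
  have "finite {u. {u, v} \<in> tree_edges \<Delta>} \<and> card {u. {u, v} \<in> tree_edges \<Delta>} = \<Delta>"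
  proof (cases v)
    case Nil
    have "{u. {u, v} \<in> tree_edges \<Delta>} = (\<lambda>i. [i]) ` {..<\<Delta>}"
      by (auto simp: Nil tree_edges_iff tree_verts_def)
    then show ?thesis by (simp add: card_image inj_on_def)
  next
    case (Cons j w)
    have j: "j < \<Delta>" using assms by (simp add: Cons tree_verts_def)
    have eq: "{u. {u, v} \<in> tree_edges \<Delta>} = insert w ((\<lambda>i. i # v) ` ({..<\<Delta>} - {j}))"
      using assms tree_verts_tl[of j w \<Delta>]
      by (auto simp: Cons tree_edges_iff tree_verts_def)
    have "w \<notin> (\<lambda>i. i # v) ` ({..<\<Delta>} - {j})" by (auto simp: Cons)
    moreover have "card ((\<lambda>i. i # v) ` ({..<\<Delta>} - {j})) = \<Delta> - 1"
      using j by (simp add: card_image inj_on_def)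
    ultimately show ?thesis using j by (simp add: eq)
  qed
  then show "finite {u. {u, v} \<in> tree_edges \<Delta>}" "card {u. {u, v} \<in> tree_edges \<Delta>} = \<Delta>"
    by auto
qed

lemma tree_connected:
  assumes "u \<in> tree_verts \<Delta>" "v \<in> tree_verts \<Delta>"
  shows "(u, v) \<in> {(x, y). {x, y} \<in> tree_edges \<Delta>}\<^sup>*"
proof -
  let ?R = "{(x, y). {x, y} \<in> tree_edges \<Delta>}"
  have root: "(w, []) \<in> ?R\<^sup>*" if "w \<in> tree_verts \<Delta>" for w
    using that
  proof (induction w)
    case (Cons i w)
    then have "(i # w, w) \<in> ?R" "(w, []) \<in> ?R\<^sup>*"
      using tree_verts_tl[of i w] by (auto simp: tree_edges_iff)
    then show ?case by (rule converse_rtrancl_into_rtrancl)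
  qed simp
  have "sym ?R" by (auto simp: sym_def insert_commute)
  then have "sym (?R\<^sup>*)" by (rule sym_rtrancl)
  then have "([], v) \<in> ?R\<^sup>*" using root[OF assms(2)] by (rule symD)
  with root[OF assms(1)] show ?thesis by (rule rtrancl_trans)
qed

lemma tree_acyclic:
  assumes "length c \<ge> 3" "distinct c"
  shows "\<exists>k<length c. {c ! k, c ! (Suc k mod length c)} \<notin> tree_edges \<Delta>"
proof (rule ccontr)
  define n where "n = length c"
  assume "\<not> ?thesis"
  then have E: "{c ! k, c ! (Suc k mod n)} \<in> tree_edges \<Delta>" if "k < n" for k
    using that by (auto simp: n_def)
  have n: "n \<ge> 3" using assms by (simp add: n_def)
  let ?L = "length ` (!) c ` {..<n}"
  have "0 \<in> {..<n}" using n by simp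
  then have L: "finite ?L" "?L \<noteq> {}" by blast+
  obtain m where "m < n" "Max ?L = length (c ! m)"
    using Max_in[OF L] by auto
  moreover have "length (c ! k) \<le> Max ?L" if "k < n" for k
    using that by (intro Max_ge[OF L(1)]) auto
  ultimately have m: "m < n" "\<And>k. k < n \<Longrightarrow> length (c ! k) \<le> length (c ! m)"
    by simp_all
  have tl_eq: "c ! k = tl (c ! m)" if "k < n" "{c ! k, c ! m} \<in> tree_edges \<Delta>" for k
    using that(2) m(2)[OF that(1)] by (auto simp: tree_edges_iff)
  define p where "p = (if m = 0 then n - 1 else m - 1)"
  define s where "s = Suc m mod n"
  have ps: "p < n" "s < n" "Suc p mod n = m" "p \<noteq> s"
    using m(1) n by (auto simp: p_def s_def mod_Suc)
  have "{c ! p, c ! m} \<in> tree_edges \<Delta>" "{c ! s, c ! m} \<in> tree_edges \<Delta>"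
    using E[OF ps(1)] E[OF m(1)] ps(3) by (simp_all add: s_def insert_commute)
  then have "c ! p = c ! s" using tl_eq ps by metis
  then show False using assms(2) ps by (simp add: nth_eq_iff_index_eq n_def)
qed

lemma tree_infinite:
  assumes "\<Delta> \<ge> 2"
  shows "infinite (tree_verts \<Delta>)"
proof
  assume fin: "finite (tree_verts \<Delta>)"
  have ex: "\<exists>v \<in> tree_verts \<Delta>. length v = n" for n
  proof (induction n)
    case (Suc n)
    then obtain v where v: "v \<in> tree_verts \<Delta>" "length v = n" by auto
    have "(if v = [] \<or> hd v \<noteq> 0 then 0 else 1) # v \<in> tree_verts \<Delta>"
      using v assms by (cases v) (auto simp: tree_verts_def)
    then show ?case using v by (intro bexI) auto
  qed (use Nil_in_tree_verts in auto)
  have "length ` tree_verts \<Delta> = UNIV"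
    using ex by (auto simp: image_iff) metis
  then show False using fin finite_imageI[OF fin, of length] by simp
qed


section \<open>The Potts model on a finite graph\<close>

definition mono_edges :: "'v set set \<Rightarrow> ('v \<Rightarrow> nat) \<Rightarrow> nat" where
  "mono_edges E \<sigma> = card {e \<in> E. \<exists>u v. e = {u, v} \<and> \<sigma> u = \<sigma> v}"

definition potts_measure :: "'v set \<Rightarrow> 'v set set \<Rightarrow> nat \<Rightarrow> real \<Rightarrow> ('v \<Rightarrow> nat) measure" where
  "potts_measure V E q w =
     point_measure (V \<rightarrow>\<^sub>E {1..q})
       (\<lambda>\<phi>. ennreal (w ^ mono_edges E \<phi> / (\<Sum>\<sigma> \<in> V \<rightarrow>\<^sub>E {1..q}. w ^ mono_edges E \<sigma>)))"


section \<open>Gibbs measures on an infinite graph\<close>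

text \<open>
  The space of all maps \<open>V \<rightarrow> {1..q}\<close>, with the cylinder sigma-algebra.
  (The measure that the library attaches to the product space is irrelevant.)
\<close>

abbreviation config_space :: "'v set \<Rightarrow> nat \<Rightarrow> ('v \<Rightarrow> nat) measure" where
  "config_space V q \<equiv> \<Pi>\<^sub>M v\<in>V. count_space {1..q}"

lemma sets_config_space:
  "sets (config_space V q) =
     sigma_sets (V \<rightarrow>\<^sub>E {1..q})
       {{\<phi> \<in> V \<rightarrow>\<^sub>E {1..q}. restrict \<phi> U = \<sigma>} | U \<sigma>. finite U \<and> U \<subseteq> V \<and> \<sigma> \<in> U \<rightarrow>\<^sub>E {1..q}}"
  (is "_ = sigma_sets ?X ?C")
proof -
  let ?R = "{{f \<in> ?X. f i \<in> A} | i A. i \<in> V \<and> A \<subseteq> {1..q}}"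
  have "sets (config_space V q) = sigma_sets ?X ?R"
    by (simp add: sets_PiM_single)
  also have "\<dots> = sigma_sets ?X ?C"
  proof (rule sigma_sets_eqI)
    fix a assume "a \<in> ?R"
    then obtain i A where a: "a = {f \<in> ?X. f i \<in> A}" "i \<in> V" "A \<subseteq> {1..q}" by blast
    define cyl where "cyl = (\<lambda>k. {f \<in> ?X. restrict f {i} = (\<lambda>_\<in>{i}. k)})"
    have cyl: "cyl k = {f \<in> ?X. f i = k}" for k
      by (auto simp: cyl_def restrict_def fun_eq_iff)
    have "cyl k \<in> sigma_sets ?X ?C" if "k \<in> A" for k
    proof (rule sigma_sets.Basic)
      have "(\<lambda>_\<in>{i}. k) \<in> {i} \<rightarrow>\<^sub>E {1..q}" using that a by auto
      then show "cyl k \<in> ?C" using a(2) unfolding cyl_def by blast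
    qed
    moreover have "countable A" by (rule countableI_type)
    moreover have "a = (\<Union>k\<in>A. cyl k)" by (auto simp: a cyl)
    moreover have "sigma_algebra ?X (sigma_sets ?X ?C)" by (rule sigma_algebra_sigma_sets) auto
    ultimately show "a \<in> sigma_sets ?X ?C"
      by (auto intro!: sigma_algebra.countable_UN'' simp: image_subset_iff)
  next
    fix c assume "c \<in> ?C"
    then obtain U \<sigma> where c: "c = {\<phi> \<in> ?X. restrict \<phi> U = \<sigma>}" "finite U" "U \<subseteq> V"
      "\<sigma> \<in> U \<rightarrow>\<^sub>E {1..q}" by blast
    interpret S: sigma_algebra ?X "sigma_sets ?X ?R" by (rule sigma_algebra_sigma_sets) auto
    have "c = {\<phi> \<in> ?X. \<forall>i\<in>U. \<phi> i \<in> {\<sigma> i}}"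
    proof -
      have "restrict \<phi> U = \<sigma> \<longleftrightarrow> (\<forall>i\<in>U. \<phi> i = \<sigma> i)" for \<phi>
        using c(4) by (auto simp: fun_eq_iff restrict_def PiE_def extensional_def)
      then show ?thesis by (simp add: c(1))
    qed
    also have "\<dots> \<in> sigma_sets ?X ?R"
    proof (rule S.sets_Collect_finite_All[OF _ c(2)])
      fix i assume "i \<in> U"
      then have "i \<in> V" "{\<sigma> i} \<subseteq> {1..q}" using c by auto
      then show "{\<phi> \<in> ?X. \<phi> i \<in> {\<sigma> i}} \<in> sigma_sets ?X ?R"
        by (intro sigma_sets.Basic) blast
    qed
    finally show "c \<in> sigma_sets ?X ?R" .
  qed
  finally show ?thesis .
qed

definition bdry :: "'v set \<Rightarrow> 'v set set \<Rightarrow> 'v set \<Rightarrow> 'v set" where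
  "bdry V E U = {u \<in> U. \<exists>v \<in> V - U. {u, v} \<in> E}"

definition intr :: "'v set \<Rightarrow> 'v set set \<Rightarrow> 'v set \<Rightarrow> 'v set" where
  "intr V E U = U - bdry V E U"

definition induced_edges :: "'v set set \<Rightarrow> 'v set \<Rightarrow> 'v set set" where
  "induced_edges E U = {e \<in> E. e \<subseteq> U}"

text \<open>The sigma-algebra on configurations on \<open>V\<close> generated by the random variable \<open>\<Phi>\<restriction>W\<close>:\<close>

definition restr_algebra :: "'v set \<Rightarrow> nat \<Rightarrow> 'v set \<Rightarrow> ('v \<Rightarrow> nat) measure" where
  "restr_algebra V q W =
     vimage_algebra (V \<rightarrow>\<^sub>E {1..q}) (\<lambda>\<Phi>. restrict \<Phi> W) (config_space W q)"

lemma subalgebra_restr_algebra: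
  assumes "W \<subseteq> V" "sets \<mu> = sets (config_space V q)"
  shows "subalgebra \<mu> (restr_algebra V q W)"
proof -
  have sp: "space \<mu> = V \<rightarrow>\<^sub>E {1..q}"
    using sets_eq_imp_space_eq[OF assms(2)] by (simp add: space_PiM)
  have "(\<lambda>\<Phi>. restrict \<Phi> W) \<in> measurable (config_space V q) (config_space W q)"
    using assms(1) by (intro measurable_restrict_subset)
  then have "(\<lambda>\<Phi>. restrict \<Phi> W) \<in> measurable \<mu> (config_space W q)"
    using measurable_cong_sets[OF assms(2) refl] by blast
  then have "sets (restr_algebra V q W) \<subseteq> sets \<mu>"
    unfolding restr_algebra_def sp[symmetric] by (rule sets_image_in_sets[OF refl])
  then show ?thesis by (simp add: subalgebra_def sp restr_algebra_def)
qed

text \<open>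
  The conditional probability on the left is conditioned on \<open>\<Phi>\<restriction>(V - U\<degree>)\<close>, an event that is
  typically null; it denotes a version of the conditional expectation of the indicator of
  \<open>{\<Phi>. \<Phi>\<restriction>U\<degree> = \<phi>\<restriction>U\<degree>}\<close> given the sigma-algebra generated by \<open>\<Phi>\<restriction>(V - U\<degree>)\<close>, evaluated at \<open>\<phi>\<close>.
  The conditional probability on the right is elementary.
\<close>

definition potts_gibbs_measure ::
  "'v set \<Rightarrow> 'v set set \<Rightarrow> nat \<Rightarrow> real \<Rightarrow> ('v \<Rightarrow> nat) measure \<Rightarrow> bool" where
  "potts_gibbs_measure V E q w \<mu> \<longleftrightarrow>
     prob_space \<mu> \<and> sets \<mu> = sets (config_space V q) \<and>
     (\<forall>U. finite U \<and> U \<subseteq> V \<longrightarrow>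
       (AE \<phi> in \<mu>.
          real_cond_exp \<mu> (restr_algebra V q (V - intr V E U))
            (indicator {\<Phi> \<in> space \<mu>. restrict \<Phi> (intr V E U) = restrict \<phi> (intr V E U)}) \<phi> =
          \<P>(\<Phi> in potts_measure U (induced_edges E U) q w.
            restrict \<Phi> (intr V E U) = restrict \<phi> (intr V E U) \<bar>
            restrict \<Phi> (bdry V E U) = restrict \<phi> (bdry V E U))))"

end

theory Submission
  imports Defs
begin

text \<open>
  On the tree, conditioning on a distant boundary is governed by the recursion
  \<open>p\<^sub>i \<propto> \<Prod>\<^sub>s (1 - b p\<^sup>s\<^sub>i)\<close> over the \<open>d = \<Delta> - 1\<close> children, \<open>b = 1 - w\<close>. Uniqueness follows once all
  messages at depth \<open>n\<close> tend to the uniform distribution, uniformly in the boundary condition.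

  Measure the distance of \<open>p\<close> from uniform by the least \<open>c\<close> such that
  \<open>X\<^sub>i = - d (ln (1 - b p\<^sub>i) - mean\<^sub>j ln (1 - b p\<^sub>j)) \<ge> - c\<close> for all \<open>i\<close>. This region is convex in the \<open>X\<close>
  coordinates, so after one step the message is the softmax of \<open>- X\<close> for a single such \<open>X\<close>. For the second
  step, the condition on coordinate \<open>k\<close> is, to leading order, a bound on \<open>mean\<^sub>j \<Prod>\<^sub>s (1 - b y\<^sup>s\<^sub>j) / (1 - b y\<^sup>s\<^sub>k)\<close>, which is
  convex in the logarithms, so it suffices to bound it when all children carry the same message \<open>y\<close>.
  In the limit \<open>d \<rightarrow> \<infinity>\<close> at criticality, writing \<open>1 + F\<^sub>i = exp (- X\<^sub>i) / m\<close> with \<open>m = mean exp (- X)\<close>,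
  this is \<open>exp F\<^sub>k \<sqdot> mean exp (- F) \<le> exp (exp c - 1) \<le> 1 / (1 - c + c\<^sup>3 / 12)\<close>: two steps
  decrease \<open>c\<close> by a cubic amount. The terms of order \<open>c\<^sup>2 / d\<close> cancel over the two steps, and what is left
  of the finite-degree correction is of order \<open>c\<^sup>3 / d\<close>, hence dominated by the gain when \<open>d\<close> is large.
\<close>

section \<open>Averages and scalar inequalities\<close>

text \<open>The degree stays fixed while c tends to 0, so a surviving error of order c^2/d would in
  the end outweigh the cubic gain. Errors of that order are therefore carried along as explicit
  terms, in c^2 and in the mean square of the children's deviations, and only cubic errors are
  estimated crudely.

  The natural parameter is a = b / (q - b): with F_i = q p_i - 1 one has (1 + a)(1 - b p_i) = 1 - a
  F_i, and b \<Delta> \<le> q is the same as a d \<le> 1. The limit d \<rightarrow> \<infinity> is a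
  \<rightarrow> 0, and equality a d = 1 is criticality.

  The distance c is one-sided because p_k \<ge> 0 alone forces X_k to be at least about -1, whatever
  q is; a bound from the other side would start at order q, outside the range of the cubic gain. The
  starting value 21/20 leaves 1/20 for the finite degree.

  Once the messages are nearly uniform, every Gibbs measure must give a ball its normalised
  free-boundary weights. The same weights are the marginals of an explicit Markov chain, which
  settles existence.\<close>

definition avg :: "'a set \<Rightarrow> ('a \<Rightarrow> real) \<Rightarrow> real" where
  "avg A f = (\<Sum>x\<in>A. f x) / real (card A)"

lemma avg_add: "avg A (\<lambda>x. f x + g x) = avg A f + avg A g"
  by (simp add: avg_def sum.distrib add_divide_distrib)

lemma avg_diff: "avg A (\<lambda>x. f x - g x) = avg A f - avg A g"
  by (simp add: avg_def sum_subtractf diff_divide_distrib)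

lemma avg_cmult: "avg A (\<lambda>x. c * f x) = c * avg A f"
  by (simp add: avg_def sum_distrib_left)

lemma avg_uminus: "avg A (\<lambda>x. - f x) = - avg A f"
  by (simp add: avg_def sum_negf)

lemma avg_divide: "avg A (\<lambda>x. f x / c) = avg A f / c"
  by (simp add: avg_def sum_divide_distrib[symmetric])

lemma avg_const: "finite A \<Longrightarrow> A \<noteq> {} \<Longrightarrow> avg A (\<lambda>x. c) = c"
  by (simp add: avg_def)

lemma avg_mono: "(\<And>x. x \<in> A \<Longrightarrow> f x \<le> g x) \<Longrightarrow> avg A f \<le> avg A g"
  unfolding avg_def by (intro divide_right_mono sum_mono) auto

lemma avg_cong: "(\<And>x. x \<in> A \<Longrightarrow> f x = g x) \<Longrightarrow> avg A f = avg A g"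
  by (simp add: avg_def)

lemma avg_swap: "avg A (\<lambda>x. avg B (\<lambda>y. f x y)) = avg B (\<lambda>y. avg A (\<lambda>x. f x y))"
  unfolding avg_def by (simp add: sum_divide_distrib[symmetric] sum.swap[of f B A] mult.commute)

lemma avg_ge:
  assumes "finite A" "A \<noteq> {}" "\<And>x. x \<in> A \<Longrightarrow> c \<le> f x"
  shows "c \<le> avg A f"
  using avg_mono[of A "\<lambda>_. c" f] assms by (simp add: avg_const)

lemma avg_le:
  assumes "finite A" "A \<noteq> {}" "\<And>x. x \<in> A \<Longrightarrow> f x \<le> c"
  shows "avg A f \<le> c"
  using avg_mono[of A f "\<lambda>_. c"] assms by (simp add: avg_const)

lemma avg_abs_le:
  assumes "finite A" "A \<noteq> {}" "\<And>x. x \<in> A \<Longrightarrow> \<bar>f x\<bar> \<le> c"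
  shows "\<bar>avg A f\<bar> \<le> c"
proof -
  have "avg A f \<le> c" using assms by (intro avg_le) (auto simp: abs_le_iff)
  moreover have "- c \<le> avg A f" using assms(3) by (intro avg_ge assms(1,2)) (force simp: abs_le_iff)
  ultimately show ?thesis by (simp add: abs_le_iff)
qed

lemma exp_avg_le:
  assumes "finite A" "A \<noteq> {}"
  shows "exp (avg A f) \<le> avg A (\<lambda>x. exp (f x))"
proof -
  let ?m = "avg A f"
  have "exp ?m * (1 + (f x - ?m)) \<le> exp (f x)" for x
  proof -
    have "exp ?m * (1 + (f x - ?m)) \<le> exp ?m * exp (f x - ?m)"
      by (intro mult_left_mono exp_ge_add_one_self) auto
    then show ?thesis by (simp add: exp_diff)
  qed
  then have "avg A (\<lambda>x. exp ?m * (1 + (f x - ?m))) \<le> avg A (\<lambda>x. exp (f x))"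
    by (intro avg_mono) auto
  moreover have "avg A (\<lambda>x. exp ?m * (1 + (f x - ?m))) = exp ?m"
    by (simp add: avg_cmult avg_add avg_diff avg_const assms(1,2))
  ultimately show ?thesis by simp
qed

lemma power2_avg_le:
  assumes "finite A" "A \<noteq> {}"
  shows "(avg A f)\<^sup>2 \<le> avg A (\<lambda>x. (f x)\<^sup>2)"
proof -
  let ?m = "avg A f"
  have "0 \<le> avg A (\<lambda>x. (f x - ?m)\<^sup>2)" by (intro avg_ge assms) auto
  also have "\<dots> = avg A (\<lambda>x. (f x)\<^sup>2 - (2 * ?m) * f x + ?m\<^sup>2)"
    by (intro avg_cong) (simp add: power2_eq_square algebra_simps)
  also have "\<dots> = avg A (\<lambda>x. (f x)\<^sup>2) - ?m\<^sup>2"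
    unfolding avg_add avg_diff avg_cmult avg_const[OF assms] by (simp add: power2_eq_square)
  finally show ?thesis by simp
qed

section \<open>Taylor bounds for exp and ln, and the two inequalities behind the infinite-degree
  limit\<close>

lemma ln_one_minus_taylor:
  fixes x :: real
  assumes "x \<le> 1/2"
  shows "\<bar>ln (1 - x) + x + x\<^sup>2 / 2\<bar> \<le> \<bar>x\<bar>^3"
proof -
  \<comment> \<open>On x \<le> 1/2 the remainder \<open>?h\<close> decreases and \<open>?k\<close>
    increases, and both vanish at 0; this traps the remainder between 0 and - x^3 on either side of
    0.\<close>
  let ?h = "\<lambda>x::real. ln (1 - x) + x + x\<^sup>2 / 2"
  let ?k = "\<lambda>x::real. ?h x + x^3"
  have dh: "(?h has_real_derivative (- (y\<^sup>2) / (1 - y))) (at y)" if "y \<le> 1/2" for y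
    using that by (auto intro!: derivative_eq_intros simp: field_simps power2_eq_square)
  have dk: "(?k has_real_derivative (3 * y\<^sup>2 - y\<^sup>2 / (1 - y))) (at y)" if "y \<le> 1/2" for y
    using that by (auto intro!: derivative_eq_intros simp: field_simps power2_eq_square)
  have nh: "- (y\<^sup>2) / (1 - y) \<le> 0" if "y \<le> 1/2" for y :: real
    using that by (auto simp: divide_simps)
  have nk: "3 * y\<^sup>2 - y\<^sup>2 / (1 - y) \<ge> 0" if "y \<le> 1/2" for y :: real
  proof -
    have "y\<^sup>2 / (1 - y) \<le> y\<^sup>2 / (1/2)" using that by (intro divide_left_mono) auto
    also have "\<dots> \<le> 3 * y\<^sup>2" by (simp)
    finally show ?thesis by simp
  qed
  have eh: "\<exists>D. (?h has_real_derivative D) (at y) \<and> D \<le> 0" if "y \<le> 1/2" for y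
    using dh[OF that] nh[OF that] by blast
  have ek: "\<exists>D. (?k has_real_derivative D) (at y) \<and> 0 \<le> D" if "y \<le> 1/2" for y
    using dk[OF that] nk[OF that] by blast
  show ?thesis
  proof (cases "x \<ge> 0")
    case True
    have "?h x \<le> ?h 0"
      by (rule DERIV_nonpos_imp_nonincreasing[OF True]) (rule eh, use assms in linarith)
    moreover have "?k 0 \<le> ?k x"
      by (rule DERIV_nonneg_imp_nondecreasing[OF True]) (rule ek, use assms in linarith)
    ultimately show ?thesis using True by (simp add: abs_le_iff)
  next
    case False
    then have x: "x \<le> 0" by simp
    have "?h 0 \<le> ?h x"
      by (rule DERIV_nonpos_imp_nonincreasing[OF x]) (rule eh, linarith)
    moreover have "?k x \<le> ?k 0"
      by (rule DERIV_nonneg_imp_nondecreasing[OF x]) (rule ek, linarith)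
    ultimately show ?thesis using False by (simp add: abs_le_iff)
  qed
qed

lemma exp_minus_le_quadratic:
  fixes x :: real
  assumes "0 \<le> x"
  shows "exp (- x) \<le> 1 - x + x\<^sup>2 / 2"
proof -
  let ?h = "\<lambda>x::real. 1 - x + x\<^sup>2 / 2 - exp (- x)"
  have "?h 0 \<le> ?h x"
  proof (intro DERIV_nonneg_imp_nondecreasing[of 0 x ?h] allI impI exI conjI assms)
    fix y :: real
    show "(?h has_real_derivative (- 1 + y + exp (- y))) (at y)"
      by (auto intro!: derivative_eq_intros)
    show "- 1 + y + exp (- y) \<ge> 0" using exp_ge_add_one_self[of "- y"] by simp
  qed
  then show ?thesis by simp
qed

lemma exp_le_quadratic:
  fixes u :: real
  assumes "u \<le> 1"
  shows "exp u \<le> 1 + u + u\<^sup>2"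
proof (cases "u \<ge> 0")
  case True then show ?thesis using exp_bound[of u] assms by simp
next
  case False
  then have "exp u \<le> 1 + u + u\<^sup>2 / 2" using exp_minus_le_quadratic[of "- u"] by simp
  then show ?thesis by (smt (verit) zero_le_power2 field_sum_of_halves)
qed

text \<open>Both remainders are F^2/2 to second order and their quotient expands as 1 + F/3 + ...,
  whence the factor 1/3. For F < 0 the quotient is at most 1. For F \<ge> 0, with F in place of T,
  the difference of the two sides vanishes to first order at 0 and is convex.\<close>

lemma exp_remainder_le_log_remainder:
  fixes F T :: real
  assumes "- 1 < F" "F \<le> T" "0 \<le> T"
  shows "exp (- F) - 1 + F \<le> (1 + T / 3) * (F - ln (1 + F))"
proof (cases "F \<ge> 0")
  case False
  let ?h = "\<lambda>x::real. 1 - exp (- x) - ln (1 + x)"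
  have "?h 0 \<le> ?h F"
  proof (rule DERIV_nonpos_imp_nonincreasing[of F 0 ?h])
    show "F \<le> 0" using False by simp
    fix x assume x: "F \<le> x" "x \<le> 0"
    then have "(?h has_real_derivative (exp (- x) - 1 / (1 + x))) (at x)"
      using assms by (auto intro!: derivative_eq_intros simp: field_simps)
    moreover have "exp (- x) - 1 / (1 + x) \<le> 0"
      using le_imp_inverse_le[OF exp_ge_add_one_self[of x]] assms x
      by (simp add: exp_minus inverse_eq_divide)
    ultimately show "\<exists>y. (?h has_real_derivative y) (at x) \<and> y \<le> 0" by blast
  qed
  then have "exp (- F) - 1 + F \<le> F - ln (1 + F)" by simp
  also have "\<dots> \<le> (1 + T / 3) * (F - ln (1 + F))"
  proof -
    have "ln (1 + F) \<le> F" using assms ln_add_one_self_le_self2 by auto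
    then have "0 \<le> (T / 3) * (F - ln (1 + F))" using assms by simp
    then show ?thesis by (simp add: algebra_simps)
  qed
  finally show ?thesis .
next
  case True
  let ?g = "\<lambda>x::real. (1 + x / 3) * (x - ln (1 + x)) - (exp (- x) - 1 + x)"
  let ?g' = "\<lambda>x::real. (x - ln (1 + x)) / 3 + (1 + x / 3) * (1 - 1 / (1 + x)) + exp (- x) - 1"
  have dg: "(?g has_real_derivative ?g' x) (at x)" if "0 \<le> x" for x
  proof -
    have 1: "((\<lambda>x. (1 + x / 3) * (x - ln (1 + x))) has_real_derivative
        ((x - ln (1 + x)) / 3 + (1 + x / 3) * (1 - 1 / (1 + x)))) (at x)"
      using that by (auto intro!: derivative_eq_intros)
    have 2: "((\<lambda>x. exp (- x) - 1 + x) has_real_derivative - exp (- x) + 1) (at x)"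
      by (auto intro!: derivative_eq_intros)
    show ?thesis using DERIV_diff[OF 1 2] by (simp add: algebra_simps)
  qed
  let ?g'' = "\<lambda>x::real. (1 - 1 / (1 + x)) / 3 + (1 - 1 / (1 + x)) / 3 + (1 + x / 3) * (1 / (1 + x)\<^sup>2) - exp (- x)"
  have dg': "(?g' has_real_derivative ?g'' x) (at x)" if "0 \<le> x" for x
  proof -
    have 1: "((\<lambda>x. (x - ln (1 + x)) / 3) has_real_derivative (1 - 1 / (1 + x)) / 3) (at x)"
      using that by (auto intro!: derivative_eq_intros)
    have 2: "((\<lambda>x. (1 + x / 3) * (1 - 1 / (1 + x))) has_real_derivative
        ((1 - 1 / (1 + x)) / 3 + (1 + x / 3) * (1 / (1 + x)\<^sup>2))) (at x)"
      using that by (auto intro!: derivative_eq_intros simp: power2_eq_square)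
    have 3: "((\<lambda>x. exp (- x) - 1) has_real_derivative - exp (- x)) (at x)"
      by (auto intro!: derivative_eq_intros)
    show ?thesis using DERIV_add[OF DERIV_add[OF 1 2] 3] by (simp add: algebra_simps)
  qed
  have g''_nonneg: "?g'' x \<ge> 0" if "0 \<le> x" for x :: real
  proof -
    have "exp (- x) \<le> 1 / (1 + x)" using exp_ge_add_one_self[of x] that by (simp add: exp_minus field_simps)
    moreover have "(1 - 1 / (1 + x)) / 3 + (1 - 1 / (1 + x)) / 3 + (1 + x / 3) * (1 / (1 + x)\<^sup>2) - 1 / (1 + x)
        = (2/3) * x\<^sup>2 / (1 + x)\<^sup>2"
      using that by (simp add: divide_simps power2_eq_square) algebra
    moreover have "(2/3) * x\<^sup>2 / (1 + x)\<^sup>2 \<ge> 0" by simp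
    ultimately show ?thesis by linarith
  qed
  have g'_nonneg: "?g' x \<ge> 0" if "0 \<le> x" for x
  proof -
    have "?g' 0 \<le> ?g' x"
      by (rule DERIV_nonneg_imp_nondecreasing[OF that]) (use dg' g''_nonneg in blast)
    then show ?thesis by simp
  qed
  have "?g 0 \<le> ?g F"
    by (rule DERIV_nonneg_imp_nondecreasing[OF True]) (use dg g'_nonneg in blast)
  then have "exp (- F) - 1 + F \<le> (1 + F / 3) * (F - ln (1 + F))" by simp
  also have "\<dots> \<le> (1 + T / 3) * (F - ln (1 + F))"
    using assms True ln_add_one_self_le_self[of F] by (intro mult_right_mono) auto
  finally show ?thesis .
qed

text \<open>The expansion exp (1 - exp c) = 1 - c + c^3/6 + ... has slope -1 and no quadratic term,
  so the gain is cubic. Half of the coefficient 1/6 survives on the whole range up to 21/20, the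
  radius at which the iteration starts.\<close>

lemma cubic_gain:
  fixes c :: real
  assumes "0 \<le> c" "c \<le> 21/20"
  shows "(1 - c + c^3 / 12) * exp (exp c - 1) \<le> 1"
proof -
  \<comment> \<open>\<open>?\<chi> \<ge> 0\<close> is the sign condition for the derivative of
    \<open>?\<psi>\<close> below, after division by the positive factors
    \<open>exp (exp y - 1)\<close> and \<open>exp y\<close>.\<close>
  let ?\<chi> = "\<lambda>x::real. (1 - x\<^sup>2 / 4) * exp (- x) - 1 + x - x^3 / 12"
  have \<chi>: "?\<chi> x \<ge> 0" if x: "0 \<le> x" "x \<le> 21/20" for x
  proof -
    have "?\<chi> 0 \<le> ?\<chi> x"
    proof (rule DERIV_nonneg_imp_nondecreasing[OF x(1)])
      fix y assume y: "0 \<le> y" "y \<le> x"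
      let ?D = "exp (- y) * (- 1 - y / 2 + y\<^sup>2 / 4) + 1 - y\<^sup>2 / 4"
      have d: "(?\<chi> has_real_derivative ?D) (at y)"
        by (auto intro!: derivative_eq_intros simp: field_simps power2_eq_square)
      have y2: "y\<^sup>2 \<le> (21/20)\<^sup>2" using x y by (intro power_mono) auto
      \<comment> \<open>The second factor is negative on this range, so an upper bound for exp (- y)
        gives a lower bound for the product.\<close>
      have "(1 - y + y\<^sup>2 / 2) * (- 1 - y / 2 + y\<^sup>2 / 4) \<le> exp (- y) * (- 1 - y / 2 + y\<^sup>2 / 4)"
        using y y2 by (intro mult_right_mono_neg exp_minus_le_quadratic) (auto simp: power2_eq_square)
      moreover have "(1 - y + y\<^sup>2 / 2) * (- 1 - y / 2 + y\<^sup>2 / 4) + 1 - y\<^sup>2 / 4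
          = y * (1/2 - y\<^sup>2 / 2 + y^3 / 8)"
        by (simp add: power2_eq_square power3_eq_cube algebra_simps)
      moreover have "1/2 - y\<^sup>2 / 2 + y^3 / 8 \<ge> 0"
      \<comment> \<open>For y above 1 the quadratic term exceeds 1/2, so from 4/5 on the cubic term
        is kept; below 4/5 it may be dropped.\<close>
      proof (cases "y \<ge> 4/5")
        case True
        then have "y^3 \<ge> (4/5)^3" by (intro power_mono) auto
        then show ?thesis using y2 by (simp add: power2_eq_square power3_eq_cube)
      next
        case False
        then have "y\<^sup>2 \<le> (4/5)\<^sup>2" using y by (intro power_mono) auto
        moreover have "y^3 \<ge> 0" using y by simp
        ultimately show ?thesis by (simp add: power2_eq_square)
      qed
      ultimately have "?D \<ge> 0" using y(1) by (smt (verit) mult_nonneg_nonneg)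
      with d show "\<exists>D. (?\<chi> has_real_derivative D) (at y) \<and> 0 \<le> D" by blast
    qed
    then show ?thesis by simp
  qed
  let ?\<psi> = "\<lambda>x::real. (1 - x + x^3 / 12) * exp (exp x - 1)"
  have "?\<psi> c \<le> ?\<psi> 0"
  proof (rule DERIV_nonpos_imp_nonincreasing[OF assms(1)])
    fix y assume y: "0 \<le> y" "y \<le> c"
    let ?D = "exp (exp y - 1) * (exp y * (1 - y + y^3 / 12) - (1 - y\<^sup>2 / 4))"
    have d: "(?\<psi> has_real_derivative ?D) (at y)"
      by (auto intro!: derivative_eq_intros simp: field_simps power2_eq_square power3_eq_cube)
    have "1 - y + y^3 / 12 \<le> (1 - y\<^sup>2 / 4) * exp (- y)" using \<chi>[of y] y assms by simp
    then have "exp y * (1 - y + y^3 / 12) \<le> exp y * ((1 - y\<^sup>2 / 4) * exp (- y))"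
      by (intro mult_left_mono) auto
    also have "\<dots> = 1 - y\<^sup>2 / 4" by (simp add: exp_minus)
    finally have "?D \<le> 0" by (intro mult_nonneg_nonpos) auto
    with d show "\<exists>D. (?\<psi> has_real_derivative D) (at y) \<and> D \<le> 0" by blast
  qed
  then show ?thesis by simp
qed

section \<open>Two steps in the limit of infinite degree\<close>

lemma limit_two_step:
  fixes X :: "'a \<Rightarrow> real" and c :: real
  assumes "finite I" "I \<noteq> {}" "avg I X = 0" "\<And>i. i \<in> I \<Longrightarrow> - c \<le> X i"
  defines "m \<equiv> avg I (\<lambda>i. exp (- X i))"
  shows "1 \<le> m" "m \<le> exp c"
    "exp (exp c / m - 1) * avg I (\<lambda>i. exp (- (exp (- X i) / m - 1))) \<le> exp (exp c - 1)"
proof -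
  show m1: "1 \<le> m"
    using exp_avg_le[OF assms(1,2), of "\<lambda>i. - X i"] assms(3) by (simp add: m_def avg_uminus)
  show mc: "m \<le> exp c"
    unfolding m_def using assms by (intro avg_le) (force)+
  define T where "T = exp c / m - 1"
  have T: "0 \<le> T" using m1 mc by (simp add: T_def field_simps)
  define \<mu> where "\<mu> = ln m"
  have \<mu>: "0 \<le> \<mu>" "exp \<mu> = m" using m1 by (auto simp: \<mu>_def)
  \<comment> \<open>Comparing with \<open>F - ln (1 + F)\<close> pays off because the mean of the latter is exactly \<open>ln m\<close>.\<close>
  have "avg I (\<lambda>i. exp (- (exp (- X i) / m - 1)))
      \<le> avg I (\<lambda>i. 1 - (exp (- X i) / m - 1) + (1 + T / 3) * (exp (- X i) / m - 1 + X i + \<mu>))"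
  proof (rule avg_mono)
    fix i assume i: "i \<in> I"
    let ?F = "exp (- X i) / m - 1"
    have "exp (- X i) \<le> exp c" using assms(4)[OF i] by simp
    then have "?F \<le> T" using m1 by (simp add: T_def divide_right_mono)
    moreover have "- 1 < ?F" using m1 by simp
    moreover have "ln (1 + ?F) = - X i - \<mu>" using m1 by (simp add: \<mu>_def ln_div)
    ultimately have "exp (- ?F) - 1 + ?F \<le> (1 + T / 3) * (?F - (- X i - \<mu>))"
      using exp_remainder_le_log_remainder[of ?F T] T by (simp only:)
    moreover have "?F - (- X i - \<mu>) = ?F + X i + \<mu>" by simp
    ultimately have "exp (- ?F) - 1 + ?F \<le> (1 + T / 3) * (?F + X i + \<mu>)" by (simp only:)
    then show "exp (- ?F) \<le> 1 - ?F + (1 + T / 3) * (?F + X i + \<mu>)"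
      by linarith
  qed
  also have "\<dots> = 1 + (1 + T / 3) * \<mu>"
    using m1 assms(1-3)
    by (simp add: avg_add avg_diff avg_cmult avg_divide avg_const m_def[symmetric])
  also have "\<dots> \<le> exp ((1 + T / 3) * \<mu>)" by (rule exp_ge_add_one_self)
  finally have "exp T * avg I (\<lambda>i. exp (- (exp (- X i) / m - 1))) \<le> exp T * exp ((1 + T / 3) * \<mu>)"
    by (intro mult_left_mono) auto
  also have "\<dots> = exp (T + (1 + T / 3) * \<mu>)" by (simp add: exp_add)
  also have "T + (1 + T / 3) * \<mu> \<le> exp c - 1"
  proof -
    \<comment> \<open>The identity (T + 1) m = exp c divides the budget exp c - 1 between the peak T
      and \<mu> = ln m; the slack T \<mu> absorbs the correction T \<mu> / 3.\<close>
    have "(T + 1) * (1 + \<mu>) \<le> (T + 1) * exp \<mu>" using T by (intro mult_left_mono exp_ge_add_one_self) auto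
    also have "\<dots> = exp c" using \<mu> m1 by (simp add: T_def)
    finally have "T + \<mu> + T * \<mu> \<le> exp c - 1" by (simp add: algebra_simps)
    moreover have "0 \<le> T * \<mu>" using T \<mu> by simp
    ultimately show ?thesis by (simp add: algebra_simps)
  qed
  finally show "exp (exp c / m - 1) * avg I (\<lambda>i. exp (- (exp (- X i) / m - 1))) \<le> exp (exp c - 1)"
    by (simp add: T_def)
qed

section \<open>Equal children at finite degree\<close>

lemma exp_le_one_plus_mult_exp: "exp x \<le> 1 + x * exp x" for x :: real
proof -
  have "exp x * (1 - x) \<le> exp x * exp (- x)"
    using exp_ge_add_one_self[of "- x"] by (intro mult_left_mono) auto
  then show ?thesis by (simp add: exp_minus algebra_simps)
qed

text \<open>The numerical input is exp (21/20) \<le> 287/100. The bound exp c - 1 \<le> 2 c lets the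
  upper deviation of a message be absorbed into q c as soon as there are two colours.\<close>

lemma exp_bounds:
  fixes c :: real
  assumes "0 \<le> c" "c \<le> 21/20"
  shows "exp c \<le> 3" "exp c - 1 \<le> 3 * c" "exp c - 1 \<le> c + 3 * c\<^sup>2"
    "exp (exp c - 1) \<le> 9" "exp (exp c - 1) \<le> 1 + 27 * c" "1 + c \<le> exp (exp c - 1)"
    "exp c - 1 \<le> 2 * c"
proof -
  have *: "exp (1/20::real) \<le> 1 + 1/20 + (1/20)\<^sup>2" by (rule exp_bound) auto
  have "exp c \<le> exp (1 + 1/20)" using assms by simp
  also have "\<dots> = exp 1 * exp (1/20)" by (simp add: exp_add[symmetric])
  also have "\<dots> \<le> (272/100) * (1 + 1/20 + (1/20)\<^sup>2)"
    using e_less_272 * by (intro mult_mono) auto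
  also have e3: "\<dots> \<le> 287/100" by (simp add: power2_eq_square)
  finally have e: "exp c \<le> 287/100" .
  then show 1: "exp c \<le> 3" by simp
  have "c * exp c \<le> c * 3" using 1 assms by (intro mult_left_mono) auto
  then show 2: "exp c - 1 \<le> 3 * c" using exp_le_one_plus_mult_exp[of c] by simp
  have "c * (exp c - 1) \<le> c * (3 * c)" using 2 assms by (intro mult_left_mono) auto
  then show 3: "exp c - 1 \<le> c + 3 * c\<^sup>2"
    using exp_le_one_plus_mult_exp[of c] by (simp add: power2_eq_square algebra_simps)
  have "exp (exp c - 1) \<le> exp (1 + 1)" using 1 by simp
  also have "\<dots> = exp 1 * exp (1::real)" by (rule exp_add)
  also have "\<dots> \<le> 3 * 3" using e_less_272 by (intro mult_mono) auto
  finally show 4: "exp (exp c - 1) \<le> 9" by simp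
  have "(exp c - 1) * exp (exp c - 1) \<le> (3 * c) * 9"
    using 2 4 assms by (intro mult_mono) auto
  then show "exp (exp c - 1) \<le> 1 + 27 * c" using exp_le_one_plus_mult_exp[of "exp c - 1"] by simp
  show "1 + c \<le> exp (exp c - 1)"
    using exp_ge_add_one_self[of "exp c - 1"] exp_ge_add_one_self[of c] by linarith
  show "exp c - 1 \<le> 2 * c"
  proof (cases "c \<le> 1")
    case True
    have "exp c \<le> 1 + c + c\<^sup>2" using assms True by (intro exp_bound) auto
    also have "c\<^sup>2 \<le> c" using assms True by (simp add: power2_eq_square mult_left_le)
    finally show ?thesis by simp
  next
    case False then show ?thesis using e by simp
  qed
qed

text \<open>The second-order terms a x^2 / 2 keep their exact coefficient, since they take part in
  the later cancellation; only the third-order remainder is estimated.\<close>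

lemma ln_ratio_le:
  fixes a :: real
  assumes a: "0 < a" and x: "a * \<bar>x\<bar> \<le> 1/2" and y: "a * \<bar>y\<bar> \<le> 1/2"
    and M: "\<bar>x\<bar> \<le> M" "\<bar>y\<bar> \<le> M"
  shows "(ln (1 - a * x) - ln (1 - a * y)) / a
    \<le> (y + a * y\<^sup>2 / 2) - (x + a * x\<^sup>2 / 2) + 2 * a\<^sup>2 * M^3"
proof -
  have *: "\<bar>ln (1 - a * z) + a * z + (a * z)\<^sup>2 / 2\<bar> \<le> a^3 * M^3" if "a * \<bar>z\<bar> \<le> 1/2" "\<bar>z\<bar> \<le> M" for z
  proof -
    have "a * z \<le> 1/2" using that a by (smt (verit) abs_le_iff mult_left_mono)
    then have "\<bar>ln (1 - a * z) + a * z + (a * z)\<^sup>2 / 2\<bar> \<le> \<bar>a * z\<bar>^3"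
      by (rule ln_one_minus_taylor)
    also have "\<dots> = a^3 * \<bar>z\<bar>^3" using a by (simp add: abs_mult power_mult_distrib)
    also have "\<dots> \<le> a^3 * M^3" using that a by (intro mult_left_mono power_mono) auto
    finally show ?thesis .
  qed
  have "ln (1 - a * x) - ln (1 - a * y)
      \<le> a * ((y + a * y\<^sup>2 / 2) - (x + a * x\<^sup>2 / 2) + 2 * a\<^sup>2 * M^3)"
    using *[OF x M(1)] *[OF y M(2)]
    by (simp add: abs_le_iff power2_eq_square power3_eq_cube algebra_simps)
  then show ?thesis using a by (simp add: divide_simps mult.commute)
qed

text \<open>This is the case of equal children with exponent 1/a, the critical value of d. Relative
  to \<open>lim\<close>, coordinate k contributes a T^2 / 2, which is a c^2 / 2 up to cubic terms,
  and the averaged factor contributes minus a/2 times the mean of F^2. Both stay explicit; every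
  other error is cubic in c.\<close>

lemma perturbed_limit_bound:
  fixes F :: "'a \<Rightarrow> real" and a c Q T :: real
  assumes I: "finite I" "I \<noteq> {}"
    and F: "\<And>i. i \<in> I \<Longrightarrow> - 1 \<le> F i" "\<And>i. i \<in> I \<Longrightarrow> F i \<le> T" "\<And>i. i \<in> I \<Longrightarrow> \<bar>F i\<bar> \<le> Q * c"
    and T: "0 \<le> T" "T \<le> exp c - 1"
    and lim: "exp T * avg I (\<lambda>i. exp (- F i)) \<le> exp (exp c - 1)"
    and c: "0 < c" "c \<le> 21/20" and Q: "1 \<le> Q"
    and a: "0 < a" "200 * Q^3 * a \<le> 1"
    and k: "k \<in> I"
  shows "avg I (\<lambda>i. exp ((ln (1 - a * F i) - ln (1 - a * F k)) / a))
    \<le> exp (exp c - 1) + (a / 2) * (c\<^sup>2 - avg I (\<lambda>i. (F i)\<^sup>2)) + 600 * Q^3 * a * c^3"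
proof -
  define V where "V = avg I (\<lambda>i. (F i)\<^sup>2)"
  define B where "B = exp (exp c - 1)"
  have Q23: "1 \<le> Q^2" "1 \<le> Q^3" "Q \<le> Q^3" using Q by (auto intro: one_le_power self_le_power)
  have aQ3: "a * Q^3 \<le> 1/200" using a by (simp add: mult.commute)
  have a200: "a \<le> 1/200" using aQ3 mult_left_mono[OF Q23(2) less_imp_le[OF a(1)]] by linarith
  have aQ: "a * Q \<le> 1/200" using aQ3 mult_left_mono[OF Q23(3) less_imp_le[OF a(1)]] by linarith
  have aF: "a * \<bar>F i\<bar> \<le> 1/2" if "i \<in> I" for i
  proof -
    have "a * \<bar>F i\<bar> \<le> a * (Q * c)" using F(3)[OF that] a by (intro mult_left_mono) auto
    also have "\<dots> \<le> (1/200) * (21/20)" using aQ c a Q by (simp only: mult.assoc[symmetric]) (intro mult_mono, auto)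
    finally show ?thesis by simp
  qed
  \<comment> \<open>\<open>\<theta>\<close> collects what the square term of coordinate k and the
    Taylor remainder add to the exponent T.\<close>
  define \<theta> where "\<theta> = a * T\<^sup>2 / 2 + 2 * a\<^sup>2 * (Q * c)^3"
  have \<theta>0: "0 \<le> \<theta>" using a c Q by (simp add: \<theta>_def)
  have c3: "c\<^sup>2 * c \<le> c\<^sup>2 * (21/20)" using c by (intro mult_left_mono) auto
  have \<theta>1: "\<theta> \<le> a * c\<^sup>2 / 2 + 10 * a * c^3"
  proof -
    have "T \<le> c + 3 * c\<^sup>2" using T exp_bounds(3)[of c] c by linarith
    then have "T\<^sup>2 \<le> (c + 3 * c\<^sup>2)\<^sup>2" using T by (intro power_mono) auto
    also have "\<dots> = c\<^sup>2 + 6 * c^3 + 9 * (c^3 * c)" by (simp add: power2_eq_square power3_eq_cube algebra_simps)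
    also have "c^3 * c \<le> c^3 * (21/20)" using c by (intro mult_left_mono) auto
    finally have "T\<^sup>2 \<le> c\<^sup>2 + 16 * c^3" using zero_le_power[OF less_imp_le[OF c(1)], of 3] by linarith
    then have "a * T\<^sup>2 \<le> a * (c\<^sup>2 + 16 * c^3)" using a by (intro mult_left_mono) auto
    then have "a * T\<^sup>2 \<le> a * c\<^sup>2 + 16 * (a * c^3)" by (simp add: algebra_simps)
    moreover have "2 * a\<^sup>2 * (Q * c)^3 = (2 * a * c^3) * (a * Q^3)"
      by (simp add: power_mult_distrib power2_eq_square)
    moreover have "(2 * a * c^3) * (a * Q^3) \<le> (2 * a * c^3) * 1"
      using a c aQ3 by (intro mult_left_mono) auto
    ultimately have "\<theta> \<le> a * c\<^sup>2 / 2 + 10 * (a * c^3)" unfolding \<theta>_def by linarith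
    then show ?thesis by (simp only: mult.assoc)
  qed
  have \<theta>2: "\<theta> \<le> 12 * a * c\<^sup>2"
  proof -
    have "a * c^3 \<le> (21/20) * (a * c\<^sup>2)"
      using mult_left_mono[OF c3 less_imp_le[OF a(1)]]
      by (simp add: power2_eq_square power3_eq_cube algebra_simps)
    moreover have "0 \<le> a * c\<^sup>2" using a by simp
    ultimately have "\<theta> \<le> 12 * (a * c\<^sup>2)" using \<theta>1 by linarith
    then show ?thesis by (simp only: mult.assoc)
  qed
  have c2: "c\<^sup>2 \<le> (21/20)\<^sup>2" using c by (intro power_mono) auto
  have "\<theta> \<le> 12 * (1/200) * (21/20)\<^sup>2"
    using \<theta>2 mult_mono[OF a200 c2] a by (simp add: mult.assoc)
  then have \<theta>le1: "\<theta> \<le> 1" by (simp add: power2_eq_square)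
  have \<theta>sq: "\<theta>\<^sup>2 \<le> a * c^3"
  proof -
    have "\<theta>\<^sup>2 \<le> (12 * a * c\<^sup>2)\<^sup>2" using \<theta>0 \<theta>2 by (intro power_mono) auto
    also have "\<dots> = (a * c^3) * (144 * (a * c))" by (simp add: power2_eq_square power3_eq_cube algebra_simps)
    also have "\<dots> \<le> (a * c^3) * (144 * ((1/200) * (21/20)))"
      using a c a200 by (intro mult_left_mono mult_mono) auto
    also have "\<dots> \<le> a * c^3" using a c by simp
    finally show ?thesis .
  qed
  have exp\<theta>: "exp \<theta> \<le> 1 + a * c\<^sup>2 / 2 + 11 * a * c^3"
    using exp_le_quadratic[OF \<theta>le1] \<theta>1 \<theta>sq by linarith
  define Y where "Y = avg I (\<lambda>i. exp (- F i - a * (F i)\<^sup>2 / 2))"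
  have Y0: "0 \<le> Y" unfolding Y_def by (intro avg_ge I) auto
  have "avg I (\<lambda>i. exp ((ln (1 - a * F i) - ln (1 - a * F k)) / a))
      \<le> avg I (\<lambda>i. exp T * exp \<theta> * exp (- F i - a * (F i)\<^sup>2 / 2))"
  proof (rule avg_mono)
    fix i assume i: "i \<in> I"
    have "(ln (1 - a * F i) - ln (1 - a * F k)) / a
        \<le> (F k + a * (F k)\<^sup>2 / 2) - (F i + a * (F i)\<^sup>2 / 2) + 2 * a\<^sup>2 * (Q * c)^3"
      using i k by (intro ln_ratio_le a aF F)
    also have "F k + a * (F k)\<^sup>2 / 2 \<le> T + a * T\<^sup>2 / 2"
    proof -
      \<comment> \<open>The function t + a t^2 / 2 increases as long as a t \<ge> -1, and F k lies
        in [-1, T] while a is tiny.\<close>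
      have "0 \<le> (T - F k) * (1 + a * (T + F k) / 2)"
      proof (intro mult_nonneg_nonneg)
        show "0 \<le> T - F k" using F(2)[OF k] by simp
        have "a * (- 1) \<le> a * (T + F k)" using a F(1)[OF k] T by (intro mult_left_mono) auto
        then show "0 \<le> 1 + a * (T + F k) / 2" using a200 a by simp
      qed
      then show ?thesis by (simp add: power2_eq_square field_simps)
    qed
    finally show "exp ((ln (1 - a * F i) - ln (1 - a * F k)) / a)
        \<le> exp T * exp \<theta> * exp (- F i - a * (F i)\<^sup>2 / 2)"
      by (simp add: exp_add[symmetric] \<theta>_def algebra_simps)
  qed
  also have "\<dots> = exp \<theta> * (exp T * Y)" by (simp add: avg_cmult Y_def algebra_simps)
  finally have main: "avg I (\<lambda>i. exp ((ln (1 - a * F i) - ln (1 - a * F k)) / a)) \<le> exp \<theta> * (exp T * Y)" .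
  have "Y \<le> avg I (\<lambda>i. exp (- F i) - (a/2) * (F i)\<^sup>2 + (3/2) * a * Q^3 * c^3)"
    unfolding Y_def
  proof (rule avg_mono)
    fix i assume i: "i \<in> I"
    let ?e = "exp (- F i)"
    have F3: "\<bar>F i\<bar>^3 \<le> (Q * c)^3" using F(3)[OF i] by (intro power_mono) auto
    have e3: "?e \<le> 3"
      using order_trans[of ?e "exp 1" 3] F(1)[OF i] e_less_272 by simp
    have "exp (- F i - a * (F i)\<^sup>2 / 2) = ?e * exp (- (a * (F i)\<^sup>2 / 2))" by (simp add: exp_add[symmetric])
    also have "\<dots> \<le> ?e * (1 - a * (F i)\<^sup>2 / 2 + (a * (F i)\<^sup>2 / 2)\<^sup>2 / 2)"
      using a by (intro mult_left_mono exp_minus_le_quadratic) auto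
    also have "\<dots> = ?e - (a/2) * ((F i)\<^sup>2 * ?e) + (a\<^sup>2 / 8) * ((F i)\<^sup>2)\<^sup>2 * ?e"
      by (simp add: power2_eq_square algebra_simps)
    finally have E: "exp (- F i - a * (F i)\<^sup>2 / 2)
      \<le> ?e - (a/2) * ((F i)\<^sup>2 * ?e) + (a\<^sup>2 / 8) * ((F i)\<^sup>2)\<^sup>2 * ?e" .
    have "(F i)\<^sup>2 * ?e \<ge> (F i)\<^sup>2 - (Q * c)^3"
    proof -
      have "(F i)\<^sup>2 * (1 - F i) \<le> (F i)\<^sup>2 * ?e"
        using exp_ge_add_one_self[of "- F i"] by (intro mult_left_mono) auto
      moreover have "(F i)\<^sup>2 * F i \<le> \<bar>F i\<bar>^3"
        using abs_ge_self[of "(F i)\<^sup>2 * F i"] by (simp add: abs_mult power2_eq_square power3_eq_cube)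
      ultimately show ?thesis using F3 by (simp add: algebra_simps)
    qed
    then have "(a/2) * ((F i)\<^sup>2 - (Q * c)^3) \<le> (a/2) * ((F i)\<^sup>2 * ?e)"
      using a by (intro mult_left_mono) auto
    moreover have "(a\<^sup>2 / 8) * ((F i)\<^sup>2)\<^sup>2 * ?e \<le> a * (Q * c)^3"
    proof -
      have "((F i)\<^sup>2)\<^sup>2 = \<bar>F i\<bar> * \<bar>F i\<bar>^3" by (simp add: power2_eq_square power3_eq_cube)
      then have "(a\<^sup>2 / 8) * ((F i)\<^sup>2)\<^sup>2 * ?e = (a / 8) * (a * \<bar>F i\<bar>) * \<bar>F i\<bar>^3 * ?e"
        by (simp add: power2_eq_square)
      also have "\<dots> \<le> (a / 8) * 1 * (Q * c)^3 * 3"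
        using a aF[OF i] F3 e3 Q c by (intro mult_mono) auto
      also have "\<dots> \<le> a * (Q * c)^3" using a Q c by simp
      finally show ?thesis .
    qed
    ultimately have "exp (- F i - a * (F i)\<^sup>2 / 2)
        \<le> ?e - (a/2) * ((F i)\<^sup>2 - (Q * c)^3) + a * (Q * c)^3"
      using E by linarith
    then show "exp (- F i - a * (F i)\<^sup>2 / 2) \<le> ?e - (a/2) * (F i)\<^sup>2 + (3/2) * a * Q^3 * c^3"
      by (simp add: power_mult_distrib algebra_simps)
  qed
  also have "\<dots> = avg I (\<lambda>i. exp (- F i)) - (a/2) * V + (3/2) * a * Q^3 * c^3"
    by (simp only: avg_add avg_diff avg_cmult avg_const[OF I] V_def)
  finally have Yle: "Y \<le> avg I (\<lambda>i. exp (- F i)) - (a/2) * V + (3/2) * a * Q^3 * c^3" .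
  have B: "B \<le> 9" "B \<le> 1 + 27 * c" using exp_bounds[of c] c by (auto simp: B_def)
  have V0: "0 \<le> V" unfolding V_def by (intro avg_ge I) auto
  define W where "W = B - (a/2) * V + 27/2 * (a * Q^3 * c^3)"
  have YW: "exp T * Y \<le> W"
  proof -
    have eT: "1 \<le> exp T" "exp T \<le> 9" using T B by (auto simp: B_def intro: order_trans[OF _ B(1)[unfolded B_def]])
    have "exp T * Y \<le> exp T * (avg I (\<lambda>i. exp (- F i)) - (a/2) * V + (3/2) * a * Q^3 * c^3)"
      using Yle by (intro mult_left_mono) auto
    \<comment> \<open>The variance term enters with a minus sign, so its factor exp T \<ge> 1 may be
      dropped; its coefficient remains exactly a/2.\<close>
    moreover have "1 * ((a/2) * V) \<le> exp T * ((a/2) * V)" using eT a V0 by (intro mult_right_mono) auto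
    moreover have "exp T * ((3/2) * a * Q^3 * c^3) \<le> 9 * ((3/2) * a * Q^3 * c^3)"
      using eT a Q c by (intro mult_right_mono) auto
    ultimately show ?thesis using lim by (simp add: W_def B_def algebra_simps)
  qed
  have W0: "0 \<le> W" using YW Y0 by (smt (verit) exp_gt_zero mult_nonneg_nonneg)
  have Wc: "W \<le> 1 + 42 * c"
  proof -
    have "27/2 * (a * Q^3 * c^3) \<le> 27/2 * ((1/200) * (c * c\<^sup>2))"
      using aQ3 a Q c by (intro mult_left_mono mult_mono) (auto simp: power2_eq_square power3_eq_cube)
    also have "c * c\<^sup>2 \<le> c * (21/20)\<^sup>2" using c c2 by (intro mult_left_mono) auto
    finally have "27/2 * (a * Q^3 * c^3) \<le> c" using c by (simp add: power2_eq_square)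
    moreover have "0 \<le> (a/2) * V" using a V0 by simp
    ultimately show ?thesis using B c unfolding W_def by linarith
  qed
  \<comment> \<open>\<open>W\<close> is at most 1 + O(c), so multiplying a c^2 / 2 by it changes
    that term only by a cubic amount.\<close>
  have "exp \<theta> * (exp T * Y) \<le> (1 + a * c\<^sup>2 / 2 + 11 * a * c^3) * W"
    using exp\<theta> YW W0 Y0 a c by (intro mult_mono) auto
  also have "\<dots> = W + (a * c\<^sup>2 / 2) * W + (11 * a * c^3) * W" by (simp add: algebra_simps)
  also have "(a * c\<^sup>2 / 2) * W \<le> (a * c\<^sup>2 / 2) * (1 + 42 * c)" using Wc a by (intro mult_left_mono) auto
  also have "(11 * a * c^3) * W \<le> (11 * a * c^3) * 46" using Wc a c by (intro mult_left_mono) auto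
  finally have "exp \<theta> * (exp T * Y) \<le> W + (a * c\<^sup>2 / 2) * (1 + 42 * c) + 506 * a * c^3" by simp
  also have "\<dots> = B + (a/2) * (c\<^sup>2 - V) + 27/2 * (a * c^3 * Q^3) + 527 * (a * c^3)"
    by (simp add: W_def power2_eq_square power3_eq_cube field_simps)
  also have "527 * (a * c^3) \<le> 527 * (a * c^3 * Q^3)"
    using mult_left_mono[OF Q23(2), of "a * c^3"] a c by simp
  finally have W': "exp \<theta> * (exp T * Y)
      \<le> B + (a/2) * (c\<^sup>2 - V) + 27/2 * (a * c^3 * Q^3) + 527 * (a * c^3 * Q^3)"
    by simp
  have "exp \<theta> * (exp T * Y) \<le> B + (a/2) * (c\<^sup>2 - V) + 600 * Q^3 * a * c^3"
  proof -
    have "0 \<le> a * c^3 * Q^3" using a c Q by simp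
    moreover have "600 * Q^3 * a * c^3 = 600 * (a * c^3 * Q^3)" by simp
    ultimately show ?thesis using W' by linarith
  qed
  with main show ?thesis unfolding B_def V_def by linarith
qed

section \<open>Contraction of the message recursion\<close>

lemma sum_eq_card_avg: "finite A \<Longrightarrow> A \<noteq> {} \<Longrightarrow> (\<Sum>x\<in>A. f x) = real (card A) * avg A f"
  by (simp add: avg_def)

text \<open>Convexity of exp between 0 and x. It serves the case l = a d < 1 below criticality: the
  missing weight 1 - l acts like extra children with uniform messages.\<close>

lemma exp_mult_le_interpolation:
  fixes l x :: real
  assumes "0 \<le> l" "l \<le> 1"
  shows "exp (l * x) \<le> 1 - l + l * exp x"
proof -
  let ?m = "l * x"
  have *: "exp ?m * (1 + (y - ?m)) \<le> exp y" for y
  proof -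
    have "exp ?m * (1 + (y - ?m)) \<le> exp ?m * exp (y - ?m)"
      by (intro mult_left_mono exp_ge_add_one_self) auto
    then show ?thesis by (simp add: exp_diff)
  qed
  have "l * (exp ?m * (1 + (x - ?m))) + (1 - l) * (exp ?m * (1 + (0 - ?m))) \<le> l * exp x + (1 - l) * exp 0"
    using assms by (intro add_mono mult_left_mono *) auto
  moreover have "l * (exp ?m * (1 + (x - ?m))) + (1 - l) * (exp ?m * (1 + (0 - ?m))) = exp ?m"
    by (simp add: algebra_simps)
  ultimately show ?thesis by simp
qed

text \<open>The ratio of the products at i and k is the exponential of l times a mean over the
  children, so convexity moves that mean outside and leaves the bound \<open>D\<close> for one child
  at a time. Taking reciprocals turns the upper bound on the mean ratio into a lower bound at
  coordinate k.\<close>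

lemma two_step_deviation_lower:
  fixes F :: "'b \<Rightarrow> 'a \<Rightarrow> real" and a c Q :: real
  assumes I: "finite I" "I \<noteq> {}" and S: "finite S" "S \<noteq> {}"
    and pos: "\<And>s i. s \<in> S \<Longrightarrow> i \<in> I \<Longrightarrow> 0 < 1 - a * F s i"
    and V: "\<And>s. s \<in> S \<Longrightarrow> avg I (\<lambda>i. (F s i)\<^sup>2) \<le> (Q * c)\<^sup>2"
    and D: "\<And>s. s \<in> S \<Longrightarrow> avg I (\<lambda>i. exp ((ln (1 - a * F s i) - ln (1 - a * F s k)) / a))
        \<le> exp (exp c - 1) + (a / 2) * (c\<^sup>2 - avg I (\<lambda>i. (F s i)\<^sup>2)) + 600 * Q^3 * a * c^3"
    and c: "0 < c" "c \<le> 21/20" and Q: "1 \<le> Q"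
    and a: "0 < a" "200 * Q^3 * a \<le> 1" "a * card S \<le> 1"
    and k: "k \<in> I"
  shows "(\<Prod>s\<in>S. 1 - a * F s k) / avg I (\<lambda>i. \<Prod>s\<in>S. 1 - a * F s i) - 1
    \<ge> - (c - c^3 / 12 + (a / 2) * (c\<^sup>2 - avg S (\<lambda>s. avg I (\<lambda>i. (F s i)\<^sup>2))) + 603 * Q^3 * a * c^3)"
proof -
  define P where "P i = (\<Prod>s\<in>S. 1 - a * F s i)" for i
  define V' where "V' = avg S (\<lambda>s. avg I (\<lambda>i. (F s i)\<^sup>2))"
  define B where "B = exp (exp c - 1)"
  define x where "x = (a / 2) * (c\<^sup>2 - V') + 600 * Q^3 * a * c^3"
  define l where "l = a * card S"
  have Q23: "1 \<le> Q^2" "1 \<le> Q^3" "Q^2 \<le> Q^3" using Q by (auto intro: one_le_power power_increasing)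
  have aQ3: "a * Q^3 \<le> 1/200" using a by (simp add: mult.commute)
  have aQ2: "a * Q^2 \<le> 1/200" using aQ3 mult_left_mono[OF Q23(3) less_imp_le[OF a(1)]] by linarith
  have l: "0 \<le> l" "l \<le> 1" using a by (auto simp: l_def)
  have Ppos: "0 < P i" if "i \<in> I" for i using pos that by (auto simp: P_def intro: prod_pos)
  have avgP: "0 < avg I P" unfolding avg_def using Ppos I by (intro divide_pos_pos sum_pos) (auto simp: card_gt_0_iff)
  define L where "L s i = (ln (1 - a * F s i) - ln (1 - a * F s k)) / a" for s i
  have ratio: "P i / P k = exp (l * avg S (\<lambda>s. L s i))" if i: "i \<in> I" for i
  proof -
    have "P i / P k = (\<Prod>s\<in>S. (1 - a * F s i) / (1 - a * F s k))" by (simp add: P_def prod_dividef)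
    also have "\<dots> = (\<Prod>s\<in>S. exp (a * L s i))"
      using a pos i k by (intro prod.cong) (auto simp: L_def exp_diff)
    also have "\<dots> = exp (l * avg S (\<lambda>s. L s i))"
      by (simp add: exp_sum[OF S(1), symmetric] l_def sum_eq_card_avg[OF S] avg_cmult)
    finally show ?thesis .
  qed
  have "avg I P / P k = avg I (\<lambda>i. P i / P k)" by (simp add: avg_divide)
  also have "\<dots> = avg I (\<lambda>i. exp (l * avg S (\<lambda>s. L s i)))" using ratio by (intro avg_cong)
  also have "\<dots> \<le> avg I (\<lambda>i. 1 - l + l * avg S (\<lambda>s. exp (L s i)))"
  proof (rule avg_mono)
    fix i
    have "exp (l * avg S (\<lambda>s. L s i)) \<le> 1 - l + l * exp (avg S (\<lambda>s. L s i))"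
      by (rule exp_mult_le_interpolation[OF l])
    also have "l * exp (avg S (\<lambda>s. L s i)) \<le> l * avg S (\<lambda>s. exp (L s i))"
      by (intro mult_left_mono exp_avg_le S l)
    finally show "exp (l * avg S (\<lambda>s. L s i)) \<le> 1 - l + l * avg S (\<lambda>s. exp (L s i))" by simp
  qed
  also have "\<dots> = 1 - l + l * avg S (\<lambda>s. avg I (\<lambda>i. exp (L s i)))"
    by (simp add: avg_add avg_diff avg_cmult avg_const I avg_swap[of I S])
  also have "avg S (\<lambda>s. avg I (\<lambda>i. exp (L s i))) \<le>
      avg S (\<lambda>s. B + (a / 2) * (c\<^sup>2 - avg I (\<lambda>i. (F s i)\<^sup>2)) + 600 * Q^3 * a * c^3)"
    using D by (intro avg_mono) (auto simp: L_def B_def)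
  also have "\<dots> = B + x"
    by (simp only: avg_add avg_diff avg_cmult avg_const[OF S] V'_def x_def add.assoc)
  finally have le0: "avg I P / P k \<le> 1 - l + l * (B + x)" using l by (simp add: mult_left_mono)
  have V'Q: "V' \<le> (Q * c)\<^sup>2" unfolding V'_def by (rule avg_le[OF S V])
  have c2: "c\<^sup>2 \<le> c * (21/20)" using c by (simp add: power2_eq_square)
  have xlow: "- ((a / 2) * (Q * c)\<^sup>2) \<le> x"
  proof -
    have "(a/2) * (- ((Q * c)\<^sup>2)) \<le> (a / 2) * (c\<^sup>2 - V')"
      using V'Q zero_le_power2[of c] a by (intro mult_left_mono) linarith+
    moreover have "0 \<le> 600 * Q^3 * a * c^3" using a c Q by simp
    ultimately show ?thesis unfolding x_def by linarith
  qed
  have ac: "(a / 2) * (Q * c)\<^sup>2 \<le> c"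
  proof -
    have "(a / 2) * (Q * c)\<^sup>2 = (a * Q^2) * c\<^sup>2 / 2" by (simp add: power_mult_distrib)
    also have "\<dots> \<le> (1/200) * (c * (21/20)) / 2" using aQ2 c2 a by (intro divide_right_mono mult_mono) auto
    finally show ?thesis using c by simp
  qed
  have B1: "1 + c \<le> B" using exp_bounds(6)[of c] c by (simp add: B_def)
  then have Bx: "1 \<le> B + x" using xlow ac by linarith
  have "1 - l + l * (B + x) \<le> B + x"
    using mult_nonneg_nonneg[of "1 - l" "B + x - 1"] l Bx by (simp add: algebra_simps)
  with le0 have le: "avg I P / P k \<le> B + x" by linarith
  have "1 / (B + x) \<le> P k / avg I P"
    using le Bx Ppos[OF k] avgP by (simp add: divide_simps mult.commute)
  \<comment> \<open>The convex function 1/t lies above its tangent line at B.\<close>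
  moreover have "1 / B - x / B\<^sup>2 \<le> 1 / (B + x)"
  proof -
    have "(1 / B - x / B\<^sup>2) * (B + x) = 1 - x\<^sup>2 / B\<^sup>2"
      using B1 c by (simp add: field_simps power2_eq_square)
    also have "\<dots> \<le> 1" by simp
    finally show ?thesis using Bx by (simp add: divide_simps)
  qed
  moreover have "1 - c + c^3 / 12 \<le> 1 / B"
    using cubic_gain[of c] c B1 by (simp add: B_def divide_simps)
  \<comment> \<open>The term (a / 2) (c^2 - V') inside \<open>x\<close> has to come out with
    coefficient 1 for the later cancellation. Since 1 - 1/B^2 is O(c) and - x is at most of order a
    c^2, dropping B^2 costs only a cubic term.\<close>
  moreover have "x / B\<^sup>2 \<le> x + 3 * Q^3 * a * c^3"
  proof (cases "0 \<le> x")
    case True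
    have "1 \<le> B\<^sup>2" using B1 c by (intro one_le_power) auto
    then have "x / B\<^sup>2 \<le> x" using True divide_left_mono[of 1 "B\<^sup>2" x] B1 c by simp
    then show ?thesis using a c Q by (smt (verit) mult_nonneg_nonneg zero_le_power)
  next
    case False
    have iB: "1 - 3 * c \<le> 1 / B"
    proof -
      have "1 / B = exp (- (exp c - 1))" unfolding exp_minus B_def by (simp add: inverse_eq_divide)
      then show ?thesis using exp_ge_add_one_self[of "- (exp c - 1)"] exp_bounds(2)[of c] c by linarith
    qed
    have iB1: "1 / B \<le> 1" using B1 c by simp
    have "1 - 1 / B\<^sup>2 = (1 - 1 / B) * (1 + 1 / B)" by (simp add: power2_eq_square algebra_simps)
    also have "\<dots> \<le> (3 * c) * 2" using iB iB1 B1 c by (intro mult_mono) auto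
    finally have "(- x) * (1 - 1 / B\<^sup>2) \<le> (- x) * (6 * c)" using False by (intro mult_left_mono) auto
    also have "\<dots> \<le> ((a / 2) * (Q * c)\<^sup>2) * (6 * c)" using xlow c by (intro mult_right_mono) auto
    also have "\<dots> = (3 * a * c^3) * Q^2" by (simp add: power2_eq_square power3_eq_cube)
    also have "\<dots> \<le> (3 * a * c^3) * Q^3" using Q23 a c by (intro mult_left_mono) auto
    finally show ?thesis by (simp add: algebra_simps)
  qed
  ultimately have "P k / avg I P - 1 \<ge> - c + c^3 / 12 - (x + 3 * Q^3 * a * c^3)" by linarith
  then show ?thesis unfolding P_def V'_def[symmetric] x_def by (simp add: algebra_simps)
qed

text \<open>To first order the recursion sends the children's deviations to - l times their mean,
  with l \<le> 1. By the Cauchy-Schwarz inequality the mean square then cannot grow, except through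
  terms of third and higher order.\<close>

lemma two_step_deviation_square:
  fixes F :: "'b \<Rightarrow> 'a \<Rightarrow> real" and a c Q :: real
  assumes I: "finite I" "I \<noteq> {}" and S: "finite S" "S \<noteq> {}"
    and F: "\<And>s i. s \<in> S \<Longrightarrow> i \<in> I \<Longrightarrow> - 1 \<le> F s i" "\<And>s i. s \<in> S \<Longrightarrow> i \<in> I \<Longrightarrow> \<bar>F s i\<bar> \<le> Q * c"
      "\<And>s. s \<in> S \<Longrightarrow> avg I (F s) = 0"
    and c: "0 < c" and Q: "1 \<le> Q"
    and a: "0 < a" "a * (Q * c) \<le> 1/2" "a * card S \<le> 1"
    and f: "\<And>i. i \<in> I \<Longrightarrow> f i = (\<Prod>s\<in>S. 1 - a * F s i) / avg I (\<lambda>i. \<Prod>s\<in>S. 1 - a * F s i) - 1"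
      "\<And>i. i \<in> I \<Longrightarrow> \<bar>f i\<bar> \<le> 2 * (Q * c)"
  shows "avg I (\<lambda>i. (f i)\<^sup>2) \<le> avg S (\<lambda>s. avg I (\<lambda>i. (F s i)\<^sup>2)) + 3 * (Q * c) * (10 * (Q * c)\<^sup>2 + 10 * (Q * c)^3)"
proof -
  define P where "P i = (\<Prod>s\<in>S. 1 - a * F s i)" for i
  define l where "l = a * card S"
  define G where "G i = avg S (\<lambda>s. F s i)" for i
  define M where "M = Q * c"
  have M: "0 < M" using c Q by (simp add: M_def)
  have l: "0 \<le> l" "l \<le> 1" using a by (auto simp: l_def)
  have GM: "\<bar>G i\<bar> \<le> M" if "i \<in> I" for i
    unfolding G_def M_def using that F by (intro avg_abs_le S)
  have aF: "\<bar>a * F s i\<bar> \<le> 1/2" if "s \<in> S" "i \<in> I" for s i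
    using order_trans[OF mult_left_mono[OF F(2)[OF that] less_imp_le[OF a(1)]] a(2)] a by (simp add: abs_mult)
  have P: "\<bar>P i - (1 - l * G i)\<bar> \<le> 5 * M\<^sup>2" "0 < P i" if i: "i \<in> I" for i
  proof -
    define u where "u = (\<Sum>s\<in>S. ln (1 - a * F s i))"
    have pos: "0 < 1 - a * F s i" if "s \<in> S" for s using aF[OF that i] by (simp add: abs_le_iff)
    then have Pu: "P i = exp u" using S by (simp add: P_def u_def exp_sum)
    then show "0 < P i" by simp
    have "\<bar>u + l * G i\<bar> = \<bar>\<Sum>s\<in>S. ln (1 - a * F s i) + a * F s i\<bar>"
      by (simp add: u_def l_def G_def sum_eq_card_avg[OF S] avg_add avg_cmult algebra_simps)
    also have "\<dots> \<le> (\<Sum>s\<in>S. \<bar>ln (1 - a * F s i) + a * F s i\<bar>)" by (rule sum_abs)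
    also have "\<dots> \<le> (\<Sum>s\<in>S. a * M\<^sup>2)"
    proof (rule sum_mono)
      fix s assume s: "s \<in> S"
      let ?x = "a * F s i"
      have "?x \<le> 1/2" using aF[OF s i] by linarith
      then have "\<bar>ln (1 - ?x) + ?x\<bar> \<le> ?x\<^sup>2 / 2 + \<bar>?x\<bar>^3"
        using ln_one_minus_taylor[of ?x] zero_le_power2[of ?x] unfolding abs_le_iff by linarith
      also have "\<bar>?x\<bar>^3 = \<bar>?x\<bar> * ?x\<^sup>2" by (simp add: power2_eq_square power3_eq_cube)
      also have "\<bar>?x\<bar> * ?x\<^sup>2 \<le> (1/2) * ?x\<^sup>2" using aF[OF s i] by (intro mult_right_mono) auto
      also have "?x\<^sup>2 / 2 + (1/2) * ?x\<^sup>2 = a * (a * \<bar>F s i\<bar>\<^sup>2)" by (simp add: power2_eq_square)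
      also have "a * (a * \<bar>F s i\<bar>\<^sup>2) \<le> a * (1 * M\<^sup>2)"
      proof -
        have "a * 1 \<le> a * card S" using S a by (intro mult_left_mono) (auto simp: Suc_le_eq card_gt_0_iff)
        then have "a \<le> 1" using a(3) by linarith
        then show ?thesis
          using a F(2)[OF s i] by (intro mult_left_mono mult_mono power_mono) (auto simp: M_def)
      qed
      finally show "\<bar>ln (1 - ?x) + ?x\<bar> \<le> a * M\<^sup>2" by simp
    qed
    also have "\<dots> = l * M\<^sup>2" by (simp add: l_def)
    also have "\<dots> \<le> M\<^sup>2" using l by (simp add: mult_left_le_one_le)
    finally have u1: "\<bar>u + l * G i\<bar> \<le> M\<^sup>2" .
    have u2: "\<bar>u\<bar> \<le> 2 * M"
    proof -
      have "\<bar>u\<bar> \<le> (\<Sum>s\<in>S. \<bar>ln (1 - a * F s i)\<bar>)" unfolding u_def by (rule sum_abs)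
      also have "\<dots> \<le> (\<Sum>s\<in>S. a * (2 * M))"
      proof (rule sum_mono)
        fix s assume s: "s \<in> S"
        let ?x = "a * F s i"
        have "?x \<le> 1/2" using aF[OF s i] by linarith
        then have "\<bar>ln (1 - ?x)\<bar> \<le> \<bar>?x\<bar> + ?x\<^sup>2 / 2 + \<bar>?x\<bar>^3"
          using ln_one_minus_taylor[of ?x] zero_le_power2[of ?x] by linarith
        also have "\<dots> = \<bar>?x\<bar> * (1 + \<bar>?x\<bar> / 2 + \<bar>?x\<bar>\<^sup>2)"
          by (simp add: power2_eq_square power3_eq_cube algebra_simps)
        also have "\<bar>?x\<bar>\<^sup>2 \<le> (1/2)\<^sup>2" using aF[OF s i] by (intro power_mono) auto
        then have "\<bar>?x\<bar> * (1 + \<bar>?x\<bar> / 2 + \<bar>?x\<bar>\<^sup>2) \<le> \<bar>?x\<bar> * 2"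
          using aF[OF s i] by (intro mult_left_mono) (auto simp: power2_eq_square)
        also have "\<dots> = 2 * (a * \<bar>F s i\<bar>)" using a by (simp add: abs_mult)
        also have "\<dots> \<le> 2 * (a * M)" using F(2)[OF s i] a by (intro mult_left_mono) (auto simp: M_def)
        finally show "\<bar>ln (1 - ?x)\<bar> \<le> a * (2 * M)" by simp
      qed
      also have "\<dots> = l * (2 * M)" by (simp add: l_def)
      also have "\<dots> \<le> 2 * M" using l M by (simp add: mult_left_le_one_le)
      finally show ?thesis .
    qed
    \<comment> \<open>The quadratic bound for exp u wants u \<le> 1 whatever q is; this comes from F
      \<ge> -1 and a d \<le> 1, not from the bound by M.\<close>
    have u3: "u \<le> 1"
    proof -
      have "u \<le> (\<Sum>s\<in>S. a)"
        unfolding u_def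
      proof (rule sum_mono)
        fix s assume s: "s \<in> S"
        have "ln (1 - a * F s i) \<le> - (a * F s i)"
          using ln_add_one_self_le_self2[of "- (a * F s i)"] pos[OF s] by simp
        also have "\<dots> \<le> a" using mult_left_mono[OF F(1)[OF s i] less_imp_le[OF a(1)]] by simp
        finally show "ln (1 - a * F s i) \<le> a" .
      qed
      then show ?thesis using a by (simp add: mult.commute)
    qed
    have "u\<^sup>2 \<le> (2 * M)\<^sup>2" using power_mono[OF u2, of 2] by simp
    then have "exp u \<le> 1 + u + 4 * M\<^sup>2" using exp_le_quadratic[OF u3] by (simp add: power2_eq_square)
    moreover have "1 + u \<le> exp u" by (rule exp_ge_add_one_self)
    ultimately show "\<bar>P i - (1 - l * G i)\<bar> \<le> 5 * M\<^sup>2"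
      using u1 zero_le_power2[of M] unfolding Pu abs_le_iff by linarith
  qed
  have avgG: "avg I G = 0"
    unfolding G_def using F(3) avg_swap[of I S "\<lambda>i s. F s i"] S by (simp add: avg_cong[of S _ "\<lambda>_. 0"] avg_const)
  define m where "m = avg I P"
  have m: "\<bar>m - 1\<bar> \<le> 5 * M\<^sup>2"
  proof -
    have "m - 1 = avg I (\<lambda>i. P i - (1 - l * G i))"
      by (simp add: avg_diff avg_cmult avg_const I avgG m_def)
    then show ?thesis using P(1) by (simp add: avg_abs_le I)
  qed
  have mpos: "0 < m" unfolding m_def avg_def using P(2) I by (intro divide_pos_pos sum_pos) (auto simp: card_gt_0_iff)
  have fG: "\<bar>f i + l * G i\<bar> \<le> 10 * M\<^sup>2 + 10 * M^3" if i: "i \<in> I" for i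
  proof -
    have "f i = P i / m - 1" using f(1)[OF i] by (simp add: P_def[abs_def] m_def)
    \<comment> \<open>Rewriting P i = m (1 + f i) in this way keeps m out of the denominator, so
      positivity of m together with the a priori bound on f suffices.\<close>
    then have "f i = (P i - m) + f i * (1 - m)" using mpos by (simp add: field_simps)
    then have "f i + l * G i = (P i - (1 - l * G i)) + (1 - m) + f i * (1 - m)" by simp
    moreover have "\<bar>f i * (1 - m)\<bar> \<le> (2 * M) * (5 * M\<^sup>2)"
      unfolding abs_mult using f(2)[OF i] m M by (intro mult_mono) (auto simp: M_def abs_minus_commute)
    moreover have "(2 * M) * (5 * M\<^sup>2) = 10 * M^3" by (simp add: power2_eq_square power3_eq_cube)
    ultimately show ?thesis using P(1)[OF i] m unfolding abs_le_iff by linarith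
  qed
  have "avg I (\<lambda>i. (f i)\<^sup>2) \<le> avg I (\<lambda>i. avg S (\<lambda>s. (F s i)\<^sup>2) + 3 * M * (10 * M\<^sup>2 + 10 * M^3))"
  proof (rule avg_mono)
    fix i assume i: "i \<in> I"
    have "(f i)\<^sup>2 - (l * G i)\<^sup>2 = (f i + l * G i) * (f i - l * G i)" by (simp add: power2_eq_square algebra_simps)
    also have "\<dots> \<le> \<bar>f i + l * G i\<bar> * \<bar>f i - l * G i\<bar>" by (simp add: abs_mult[symmetric])
    also have "\<dots> \<le> (10 * M\<^sup>2 + 10 * M^3) * (3 * M)"
    proof (intro mult_mono fG i)
      have "\<bar>l * G i\<bar> \<le> 1 * M" unfolding abs_mult using l GM[OF i] by (intro mult_mono) auto
      then show "\<bar>f i - l * G i\<bar> \<le> 3 * M" using f(2)[OF i] unfolding M_def by linarith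
    qed (use M in auto)
    finally have "(f i)\<^sup>2 \<le> (l * G i)\<^sup>2 + 3 * M * (10 * M\<^sup>2 + 10 * M^3)"
      by (simp only: mult.commute[of "3 * M"])
    also have "(l * G i)\<^sup>2 \<le> 1 * (G i)\<^sup>2"
      unfolding power_mult_distrib using l by (intro mult_right_mono) (auto simp: power_le_one)
    also have "1 * (G i)\<^sup>2 \<le> avg S (\<lambda>s. (F s i)\<^sup>2)" unfolding G_def using power2_avg_le[OF S] by simp
    finally show "(f i)\<^sup>2 \<le> avg S (\<lambda>s. (F s i)\<^sup>2) + 3 * M * (10 * M\<^sup>2 + 10 * M^3)" by simp
  qed
  also have "\<dots> = avg S (\<lambda>s. avg I (\<lambda>i. (F s i)\<^sup>2)) + 3 * M * (10 * M\<^sup>2 + 10 * M^3)"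
    by (simp only: avg_add avg_const[OF I] avg_swap[of I S])
  finally show ?thesis unfolding M_def .
qed

section \<open>Messages in softmax coordinates and the two-step contraction\<close>

definition rec_msg :: "'a set \<Rightarrow> 'b set \<Rightarrow> real \<Rightarrow> ('b \<Rightarrow> 'a \<Rightarrow> real) \<Rightarrow> 'a \<Rightarrow> real" where
  "rec_msg I S b p i = (\<Prod>s\<in>S. 1 - b * p s i) / (\<Sum>j\<in>I. \<Prod>s\<in>S. 1 - b * p s j)"

text \<open>The factor d turns the sum over d children in the log-weights of \<open>rec_msg\<close>
  into a mean, so that a bound valid for every child passes to the parent unchanged.\<close>

definition defect :: "'a set \<Rightarrow> nat \<Rightarrow> real \<Rightarrow> ('a \<Rightarrow> real) \<Rightarrow> 'a \<Rightarrow> real" where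
  "defect I d b p k = - real d * (ln (1 - b * p k) - avg I (\<lambda>i. ln (1 - b * p i)))"

definition profile :: "'a set \<Rightarrow> real \<Rightarrow> ('a \<Rightarrow> real) \<Rightarrow> bool" where
  "profile I c y \<longleftrightarrow> (\<exists>X. avg I X = 0 \<and> (\<forall>i\<in>I. - c \<le> X i) \<and>
     (\<forall>i\<in>I. y i = exp (- X i) / (\<Sum>j\<in>I. exp (- X j))))"

lemma profile_deviation:
  fixes c :: real
  assumes I: "finite I" "card I \<ge> 2" and y: "profile I c y" and c: "0 < c" "c \<le> 21/20"
  defines "F \<equiv> \<lambda>i. real (card I) * y i - 1"
  obtains T where "0 \<le> T" "T \<le> exp c - 1" "\<And>i. i \<in> I \<Longrightarrow> F i \<le> T"
    "exp T * avg I (\<lambda>i. exp (- F i)) \<le> exp (exp c - 1)"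
    "\<And>i. i \<in> I \<Longrightarrow> - 1 \<le> F i" "\<And>i. i \<in> I \<Longrightarrow> \<bar>F i\<bar> \<le> real (card I) * c" "avg I F = 0"
proof -
  have I': "I \<noteq> {}" using I by auto
  obtain X where X: "avg I X = 0" "\<And>i. i \<in> I \<Longrightarrow> - c \<le> X i"
    "\<And>i. i \<in> I \<Longrightarrow> y i = exp (- X i) / (\<Sum>j\<in>I. exp (- X j))"
    using y by (auto simp: profile_def)
  define m where "m = avg I (\<lambda>i. exp (- X i))"
  note L = limit_two_step[OF I(1) I' X(1,2), folded m_def]
  have F: "F i = exp (- X i) / m - 1" if "i \<in> I" for i
    using X(3)[OF that] by (simp add: F_def m_def avg_def)
  have Xc: "exp (- X i) \<le> exp c" if "i \<in> I" for i using X(2)[OF that] by simp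
  have up: "F i \<le> exp c / m - 1" if "i \<in> I" for i
    using Xc[OF that] L(1) F[OF that] by (simp add: divide_right_mono)
  have T: "exp c / m - 1 \<le> exp c - 1" using L(1) by (simp add: divide_le_eq)
  have sumX: "(\<Sum>i\<in>I. X i) = 0" using X(1) I by (auto simp: avg_def)
  \<comment> \<open>Mean zero and X \<ge> - c force X i \<le> (q - 1) c. Together with m \<le> exp c
    this bounds F i from below linearly in c, at the price of a factor q.\<close>
  have low: "- (real (card I) * c) \<le> F i" if i: "i \<in> I" for i
  proof -
    have "X i = - (\<Sum>j\<in>I - {i}. X j)" using sumX I i by (simp add: sum.remove[of I i])
    also have "\<dots> \<le> (\<Sum>j\<in>I - {i}. c)" unfolding sum_negf[symmetric] using X(2) by (intro sum_mono) force
    also have "\<dots> = (real (card I) - 1) * c" using I i by (simp add: of_nat_diff Suc_le_eq)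
    finally have "X i + c \<le> real (card I) * c" by (simp add: algebra_simps)
    moreover have "1 + (- X i - c) \<le> exp (- X i) / exp c"
      using exp_ge_add_one_self[of "- X i - c"] by (simp add: exp_diff)
    moreover have "exp (- X i) / exp c \<le> exp (- X i) / m"
      using L by (intro divide_left_mono) (auto intro!: mult_pos_pos)
    ultimately show ?thesis using F[OF i] by linarith
  qed
  show ?thesis
  proof (rule that[of "exp c / m - 1"])
    show "0 \<le> exp c / m - 1" using L by (simp add: field_simps)
    have "avg I (\<lambda>i. exp (- F i)) = avg I (\<lambda>i. exp (- (exp (- X i) / m - 1)))"
      by (intro avg_cong) (simp add: F)
    then show "exp (exp c / m - 1) * avg I (\<lambda>i. exp (- F i)) \<le> exp (exp c - 1)"
      using L(3) by simp
    show "- 1 \<le> F i" if "i \<in> I" for i using F[OF that] L(1) by simp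
    show "\<bar>F i\<bar> \<le> real (card I) * c" if "i \<in> I" for i
    proof -
      have "F i \<le> 2 * c" using up[OF that] T exp_bounds(7)[of c] c by linarith
      also have "2 * c \<le> real (card I) * c" using I c by simp
      finally show ?thesis using low[OF that] by simp
    qed
    have "avg I F = avg I (\<lambda>i. exp (- X i) / m - 1)" by (intro avg_cong F)
    also have "\<dots> = 0" using L(1) by (simp add: avg_diff avg_divide avg_const[OF I(1) I'] m_def[symmetric])
    finally show "avg I F = 0" .
  qed (use T up in auto)
qed

text \<open>The witness X is the mean of the children's defects; the constant \<open>K\<close>,
  common to all colours, drops out in the normalisation.\<close>

lemma rec_msg_profile:
  assumes I: "finite I" "I \<noteq> {}" and S: "finite S" "S \<noteq> {}"
    and pos: "\<And>s i. s \<in> S \<Longrightarrow> i \<in> I \<Longrightarrow> b * p s i < 1"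
    and p: "\<And>s i. s \<in> S \<Longrightarrow> i \<in> I \<Longrightarrow> - c \<le> defect I (card S) b (p s) i"
  shows "profile I c (rec_msg I S b p)"
proof -
  define X where "X i = avg S (\<lambda>s. defect I (card S) b (p s) i)" for i
  define K where "K = (\<Sum>s\<in>S. avg I (\<lambda>i. ln (1 - b * p s i)))"
  have prodX: "(\<Prod>s\<in>S. 1 - b * p s i) = exp K * exp (- X i)" if i: "i \<in> I" for i
  proof -
    have "(\<Prod>s\<in>S. 1 - b * p s i) = (\<Prod>s\<in>S. exp (ln (1 - b * p s i)))"
      using pos i by (intro prod.cong) auto
    also have "\<dots> = exp (\<Sum>s\<in>S. ln (1 - b * p s i))" using S by (simp add: exp_sum)
    also have "(\<Sum>s\<in>S. ln (1 - b * p s i)) = K - X i"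
      using S by (simp add: K_def X_def defect_def sum_eq_card_avg[OF S] avg_cmult avg_diff avg_uminus
          right_diff_distrib)
    finally show ?thesis by (simp add: exp_diff exp_minus field_simps)
  qed
  have "avg I X = avg S (\<lambda>s. avg I (defect I (card S) b (p s)))"
    unfolding X_def by (rule avg_swap)
  also have "\<dots> = avg S (\<lambda>s. 0)"
    unfolding defect_def avg_cmult avg_diff avg_const[OF I] by (simp add: avg_const[OF S])
  finally have "avg I X = 0" by (simp add: avg_const[OF S])
  moreover have "- c \<le> X i" if "i \<in> I" for i unfolding X_def using p that by (intro avg_ge S)
  moreover have "rec_msg I S b p i = exp (- X i) / (\<Sum>j\<in>I. exp (- X j))" if "i \<in> I" for i
    using that prodX by (simp add: rec_msg_def sum_distrib_left[symmetric])
  ultimately show ?thesis unfolding profile_def by blast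
qed

text \<open>The numbers 1 - b p and 1 - a F differ by the constant factor 1 + a, which cancels
  between a logarithm and the mean of the logarithms.\<close>

lemma defect_deviation:
  assumes I: "finite I" "I \<noteq> {}" and b: "b * (1 + a) = a * real (card I)" and a: "0 < a"
    and pos: "\<And>i. i \<in> I \<Longrightarrow> 0 < 1 - a * (real (card I) * p i - 1)" and k: "k \<in> I"
  shows "defect I d b p k = - real d * (ln (1 - a * (real (card I) * p k - 1))
    - avg I (\<lambda>i. ln (1 - a * (real (card I) * p i - 1))))"
proof -
  have "ln (1 - b * p i) = ln (1 - a * (real (card I) * p i - 1)) - ln (1 + a)" if "i \<in> I" for i
  proof -
    have "(1 + a) * (1 - b * p i) = (1 + a) - (b * (1 + a)) * p i" by (simp add: algebra_simps)
    also have "\<dots> = 1 - a * (real (card I) * p i - 1)" unfolding b by (simp add: algebra_simps)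
    finally have "1 - b * p i = (1 - a * (real (card I) * p i - 1)) / (1 + a)"
      using a by (simp add: field_simps)
    then show ?thesis using pos[OF that] a by (simp add: ln_div)
  qed
  then have "avg I (\<lambda>i. ln (1 - b * p i)) = avg I (\<lambda>i. ln (1 - a * (real (card I) * p i - 1)) - ln (1 + a))"
    "ln (1 - b * p k) = ln (1 - a * (real (card I) * p k - 1)) - ln (1 + a)"
    using k by (auto intro: avg_cong)
  then show ?thesis by (simp add: defect_def avg_diff avg_const I)
qed

lemma two_step_defect:
  fixes Q :: real
  assumes I: "finite I" "card I \<ge> 2" and Q: "Q = real (card I)"
    and S: "finite S" "S \<noteq> {}" and a: "0 < a" "a * real (card S) \<le> 1" "20000 * Q^4 * a \<le> 1"
    and b: "b * (1 + a) = a * real (card I)"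
    and y: "\<And>s. s \<in> S \<Longrightarrow> profile I c (y s)" and c: "0 < c" "c \<le> 21/20" and k: "k \<in> I"
  shows "- (c - c^3 / 24) \<le> defect I (card S) b (rec_msg I S b y) k"
proof -
  have I': "I \<noteq> {}" using I by auto
  have Q2: "2 \<le> Q" using I Q by simp
  then have Q1: "1 \<le> Q" by simp
  have Qp: "1 \<le> Q^3" "Q^3 \<le> Q^4" "1 \<le> Q^4" "Q \<le> Q^4" "Q^2 \<le> Q^4"
    using Q1 by (auto intro: one_le_power power_increasing self_le_power)
  have aQ4: "a * Q^4 \<le> 1/20000" using a by (simp add: mult.commute)
  have aQ: "a * Q \<le> 1/20000" "a \<le> 1/20000" "a * Q^3 \<le> 1/20000" "a * Q^2 \<le> 1/20000"
    using aQ4 mult_left_mono[OF Qp(4) less_imp_le[OF a(1)]] mult_left_mono[OF Qp(3) less_imp_le[OF a(1)]]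
      mult_left_mono[OF Qp(2) less_imp_le[OF a(1)]] mult_left_mono[OF Qp(5) less_imp_le[OF a(1)]] by linarith+
  define F where "F s i = Q * y s i - 1" for s i
  have FQ: "F s = (\<lambda>i. real (card I) * y s i - 1)" for s by (simp add: F_def Q fun_eq_iff)
  define V where "V = avg S (\<lambda>s. avg I (\<lambda>i. (F s i)\<^sup>2))"
  define P where "P i = (\<Prod>s\<in>S. 1 - a * F s i)" for i
  define z where "z = rec_msg I S b y"
  define f where "f i = Q * z i - 1" for i
  have F1: "- 1 \<le> F s i" and F2: "\<bar>F s i\<bar> \<le> Q * c" if "s \<in> S" "i \<in> I" for s i
    using profile_deviation[OF I y[OF that(1)] c] that(2) unfolding FQ Q by metis+
  have F3: "avg I (F s) = 0" if "s \<in> S" for s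
    using profile_deviation[OF I y[OF that] c] unfolding FQ by metis
  have aQc: "a * (Q * c) \<le> 1/10000"
    using mult_mono[OF aQ(1) c(2)] a c Q1 by (simp add: mult.assoc)
  have aF: "\<bar>a * F s i\<bar> \<le> 1/10000" if "s \<in> S" "i \<in> I" for s i
    using order_trans[OF mult_left_mono[OF F2[OF that] less_imp_le[OF a(1)]] aQc] a by (simp add: abs_mult)
  have D: "avg I (\<lambda>i. exp ((ln (1 - a * F s i) - ln (1 - a * F s k)) / a))
        \<le> exp (exp c - 1) + (a / 2) * (c\<^sup>2 - avg I (\<lambda>i. (F s i)\<^sup>2)) + 600 * Q^3 * a * c^3"
    if s: "s \<in> S" and k: "k \<in> I" for s k
  proof -
    obtain T where T: "0 \<le> T" "T \<le> exp c - 1" "\<And>i. i \<in> I \<Longrightarrow> F s i \<le> T"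
      "exp T * avg I (\<lambda>i. exp (- F s i)) \<le> exp (exp c - 1)"
      using profile_deviation[OF I y[OF s] c] unfolding FQ by metis
    show ?thesis
      by (rule perturbed_limit_bound[OF I(1) I' F1[OF s] T(3) F2[OF s] T(1,2,4) c Q1 a(1) _ k])
        (use aQ in \<open>auto simp: mult.commute\<close>)
  qed
  have Vs: "avg I (\<lambda>i. (F s i)\<^sup>2) \<le> (Q * c)\<^sup>2" if "s \<in> S" for s
    using F2[OF that] c Q1 by (intro avg_le I(1) I') (simp add: abs_le_square_iff[symmetric])
  have V: "0 \<le> V" "V \<le> (Q * c)\<^sup>2"
    unfolding V_def by (intro avg_ge S I(1) I' zero_le_power2) (rule avg_le[OF S Vs])
  have prodP: "(\<Prod>s\<in>S. 1 - b * y s i) = P i / (1 + a) ^ card S" for i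
  proof -
    have "1 - b * y s i = (1 - a * F s i) / (1 + a)" for s
    proof -
      have "(1 + a) * (1 - b * y s i) = (1 + a) - (b * (1 + a)) * y s i" by (simp add: algebra_simps)
      also have "\<dots> = 1 - a * F s i" unfolding b by (simp add: F_def Q algebra_simps)
      finally show ?thesis using a by (simp add: field_simps)
    qed
    then show ?thesis by (simp add: P_def prod_dividef)
  qed
  have f: "f i = P i / avg I P - 1" for i
    using a Q1 by (simp add: f_def z_def rec_msg_def prodP sum_divide_distrib[symmetric] avg_def Q)
  \<comment> \<open>The one-sided deviation bound after two steps. Its term a c^2 / 2 will be offset
    by the square term in the expansion of ln (1 - a f k), its term a V / 2 by the mean of the
    squares f i.\<close>
  define R where "R = c - c^3 / 12 + (a / 2) * (c\<^sup>2 - V) + 603 * Q^3 * a * c^3"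
  have fR: "- R \<le> f i" if i: "i \<in> I" for i
    unfolding R_def f P_def V_def
  proof (rule two_step_deviation_lower[OF I(1) I' S _ Vs D[OF _ i] c Q1 a(1) _ _ i])
    show "0 < 1 - a * F s i" if "s \<in> S" "i \<in> I" for s i using aF[OF that] by linarith
    show "200 * Q^3 * a \<le> 1" using aQ(3) by (simp add: mult.commute)
    show "a * card S \<le> 1" by (rule a)
  qed auto
  have c3: "0 < c^3" "c^3 \<le> c\<^sup>2 * (21/20)" "c\<^sup>2 \<le> c * (21/20)" "0 < c\<^sup>2"
    using c by (auto simp: power2_eq_square power3_eq_cube)
  have ac2: "a * c\<^sup>2 \<le> c\<^sup>2 / 20000" using mult_right_mono[OF aQ(2), of "c\<^sup>2"] by simp
  have Q3ac3: "Q^3 * a * c^3 \<le> c^3 / 20000" using mult_right_mono[OF aQ(3) less_imp_le[OF c3(1)]] by (simp add: mult.commute[of a])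
  have aV: "0 \<le> a * V" "a * V \<le> c\<^sup>2 / 20000"
  proof -
    have "a * V \<le> a * (Q * c)\<^sup>2" using V a by (intro mult_left_mono) auto
    also have "\<dots> = (a * Q\<^sup>2) * c\<^sup>2" by (simp add: power_mult_distrib)
    also have "\<dots> \<le> (1/20000) * c\<^sup>2" using aQ by (intro mult_right_mono) auto
    finally show "a * V \<le> c\<^sup>2 / 20000" by simp
  qed (use a V in simp)
  have Req: "R = c - c^3 / 12 + (a * c\<^sup>2) / 2 - (a * V) / 2 + 603 * (Q^3 * a * c^3)"
    by (simp add: R_def field_simps)
  have Q3ac30: "0 \<le> Q^3 * a * c^3" using Q1 a c by simp
  have R2: "R \<le> 2 * c" using ac2 aV Q3ac3 c3 c unfolding Req by linarith
  have Rlow: "- (c\<^sup>2) \<le> R - c" using aV Q3ac30 c3 a mult_nonneg_nonneg[of a "c\<^sup>2"] unfolding Req by linarith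
  have Ppos: "0 < P i" if "i \<in> I" for i
    unfolding P_def
  proof (rule prod_pos)
    fix s assume "s \<in> S" then show "0 < 1 - a * F s i" using aF[OF _ that, of s] by linarith
  qed
  have avgP: "avg I P \<noteq> 0"
    unfolding avg_def using sum_pos[OF I(1) I', of P] Ppos I by auto
  have sumf: "(\<Sum>i\<in>I. f i) = 0"
  proof -
    have "avg I f = avg I P / avg I P - 1"
      unfolding f[abs_def] by (simp add: avg_diff avg_divide avg_const[OF I(1) I'])
    then show ?thesis using avgP I by (auto simp: avg_def)
  qed
  have f2: "\<bar>f i\<bar> \<le> 2 * (Q * c)" if i: "i \<in> I" for i
  proof -
    have "f i = - (\<Sum>j\<in>I - {i}. f j)" using sumf I i by (simp add: sum.remove[of I i])
    also have "\<dots> \<le> (\<Sum>j\<in>I - {i}. 2 * c)" unfolding sum_negf[symmetric]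
    proof (rule sum_mono)
      fix j assume "j \<in> I - {i}" then show "- f j \<le> 2 * c" using fR[of j] R2 by simp
    qed
    also have "\<dots> = (Q - 1) * (2 * c)" using I i by (simp add: of_nat_diff Suc_le_eq Q)
    also have "\<dots> \<le> 2 * (Q * c)" using c by (simp add: algebra_simps)
    finally have "f i \<le> 2 * (Q * c)" .
    moreover have "c \<le> Q * c" using Q1 c by simp
    then have "- (2 * (Q * c)) \<le> f i" using fR[OF i] R2 by linarith
    ultimately show ?thesis by linarith
  qed
  define M where "M = 2 * (Q * c)"
  have af: "\<bar>a * f i\<bar> \<le> 1/5000" if "i \<in> I" for i
  proof -
    have "\<bar>a * f i\<bar> = a * \<bar>f i\<bar>" using a by (simp add: abs_mult)
    also have "\<dots> \<le> a * (2 * (Q * c))" using f2[OF that] a by (intro mult_left_mono) auto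
    also have "\<dots> = 2 * (a * (Q * c))" by simp
    finally show ?thesis using aQc by linarith
  qed
  have af3: "\<bar>a * f i\<bar>^3 \<le> a^3 * M^3" if "i \<in> I" for i
  proof -
    have "\<bar>a * f i\<bar>^3 = a^3 * \<bar>f i\<bar>^3" using a by (simp add: abs_mult power_mult_distrib)
    also have "\<dots> \<le> a^3 * M^3"
      unfolding M_def using f2[OF that] a by (intro mult_left_mono power_mono) auto
    finally show ?thesis .
  qed
  \<comment> \<open>\<open>W \<le> V\<close> up to cubic terms makes the \<open>V\<close> in \<open>R\<close> cancel against the mean of \<open>ln (1 - a f)\<close>.\<close>
  define W where "W = avg I (\<lambda>i. (f i)\<^sup>2)"
  have W: "W \<le> V + 62 * (Q^4 * c^3)"
  proof -
    have "W \<le> V + 3 * (Q * c) * (10 * (Q * c)\<^sup>2 + 10 * (Q * c)^3)"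
      unfolding W_def V_def
      by (rule two_step_deviation_square[OF I(1) I' S F1 F2 F3 c(1) Q1 a(1) _ a(2) _ f2])
        (use aQc f in \<open>auto simp: P_def[abs_def]\<close>)
    also have "3 * (Q * c) * (10 * (Q * c)\<^sup>2 + 10 * (Q * c)^3) = 30 * (Q^3 * c^3) + 30 * (Q^4 * c^3) * c"
      by (simp add: power2_eq_square power3_eq_cube power4_eq_xxxx algebra_simps)
    also have "\<dots> \<le> 30 * (Q^4 * c^3) + 30 * (Q^4 * c^3) * (21/20)"
      using Qp c Q1 by (intro add_mono mult_left_mono mult_right_mono) auto
    also have "\<dots> \<le> 62 * (Q^4 * c^3)" using Q1 c by simp
    finally show ?thesis by simp
  qed
  have lnk: "ln (1 - a * f k) \<le> - (a * f k) - (a * f k)\<^sup>2 / 2 + a^3 * M^3"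
    using ln_one_minus_taylor[of "a * f k"] af[OF k] af3[OF k] by linarith
  have "avg I (\<lambda>i. (- a) * f i - (a\<^sup>2 / 2) * (f i)\<^sup>2 - a^3 * M^3) \<le> avg I (\<lambda>i. ln (1 - a * f i))"
  proof (rule avg_mono)
    fix i assume i: "i \<in> I"
    have "(a * f i)\<^sup>2 / 2 = (a\<^sup>2 / 2) * (f i)\<^sup>2" by (simp add: power_mult_distrib)
    then show "(- a) * f i - (a\<^sup>2 / 2) * (f i)\<^sup>2 - a^3 * M^3 \<le> ln (1 - a * f i)"
      using ln_one_minus_taylor[of "a * f i"] af[OF i] af3[OF i] by linarith
  qed
  moreover have "avg I f = 0" using sumf by (simp add: avg_def)
  ultimately have lnavg: "- (a\<^sup>2 / 2) * W - a^3 * M^3 \<le> avg I (\<lambda>i. ln (1 - a * f i))"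
    by (simp only: avg_diff avg_cmult avg_const[OF I(1) I'] W_def)
  define l where "l = a * card S"
  have l: "0 \<le> l" "l \<le> 1" using a by (auto simp: l_def)
  have dz: "defect I (card S) b z k = - real (card S) * (ln (1 - a * f k) - avg I (\<lambda>i. ln (1 - a * f i)))"
    unfolding f_def Q
  proof (rule defect_deviation[OF I(1) I' b a(1) _ k])
    fix i assume "i \<in> I"
    then show "0 < 1 - a * (real (card I) * z i - 1)"
      using af[of i] unfolding f_def Q by linarith
  qed
  have "real (card S) * (a * f k + (a * f k)\<^sup>2 / 2 - (a\<^sup>2 / 2) * W - 2 * a^3 * M^3)
      \<le> real (card S) * (- (ln (1 - a * f k) - avg I (\<lambda>i. ln (1 - a * f i))))"
  proof (intro mult_left_mono)
    show "a * f k + (a * f k)\<^sup>2 / 2 - (a\<^sup>2 / 2) * W - 2 * a^3 * M^3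
        \<le> - (ln (1 - a * f k) - avg I (\<lambda>i. ln (1 - a * f i)))"
      using lnk lnavg by linarith
  qed simp
  also have "\<dots> = defect I (card S) b z k" unfolding dz by (simp only: mult_minus_left mult_minus_right)
  also have "real (card S) * (a * f k + (a * f k)\<^sup>2 / 2 - (a\<^sup>2 / 2) * W - 2 * a^3 * M^3)
      = l * (f k + a * (f k)\<^sup>2 / 2 - (a / 2) * W - 2 * a\<^sup>2 * M^3)"
    by (simp add: l_def power2_eq_square power3_eq_cube algebra_simps)
  finally have main: "l * (f k + a * (f k)\<^sup>2 / 2 - (a / 2) * W - 2 * a\<^sup>2 * M^3) \<le> defect I (card S) b z k" .
  \<comment> \<open>Monotonicity of t + a t^2 / 2, applied to f k \<ge> - R; the square term a R^2 /
    2 then offsets the a c^2 / 2 contained in \<open>R\<close>.\<close>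
  have "- R + a * R\<^sup>2 / 2 \<le> f k + a * (f k)\<^sup>2 / 2"
  proof -
    have "a * (- (4 * c)) \<le> a * (f k - R)" using fR[OF k] R2 a by (intro mult_left_mono) auto
    moreover have "a * c \<le> 1/10000"
      using mult_mono[OF aQ(2) c(2)] a c by simp
    ultimately have "0 \<le> 1 + (a * (f k - R)) / 2" by linarith
    then have "0 \<le> (f k + R) * (1 + (a * (f k - R)) / 2)"
      using fR[OF k] by (intro mult_nonneg_nonneg) auto
    then show ?thesis by (simp add: power2_eq_square algebra_simps add_divide_distrib diff_divide_distrib)
  qed
  moreover have "a * (c\<^sup>2 - 2 * c^3) \<le> a * R\<^sup>2"
  proof (intro mult_left_mono)
    have "R\<^sup>2 = c\<^sup>2 + (2 * c) * (R - c) + (R - c)\<^sup>2" by (simp add: power2_eq_square algebra_simps)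
    moreover have "(2 * c) * (- (c\<^sup>2)) \<le> (2 * c) * (R - c)" using Rlow c by (intro mult_left_mono) auto
    moreover have "(2 * c) * (- (c\<^sup>2)) = - (2 * c^3)" by (simp add: power2_eq_square power3_eq_cube)
    ultimately show "c\<^sup>2 - 2 * c^3 \<le> R\<^sup>2" using zero_le_power2[of "R - c"] by linarith
  qed (use a in simp)
  then have "a * c\<^sup>2 - 2 * (a * c^3) \<le> a * R\<^sup>2" by (simp add: algebra_simps)
  moreover have "a * c^3 \<le> c^3 / 20000" using mult_right_mono[OF aQ(2) less_imp_le[OF c3(1)]] by simp
  moreover have "(a / 2) * W \<le> (a * V) / 2 + 31 * (c^3 / 20000)"
  proof -
    have "a * W \<le> a * (V + 62 * (Q^4 * c^3))" using W a by (intro mult_left_mono) auto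
    also have "\<dots> = a * V + 62 * ((a * Q^4) * c^3)" by (simp add: algebra_simps)
    also have "(a * Q^4) * c^3 \<le> (1/20000) * c^3" using aQ4 c by (intro mult_right_mono) auto
    finally show ?thesis by simp
  qed
  moreover have "2 * a\<^sup>2 * M^3 \<le> 16 * (c^3 / 20000)"
  proof -
    have "2 * a\<^sup>2 * M^3 = 16 * (a * ((a * Q^3) * c^3))"
      by (simp add: M_def power2_eq_square power3_eq_cube)
    also have "\<dots> \<le> 16 * (1 * ((1/20000) * c^3))"
      using aQ a c Q1 by (intro mult_left_mono mult_mono) auto
    finally show ?thesis by simp
  qed
  \<comment> \<open>Error count in units of c^3 / 20000: 603 from \<open>R\<close>, 1 from a R^2 /
    2, 31 from \<open>W\<close> and 16 from the Taylor remainders. The sum 651 is below 20000 / 24,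
    so half of the gain c^3 / 12 survives.\<close>
  ultimately have "- (c - c^3 / 24) \<le> f k + a * (f k)\<^sup>2 / 2 - (a / 2) * W - 2 * a\<^sup>2 * M^3"
    using Q3ac3 c3(1) unfolding Req by linarith
  then have "l * (- (c - c^3 / 24)) \<le> defect I (card S) b z k"
    using main mult_left_mono[OF _ l(1)] order_trans by blast
  moreover have "1 * (- (c - c^3 / 24)) \<le> l * (- (c - c^3 / 24))"
  proof (rule mult_right_mono_neg[OF l(2)])
    have "c^3 = c * c\<^sup>2" by (simp add: power2_eq_square power3_eq_cube)
    also have "\<dots> \<le> c * (24)" using c3 c by (intro mult_left_mono) auto
    finally show "- (c - c^3 / 24) \<le> 0" by simp
  qed
  ultimately show ?thesis unfolding z_def mult_1 by (rule order_trans[rotated])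
qed

section \<open>Starting value and iteration of the contraction\<close>

lemma rec_msg_prob:
  assumes I: "finite I" "I \<noteq> {}" and S: "finite S"
    and pos: "\<And>s i. s \<in> S \<Longrightarrow> i \<in> I \<Longrightarrow> b * p s i < 1"
  shows "\<And>i. i \<in> I \<Longrightarrow> 0 \<le> rec_msg I S b p i" "(\<Sum>i\<in>I. rec_msg I S b p i) = 1"
proof -
  have P: "0 < (\<Prod>s\<in>S. 1 - b * p s i)" if "i \<in> I" for i using pos that by (intro prod_pos) auto
  then have "0 < (\<Sum>i\<in>I. \<Prod>s\<in>S. 1 - b * p s i)" using I by (intro sum_pos) auto
  then show "\<And>i. i \<in> I \<Longrightarrow> 0 \<le> rec_msg I S b p i" "(\<Sum>i\<in>I. rec_msg I S b p i) = 1"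
    using P by (auto simp: rec_msg_def sum_divide_distrib[symmetric] less_imp_le)
qed

text \<open>From p k \<ge> 0 one gets f k \<ge> -1, hence ln (1 - a f k) \<le> a, which after
  multiplication by d \<le> 1/a contributes at most 1. The second-order terms in the mean of the
  logarithms cost at most another 1/20, because a q^2 is small.\<close>

lemma defect_prob_ge:
  fixes Q :: real
  assumes I: "finite I" "I \<noteq> {}" and Q: "Q = real (card I)"
    and a: "0 < a" "a * real d \<le> 1" "20000 * Q^4 * a \<le> 1" and b: "b * (1 + a) = a * real (card I)"
    and p: "\<And>i. i \<in> I \<Longrightarrow> 0 \<le> p i" "(\<Sum>i\<in>I. p i) = 1" and k: "k \<in> I"
  shows "- (21/20) \<le> defect I d b p k"
proof -
  define f where "f i = Q * p i - 1" for i
  have Q1: "1 \<le> Q" using I Q by (simp add: Suc_le_eq card_gt_0_iff)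
  have Q4: "Q \<le> Q^4" "Q^2 \<le> Q^4" using Q1 by (auto intro: power_increasing self_le_power)
  have aQ: "a * Q \<le> 1/20000" "a * Q^2 \<le> 1/20000"
    using a(3) mult_left_mono[OF Q4(1) less_imp_le[OF a(1)]] mult_left_mono[OF Q4(2) less_imp_le[OF a(1)]]
    by (simp_all add: mult.commute)
  have p1: "p i \<le> 1" if "i \<in> I" for i
    using member_le_sum[of i I p] p I that by auto
  have f: "- 1 \<le> f i" "\<bar>f i\<bar> \<le> Q" if i: "i \<in> I" for i
  proof -
    show "- 1 \<le> f i" using p(1)[OF i] Q1 by (simp add: f_def)
    moreover have "Q * p i \<le> Q * 1" using p1[OF i] Q1 by (intro mult_left_mono) auto
    ultimately show "\<bar>f i\<bar> \<le> Q" using Q1 unfolding f_def by linarith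
  qed
  have af: "\<bar>a * f i\<bar> \<le> 1/2" if "i \<in> I" for i
  proof -
    have "\<bar>a * f i\<bar> = a * \<bar>f i\<bar>" using a by (simp add: abs_mult)
    also have "\<dots> \<le> a * Q" using f[OF that] a by (intro mult_left_mono) auto
    finally show ?thesis using aQ by linarith
  qed
  have avgf: "avg I f = 0"
    using p(2) Q I unfolding f_def[abs_def] avg_diff avg_cmult avg_const[OF I] by (auto simp: avg_def)
  have "ln (1 - a * f k) \<le> - (a * f k)"
    using ln_add_one_self_le_self2[of "- (a * f k)"] af[OF k] by (simp add: abs_le_iff)
  also have "\<dots> \<le> a" using mult_left_mono[OF f(1)[OF k] less_imp_le[OF a(1)]] by simp
  finally have lnk: "ln (1 - a * f k) \<le> a" .
  have "avg I (\<lambda>i. (- a) * f i - a / 20) \<le> avg I (\<lambda>i. ln (1 - a * f i))"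
  proof (rule avg_mono)
    fix i assume i: "i \<in> I"
    have "\<bar>a * f i\<bar>^3 = \<bar>a * f i\<bar> * (a * f i)\<^sup>2" by (simp add: power2_eq_square power3_eq_cube)
    also have "\<dots> \<le> (1/2) * (a * f i)\<^sup>2" using af[OF i] by (intro mult_right_mono) auto
    finally have "- (a * f i) - (a * f i)\<^sup>2 \<le> ln (1 - a * f i)"
      using ln_one_minus_taylor[of "a * f i"] af[OF i] by linarith
    moreover have "(a * f i)\<^sup>2 \<le> a / 20"
    proof -
      have "(a * f i)\<^sup>2 = a * (a * \<bar>f i\<bar>\<^sup>2)" by (simp add: power2_eq_square)
      also have "\<dots> \<le> a * (a * Q\<^sup>2)" using f[OF i] a by (intro mult_left_mono power_mono) auto
      also have "\<dots> \<le> a * (1 / 20)" using aQ a by (intro mult_left_mono) auto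
      finally show ?thesis by simp
    qed
    ultimately show "(- a) * f i - a / 20 \<le> ln (1 - a * f i)" by simp
  qed
  then have "- (a / 20) \<le> avg I (\<lambda>i. ln (1 - a * f i))"
    unfolding avg_diff avg_cmult avgf avg_const[OF I] by simp
  with lnk have "ln (1 - a * f k) - avg I (\<lambda>i. ln (1 - a * f i)) \<le> (21/20) * a" by linarith
  from mult_left_mono[OF this, of "real d"]
  have "real d * (ln (1 - a * f k) - avg I (\<lambda>i. ln (1 - a * f i))) \<le> (21/20) * (a * real d)"
    by (simp only: mult.assoc mult.left_commute mult.commute)
  also have "\<dots> \<le> (21/20) * 1" using a by (intro mult_left_mono) auto
  finally have "- (21/20) \<le> - real d * (ln (1 - a * f k) - avg I (\<lambda>i. ln (1 - a * f i)))" by simp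
  also have "\<dots> = defect I d b p k"
    unfolding f_def Q
  proof (rule defect_deviation[OF I b a(1) _ k, symmetric])
    fix i assume "i \<in> I"
    then show "0 < 1 - a * (real (card I) * p i - 1)" using af[of i] unfolding f_def Q by linarith
  qed
  finally show ?thesis .
qed

primrec contraction_radius :: "nat \<Rightarrow> real" where
  "contraction_radius 0 = 21/20"
| "contraction_radius (Suc n) = contraction_radius n - contraction_radius n ^ 3 / 24"

lemma contraction_radius_bounds: "0 < contraction_radius n \<and> contraction_radius n \<le> 21/20"
proof (induction n)
  case (Suc n)
  let ?c = "contraction_radius n"
  have "?c^2 < 24" using Suc power_mono[of ?c "21/20" 2] by (simp add: power2_eq_square)
  then have "?c * ?c^2 < ?c * 24" using Suc by (intro mult_strict_left_mono) auto
  moreover have "?c * ?c^2 = ?c^3" by (simp add: power2_eq_square power3_eq_cube)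
  ultimately have "0 < ?c - ?c^3 / 24" by simp
  moreover have "0 \<le> ?c^3" using Suc by simp
  ultimately show ?case using Suc unfolding contraction_radius.simps by linarith
qed simp

lemma contraction_radius_tendsto: "contraction_radius \<longlonglongrightarrow> 0"
proof -
  have "decseq contraction_radius"
    using contraction_radius_bounds by (intro decseq_SucI) (simp add: less_imp_le)
  then obtain L where L: "contraction_radius \<longlonglongrightarrow> L"
    using decseq_convergent[of contraction_radius 0] contraction_radius_bounds by (metis less_imp_le)
  then have "(\<lambda>n. contraction_radius n - contraction_radius n ^ 3 / 24) \<longlonglongrightarrow> L - L^3 / 24"
    by (intro tendsto_diff tendsto_divide tendsto_power tendsto_const) auto
  moreover have "(\<lambda>n. contraction_radius n - contraction_radius n ^ 3 / 24) \<longlonglongrightarrow> L"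
    using LIMSEQ_Suc[OF L] by simp
  ultimately have "L - L^3 / 24 = L" by (rule LIMSEQ_unique)
  then have "L = 0" by simp
  with L show ?thesis by simp
qed

text \<open>\<open>P n\<close> stands for all messages that can occur n generations above the
  boundary. Assuming only that each element of \<open>P (Suc n)\<close> arises from d elements of
  \<open>P n\<close> makes the convergence uniform in the boundary condition and in the
  vertex.\<close>

lemma message_contraction:
  fixes P :: "nat \<Rightarrow> ('a \<Rightarrow> real) \<Rightarrow> bool" and b \<epsilon> :: real
  assumes I: "finite I" "card I \<ge> 2"
    and d: "20000 * real (card I) ^ 4 \<le> real d"
    and b: "0 < b" "b * (real d + 1) \<le> real (card I)"
    and P0: "\<And>p. P 0 p \<Longrightarrow> (\<forall>i\<in>I. 0 \<le> p i) \<and> (\<Sum>i\<in>I. p i) = 1"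
    and PSuc: "\<And>n p. P (Suc n) p \<Longrightarrow> \<exists>(S :: 'b set) ps. finite S \<and> card S = d \<and>
      (\<forall>s\<in>S. P n (ps s)) \<and> p = rec_msg I S b ps"
    and \<epsilon>: "0 < \<epsilon>"
  shows "\<exists>N. \<forall>n\<ge>N. \<forall>p. P n p \<longrightarrow> (\<forall>i\<in>I. \<bar>real (card I) * p i - 1\<bar> \<le> \<epsilon>)"
proof -
  define Q where "Q = real (card I)"
  have I': "I \<noteq> {}" using I by auto
  have Q2: "2 \<le> Q" using I by (simp add: Q_def)
  have d1: "1 \<le> real d"
  proof -
    have "1 \<le> Q^4" using Q2 by (intro one_le_power) auto
    then show ?thesis using d unfolding Q_def by linarith
  qed
  have bQ: "b < Q"
  proof -
    have "b * 2 \<le> b * (real d + 1)" using b d1 by (intro mult_left_mono) auto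
    then show ?thesis using b unfolding Q_def by linarith
  qed
  have b1: "b < 1"
  proof (rule ccontr)
    assume "\<not> b < 1"
    then have "1 * (real d + 1) \<le> b * (real d + 1)" by (intro mult_right_mono) auto
    then have "real d + 1 \<le> Q" using b(2) unfolding Q_def by (simp only: mult_1)
    moreover have "Q \<le> Q^4" using Q2 by (intro self_le_power) auto
    then have "20000 * Q \<le> real d" using d unfolding Q_def by linarith
    ultimately show False using d1 by linarith
  qed
  \<comment> \<open>This solves b (1 + a) = a q; then a d \<le> 1 is the hypothesis b (d + 1) \<le>
    q rearranged.\<close>
  define a where "a = b / (Q - b)"
  have a0: "0 < a" using b bQ by (simp add: a_def)
  have ba: "b * (1 + a) = a * real (card I)"
    using bQ unfolding Q_def[symmetric] by (simp add: a_def field_simps)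
  have ad: "a * real d \<le> 1" using b bQ unfolding Q_def[symmetric] by (simp add: a_def field_simps)
  have aQ: "20000 * Q^4 * a \<le> 1"
    using order_trans[OF mult_left_mono[OF d less_imp_le[OF a0]] ad] by (simp add: Q_def mult.commute)
  have probP: "(\<forall>i\<in>I. 0 \<le> p i) \<and> (\<Sum>i\<in>I. p i) = 1" if "P n p" for n p
    using that
  proof (induction n arbitrary: p)
    case 0 then show ?case by (rule P0)
  next
    case (Suc n)
    obtain S :: "'b set" and ps where S: "finite S" "\<forall>s\<in>S. P n (ps s)" "p = rec_msg I S b ps"
      using PSuc[OF Suc.prems] by blast
    have "b * ps s i < 1" if "s \<in> S" "i \<in> I" for s i
    proof -
      have "ps s i \<le> 1"
        using member_le_sum[of i I "ps s"] Suc.IH[of "ps s"] S I that by auto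
      then have "b * ps s i \<le> b * 1" using b by (intro mult_left_mono) auto
      then show ?thesis using b1 by simp
    qed
    then show ?case using rec_msg_prob[OF I(1) I' S(1), of b ps] S(3) by auto
  qed
  have posP: "b * p i < 1" if "P n p" "i \<in> I" for n p i
  proof -
    have "p i \<le> 1" using member_le_sum[of i I p] probP[OF that(1)] I that by auto
    then have "b * p i \<le> b * 1" using b by (intro mult_left_mono) auto
    then show ?thesis using b1 by simp
  qed
  have prof: "profile I c p" if "P (Suc n) p" "\<And>p i. P n p \<Longrightarrow> i \<in> I \<Longrightarrow> - c \<le> defect I d b p i" for n p c
  proof -
    obtain S :: "'b set" and ps where S: "finite S" "card S = d" "\<forall>s\<in>S. P n (ps s)" "p = rec_msg I S b ps"
      using PSuc[OF \<open>P (Suc n) p\<close>] by blast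
    have "S \<noteq> {}" using S d1 by auto
    then show ?thesis unfolding S(4) using S that(2) posP by (intro rec_msg_profile I I') auto
  qed
  \<comment> \<open>One contraction uses up two generations; the offset r covers both parities and
    starts the induction at any height.\<close>
  have defP: "- contraction_radius m \<le> defect I d b p i"
    if "P (2 * m + r) p" "i \<in> I" for m r p i
    using that
  proof (induction m arbitrary: p i)
    case 0
    then show ?case
      using defect_prob_ge[OF I(1) I' Q_def a0 ad aQ ba, of p i] probP[of r p] by simp
  next
    case (Suc m)
    have "P (Suc (Suc (2 * m + r))) p" using Suc.prems by simp
    then obtain S :: "'b set" and ps where S: "finite S" "card S = d" "\<forall>s\<in>S. P (Suc (2 * m + r)) (ps s)"
        "p = rec_msg I S b ps"
      using PSuc by blast
    have Sne: "S \<noteq> {}" using S d1 by auto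
    have "profile I (contraction_radius m) (ps s)" if "s \<in> S" for s
      using prof[of "2 * m + r" "ps s"] S(3) that Suc.IH by blast
    then show ?case
      using two_step_defect[OF I Q_def S(1) Sne a0 _ aQ ba, where y = ps and c = "contraction_radius m" and k = i]
        contraction_radius_bounds[of m] S ad Suc.prems by simp
  qed
  \<comment> \<open>One more recursion step leads from a bound on defects to a profile, hence
    \<open>Suc r\<close>.\<close>
  have close: "\<bar>Q * p i - 1\<bar> \<le> Q * contraction_radius m" if "P (2 * m + Suc r) p" "i \<in> I" for m r p i
  proof -
    have "profile I (contraction_radius m) p"
      using prof[of "2 * m + r" p "contraction_radius m"] defP[of m r] that by auto
    then show ?thesis
      using profile_deviation[OF I, where c = "contraction_radius m" and y = p] contraction_radius_bounds[of m] that(2)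
      unfolding Q_def by metis
  qed
  have "(\<lambda>m. Q * contraction_radius m) \<longlonglongrightarrow> Q * 0" by (intro tendsto_intros contraction_radius_tendsto)
  then have "\<forall>\<^sub>F m in sequentially. Q * contraction_radius m < \<epsilon>" using \<epsilon> by (simp add: order_tendsto_iff)
  then obtain m where m: "Q * contraction_radius m < \<epsilon>" by (auto simp: eventually_sequentially)
  show ?thesis
  proof (intro exI[of _ "2 * m + 1"] allI impI ballI)
    fix n p i assume n: "2 * m + 1 \<le> n" and p: "P n p" and i: "i \<in> I"
    then obtain r where "n = 2 * m + Suc r" by (metis add_Suc_right add.assoc le_Suc_ex Suc_eq_plus1 add.commute)
    then show "\<bar>real (card I) * p i - 1\<bar> \<le> \<epsilon>"
      using close[of m r p i] p i m unfolding Q_def by simp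
  qed
qed

section \<open>The Potts model on balls of the tree\<close>

text \<open>An edge inside U is represented by its endpoint farther from the root, so products over
  edges become products over vertices.\<close>

definition nonroots :: "nat list set \<Rightarrow> nat list set" where
  "nonroots U = {u \<in> U. u \<noteq> [] \<and> tl u \<in> U}"

definition potts_weight :: "real \<Rightarrow> nat list set \<Rightarrow> (nat list \<Rightarrow> nat) \<Rightarrow> real" where
  "potts_weight w U \<sigma> = (\<Prod>u\<in>nonroots U. if \<sigma> (tl u) = \<sigma> u then w else 1)"

lemma finite_nonroots: "finite U \<Longrightarrow> finite (nonroots U)"
  by (simp add: nonroots_def)

lemma potts_weight_pos: "0 < w \<Longrightarrow> 0 < potts_weight w U \<sigma>"
  unfolding potts_weight_def by (intro prod_pos) auto

lemma potts_weight_cong: "(\<And>u. u \<in> U \<Longrightarrow> \<sigma> u = \<tau> u) \<Longrightarrow> potts_weight w U \<sigma> = potts_weight w U \<tau>"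
  unfolding potts_weight_def by (intro prod.cong) (auto simp: nonroots_def)

lemma inj_on_parent_edge: "inj_on (\<lambda>u. {tl u, u}) {u :: 'a list. u \<noteq> []}"
proof (rule inj_onI)
  fix u v :: "'a list" assume uv: "u \<in> {u. u \<noteq> []}" "v \<in> {u. u \<noteq> []}" and eq: "{tl u, u} = {tl v, v}"
  have "length (tl u) < length u" "length (tl v) < length v" using uv by auto
  then show "u = v" using eq by (metis doubleton_eq_iff less_asym)
qed

lemma potts_weight_eq:
  assumes "finite U" "U \<subseteq> tree_verts \<Delta>"
  shows "w ^ mono_edges (induced_edges (tree_edges \<Delta>) U) \<sigma> = potts_weight w U \<sigma>"
proof -
  let ?N = "{u \<in> nonroots U. \<sigma> (tl u) = \<sigma> u}"
  have "{e \<in> induced_edges (tree_edges \<Delta>) U. \<exists>u v. e = {u, v} \<and> \<sigma> u = \<sigma> v} = (\<lambda>u. {tl u, u}) ` ?N"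
  proof (intro equalityI subsetI)
    fix e assume e: "e \<in> {e \<in> induced_edges (tree_edges \<Delta>) U. \<exists>u v. e = {u, v} \<and> \<sigma> u = \<sigma> v}"
    then obtain i v where iv: "e = {v, i # v}" "v \<in> tree_verts \<Delta>" "i # v \<in> tree_verts \<Delta>"
      by (auto simp: induced_edges_def tree_edges_def)
    moreover have "\<sigma> v = \<sigma> (i # v)" using e iv(1) by (auto simp: doubleton_eq_iff)
    moreover have "v \<in> U" "i # v \<in> U" using e iv(1) by (auto simp: induced_edges_def)
    ultimately have "i # v \<in> ?N" "e = {tl (i # v), i # v}" by (auto simp: nonroots_def)
    then show "e \<in> (\<lambda>u. {tl u, u}) ` ?N" by blast
  next
    fix e assume "e \<in> (\<lambda>u. {tl u, u}) ` ?N"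
    then obtain u where u: "u \<in> U" "u \<noteq> []" "tl u \<in> U" "\<sigma> (tl u) = \<sigma> u" "e = {tl u, u}"
      by (auto simp: nonroots_def)
    then obtain i v where "u = i # v" by (cases u) auto
    then have "e \<in> tree_edges \<Delta>" using u assms(2) by (auto simp: tree_edges_def)
    then show "e \<in> {e \<in> induced_edges (tree_edges \<Delta>) U. \<exists>u v. e = {u, v} \<and> \<sigma> u = \<sigma> v}"
      using u by (auto simp: induced_edges_def)
  qed
  moreover have "inj_on (\<lambda>u. {tl u, u}) ?N"
    by (rule inj_on_subset[OF inj_on_parent_edge]) (auto simp: nonroots_def)
  ultimately have "mono_edges (induced_edges (tree_edges \<Delta>) U) \<sigma> = card ?N"
    by (simp add: mono_edges_def card_image)
  moreover have "potts_weight w U \<sigma> = w ^ card ?N"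
    using finite_nonroots[OF assms(1)]
    by (simp add: potts_weight_def prod.inter_filter[symmetric])
  ultimately show ?thesis by simp
qed

lemma sum_PiE_Un:
  assumes "A \<inter> B = {}"
  shows "(\<Sum>\<sigma>\<in>(A \<union> B) \<rightarrow>\<^sub>E X. h \<sigma>) = (\<Sum>\<tau>\<in>B \<rightarrow>\<^sub>E X. \<Sum>\<rho>\<in>A \<rightarrow>\<^sub>E X. h (override_on \<tau> \<rho> A))"
proof -
  have "(\<Sum>\<sigma>\<in>(A \<union> B) \<rightarrow>\<^sub>E X. h \<sigma>) = (\<Sum>(\<tau>, \<rho>)\<in>(B \<rightarrow>\<^sub>E X) \<times> (A \<rightarrow>\<^sub>E X). h (override_on \<tau> \<rho> A))"
  proof (rule sum.reindex_bij_witness[where j = "\<lambda>\<sigma>. (restrict \<sigma> B, restrict \<sigma> A)"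
      and i = "\<lambda>(\<tau>, \<rho>). override_on \<tau> \<rho> A"], goal_cases)
    case (1 \<sigma>)
    then show ?case using assms
      by (auto simp: override_on_def fun_eq_iff PiE_def extensional_def)
  next
    case (3 x)
    then show ?case using assms
      by (auto simp: override_on_def fun_eq_iff PiE_def extensional_def restrict_def)
  next
    case (4 x)
    then show ?case using assms by (auto simp: override_on_def PiE_def extensional_def)
  next
    case (5 \<sigma>)
    then have "override_on (restrict \<sigma> B) (restrict \<sigma> A) A = \<sigma>" using assms
      by (auto simp: override_on_def fun_eq_iff PiE_def extensional_def restrict_def)
    then show ?case by simp
  qed (use assms in \<open>auto simp: PiE_def\<close>)
  then show ?thesis by (simp add: sum.cartesian_product)
qed

text \<open>The finite-volume specification: the conditional law on A given the values of
  \<open>\<phi>\<close> on U - A. Letting \<open>\<phi>\<close> be a configuration of the whole tree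
  makes the kernel a function on configuration space.\<close>

definition gibbs_kernel ::
  "nat list set \<Rightarrow> nat list set \<Rightarrow> nat \<Rightarrow> real \<Rightarrow> (nat list \<Rightarrow> nat) \<Rightarrow> (nat list \<Rightarrow> nat) \<Rightarrow> real" where
  "gibbs_kernel U A q w \<phi> \<rho> =
     potts_weight w U (override_on \<phi> \<rho> A) / (\<Sum>\<rho>'\<in>A \<rightarrow>\<^sub>E {1..q}. potts_weight w U (override_on \<phi> \<rho>' A))"

lemma gibbs_kernel_pos:
  assumes "finite A" "0 < w" "1 \<le> q"
  shows "0 < gibbs_kernel U A q w \<phi> \<rho>"
proof -
  have "(\<lambda>x\<in>A. 1) \<in> A \<rightarrow>\<^sub>E {1..q}" using assms by auto
  then have "A \<rightarrow>\<^sub>E {1..q} \<noteq> {}" by blast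
  then have "0 < (\<Sum>\<rho>'\<in>A \<rightarrow>\<^sub>E {1..q}. potts_weight w U (override_on \<phi> \<rho>' A))"
    using assms by (intro sum_pos potts_weight_pos finite_PiE) auto
  then show ?thesis using assms by (simp add: gibbs_kernel_def potts_weight_pos)
qed

lemma gibbs_kernel_sum:
  assumes "finite A" "0 < w" "1 \<le> q"
  shows "(\<Sum>\<rho>\<in>A \<rightarrow>\<^sub>E {1..q}. gibbs_kernel U A q w \<phi> \<rho>) = 1"
proof -
  have "(\<lambda>x\<in>A. 1) \<in> A \<rightarrow>\<^sub>E {1..q}" using assms by auto
  then have "A \<rightarrow>\<^sub>E {1..q} \<noteq> {}" by blast
  then have "0 < (\<Sum>\<rho>'\<in>A \<rightarrow>\<^sub>E {1..q}. potts_weight w U (override_on \<phi> \<rho>' A))"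
    using assms by (intro sum_pos potts_weight_pos finite_PiE) auto
  then show ?thesis by (simp add: gibbs_kernel_def sum_divide_distrib[symmetric])
qed

text \<open>The partition function of U cancels in the quotient; what remains in the denominator is
  the sum over all completions on A.\<close>

lemma cond_prob_potts_measure:
  assumes U: "finite U" "U \<subseteq> tree_verts \<Delta>" and w: "0 < w" and q: "1 \<le> q"
    and AB: "A \<union> B = U" "A \<inter> B = {}" and \<phi>: "\<And>x. x \<in> U \<Longrightarrow> \<phi> x \<in> {1..q}"
  shows "\<P>(\<Phi> in potts_measure U (induced_edges (tree_edges \<Delta>) U) q w.
      restrict \<Phi> A = restrict \<phi> A \<bar> restrict \<Phi> B = restrict \<phi> B) = gibbs_kernel U A q w \<phi> (restrict \<phi> A)"
proof -
  let ?X = "U \<rightarrow>\<^sub>E {1..q}"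
  let ?Z = "\<Sum>\<sigma>\<in>?X. potts_weight w U \<sigma>"
  let ?M = "potts_measure U (induced_edges (tree_edges \<Delta>) U) q w"
  have finX: "finite ?X" using U by (intro finite_PiE) auto
  have "restrict \<phi> U \<in> ?X" using \<phi> by auto
  then have "?X \<noteq> {}" by blast
  then have Z: "0 < ?Z" using w finX by (intro sum_pos potts_weight_pos) auto
  have M: "?M = point_measure ?X (\<lambda>\<phi>. ennreal (potts_weight w U \<phi> / ?Z))"
    unfolding potts_measure_def potts_weight_eq[OF U] ..
  have meas: "measure ?M S = (\<Sum>\<sigma>\<in>S. potts_weight w U \<sigma>) / ?Z" if "S \<subseteq> ?X" for S
  proof -
    have "emeasure ?M S = (\<Sum>\<sigma>\<in>S. ennreal (potts_weight w U \<sigma> / ?Z))"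
      unfolding M using finX that by (rule emeasure_point_measure_finite)
    also have "\<dots> = ennreal (\<Sum>\<sigma>\<in>S. potts_weight w U \<sigma> / ?Z)"
      by (intro sum_ennreal divide_nonneg_nonneg less_imp_le[OF Z] less_imp_le[OF potts_weight_pos[OF w]])
    finally show ?thesis
      using sum_nonneg[of S "\<lambda>\<sigma>. potts_weight w U \<sigma> / ?Z"] Z potts_weight_pos[OF w, THEN less_imp_le]
      by (simp add: measure_def sum_divide_distrib)
  qed
  have sp: "space ?M = ?X" by (simp add: M space_point_measure)
  let ?S = "{\<Phi> \<in> ?X. restrict \<Phi> A = restrict \<phi> A \<and> restrict \<Phi> B = restrict \<phi> B}"
  let ?T = "{\<Phi> \<in> ?X. restrict \<Phi> B = restrict \<phi> B}"
  have restr: "restrict f Y = restrict g Y \<longleftrightarrow> (\<forall>x\<in>Y. f x = g x)" for f g :: "nat list \<Rightarrow> nat" and Y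
    by (auto simp: restrict_def fun_eq_iff)
  have "?S = {restrict \<phi> U}"
    using \<phi> AB unfolding restr by (auto simp: fun_eq_iff PiE_def extensional_def)
  moreover have "measure ?M ?S = (\<Sum>\<sigma>\<in>?S. potts_weight w U \<sigma>) / ?Z" by (rule meas) auto
  ultimately have S: "measure ?M ?S = potts_weight w U (restrict \<phi> U) / ?Z" by simp
  have "(\<Sum>\<sigma>\<in>?T. potts_weight w U \<sigma>) = (\<Sum>\<rho>\<in>A \<rightarrow>\<^sub>E {1..q}. potts_weight w U (override_on \<phi> \<rho> A))"
  proof (rule sum.reindex_bij_witness[where j = "\<lambda>\<sigma>. restrict \<sigma> A" and i = "\<lambda>\<rho>. restrict (override_on \<phi> \<rho> A) U"],
      goal_cases)
    case (1 \<sigma>)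
    then show ?case using AB unfolding restr
      by (auto simp: override_on_def fun_eq_iff PiE_def extensional_def restrict_def)
  next
    case (3 \<rho>)
    then show ?case using AB
      by (auto simp: override_on_def fun_eq_iff PiE_def extensional_def restrict_def)
  next
    case (4 \<rho>)
    then show ?case using AB \<phi> unfolding restr
      by (auto simp: override_on_def PiE_def extensional_def restrict_def Pi_iff)
  next
    case (5 \<sigma>)
    then show ?case using AB unfolding restr
      by (intro potts_weight_cong) (auto simp: override_on_def)
  qed (use AB in \<open>auto simp: PiE_def Pi_iff\<close>)
  moreover have "measure ?M ?T = (\<Sum>\<sigma>\<in>?T. potts_weight w U \<sigma>) / ?Z" by (rule meas) auto
  ultimately have T: "measure ?M ?T = (\<Sum>\<rho>\<in>A \<rightarrow>\<^sub>E {1..q}. potts_weight w U (override_on \<phi> \<rho> A)) / ?Z"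
    by simp
  have "potts_weight w U (restrict \<phi> U) = potts_weight w U (override_on \<phi> (restrict \<phi> A) A)"
    by (intro potts_weight_cong) (auto simp: override_on_def)
  then show ?thesis using Z unfolding cond_prob_def sp S T gibbs_kernel_def by simp
qed

section \<open>Balls, spheres and children in the tree\<close>

definition tree_ball :: "nat \<Rightarrow> nat \<Rightarrow> nat list set" where
  "tree_ball \<Delta> n = {v \<in> tree_verts \<Delta>. length v \<le> n}"

definition tree_sphere :: "nat \<Rightarrow> nat \<Rightarrow> nat list set" where
  "tree_sphere \<Delta> n = {v \<in> tree_verts \<Delta>. length v = n}"

definition tree_children :: "nat \<Rightarrow> nat list \<Rightarrow> nat list set" where
  "tree_children \<Delta> v = {u \<in> tree_verts \<Delta>. u \<noteq> [] \<and> tl u = v}"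

lemma finite_tree_ball: "finite (tree_ball \<Delta> n)"
proof (rule finite_subset)
  show "tree_ball \<Delta> n \<subseteq> {xs. set xs \<subseteq> {..<\<Delta>} \<and> length xs \<le> n}"
    by (auto simp: tree_ball_def tree_verts_def)
qed (rule finite_lists_length_le, simp)

lemma tree_ball_subset: "tree_ball \<Delta> n \<subseteq> tree_verts \<Delta>"
  by (auto simp: tree_ball_def)

lemma finite_tree_sphere: "finite (tree_sphere \<Delta> n)"
  by (rule finite_subset[OF _ finite_tree_ball[of \<Delta> n]]) (auto simp: tree_ball_def tree_sphere_def)

lemma finite_tree_children: "finite (tree_children \<Delta> v)"
  by (rule finite_subset[OF _ finite_tree_ball[of \<Delta> "Suc (length v)"]])
    (auto simp: tree_ball_def tree_children_def)

lemma tl_in_tree_verts: "v \<in> tree_verts \<Delta> \<Longrightarrow> tl v \<in> tree_verts \<Delta>"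
  using tree_verts_tl by (cases v) auto

lemma tree_ball_Suc: "tree_ball \<Delta> (Suc n) = tree_sphere \<Delta> (Suc n) \<union> tree_ball \<Delta> n"
  "tree_sphere \<Delta> (Suc n) \<inter> tree_ball \<Delta> n = {}"
  by (auto simp: tree_ball_def tree_sphere_def)

lemma tree_sphere_Suc:
  "tree_sphere \<Delta> (Suc n) = (\<Union>v\<in>tree_sphere \<Delta> n. tree_children \<Delta> v)"
proof (intro equalityI subsetI)
  fix u assume "u \<in> tree_sphere \<Delta> (Suc n)"
  then show "u \<in> (\<Union>v\<in>tree_sphere \<Delta> n. tree_children \<Delta> v)"
    by (auto simp: tree_sphere_def tree_children_def tl_in_tree_verts)
next
  fix u assume "u \<in> (\<Union>v\<in>tree_sphere \<Delta> n. tree_children \<Delta> v)"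
  then show "u \<in> tree_sphere \<Delta> (Suc n)"
    by (cases u) (auto simp: tree_sphere_def tree_children_def)
qed

lemma tree_children_disjoint: "u \<noteq> v \<Longrightarrow> tree_children \<Delta> u \<inter> tree_children \<Delta> v = {}"
  by (auto simp: tree_children_def)

lemma card_tree_children:
  assumes "v \<in> tree_verts \<Delta>" "v \<noteq> []"
  shows "card (tree_children \<Delta> v) = \<Delta> - 1"
proof -
  have "{u. {u, v} \<in> tree_edges \<Delta>} = insert (tl v) (tree_children \<Delta> v)"
    using assms tl_in_tree_verts[OF assms(1)]
    by (auto simp: tree_edges_iff tree_children_def neq_Nil_conv)
  moreover have "tl v \<notin> tree_children \<Delta> v"
  proof
    assume "tl v \<in> tree_children \<Delta> v"
    then have "length v = length v - 1 - 1" "tl v \<noteq> []" by (auto simp: tree_children_def dest: arg_cong[of _ _ length])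
    then show False using assms by (cases v) auto
  qed
  ultimately have "card {u. {u, v} \<in> tree_edges \<Delta>} = Suc (card (tree_children \<Delta> v))"
    using finite_tree_children by simp
  then show ?thesis using tree_regular(2)[OF assms(1)] by simp
qed

lemma tree_children_nonempty:
  assumes "v \<in> tree_verts \<Delta>" "2 \<le> \<Delta>"
  shows "tree_children \<Delta> v \<noteq> {}"
proof (cases v)
  case Nil
  then have "[0] \<in> tree_children \<Delta> v" using assms by (auto simp: tree_children_def tree_verts_def)
  then show ?thesis by blast
next
  case (Cons i u)
  then have "0 < card (tree_children \<Delta> v)" using card_tree_children[OF assms(1)] assms(2) by simp
  then show ?thesis by (metis card.empty less_irrefl)
qed

lemma bdry_tree_ball:
  assumes "2 \<le> \<Delta>"
  shows "bdry (tree_verts \<Delta>) (tree_edges \<Delta>) (tree_ball \<Delta> n) = tree_sphere \<Delta> n"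
proof (intro equalityI subsetI)
  fix v assume "v \<in> bdry (tree_verts \<Delta>) (tree_edges \<Delta>) (tree_ball \<Delta> n)"
  then show "v \<in> tree_sphere \<Delta> n"
    by (auto simp: bdry_def tree_ball_def tree_sphere_def tree_edges_iff)
next
  fix v assume v: "v \<in> tree_sphere \<Delta> n"
  then obtain u where "u \<in> tree_children \<Delta> v"
    using tree_children_nonempty[of v \<Delta>] assms by (auto simp: tree_sphere_def)
  then have u: "u \<in> tree_verts \<Delta>" "u \<noteq> []" "tl u = v" by (auto simp: tree_children_def)
  then have "{v, u} \<in> tree_edges \<Delta>" using v by (cases u) (auto simp: tree_edges_iff tree_sphere_def)
  moreover have "length u = Suc n" using u v by (cases u) (auto simp: tree_sphere_def)
  then have "u \<in> tree_verts \<Delta> - tree_ball \<Delta> n" using u by (simp add: tree_ball_def)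
  moreover have "v \<in> tree_ball \<Delta> n" using v by (simp add: tree_ball_def tree_sphere_def)
  ultimately show "v \<in> bdry (tree_verts \<Delta>) (tree_edges \<Delta>) (tree_ball \<Delta> n)"
    unfolding bdry_def by blast
qed

text \<open>The shift by one fixes the radii used below: the Gibbs condition for the ball of radius
  n + 1 resamples the ball of radius n and reads the boundary on the sphere of radius n + 1.\<close>

lemma intr_tree_ball:
  assumes "2 \<le> \<Delta>"
  shows "intr (tree_verts \<Delta>) (tree_edges \<Delta>) (tree_ball \<Delta> (Suc n)) = tree_ball \<Delta> n"
  unfolding intr_def bdry_tree_ball[OF assms] using tree_ball_Suc[of \<Delta> n] by auto

lemma nonroots_tree_ball: "nonroots (tree_ball \<Delta> n) = tree_ball \<Delta> n - {[]}"
  by (auto simp: nonroots_def tree_ball_def tl_in_tree_verts)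

lemma potts_weight_tree_ball_Suc:
  "potts_weight w (tree_ball \<Delta> (Suc k)) (override_on \<sigma> \<rho> (tree_sphere \<Delta> (Suc k))) =
    potts_weight w (tree_ball \<Delta> k) \<sigma> * (\<Prod>u\<in>tree_sphere \<Delta> (Suc k). if \<sigma> (tl u) = \<rho> u then w else 1)"
proof -
  let ?\<tau> = "override_on \<sigma> \<rho> (tree_sphere \<Delta> (Suc k))"
  have N: "nonroots (tree_ball \<Delta> (Suc k)) = nonroots (tree_ball \<Delta> k) \<union> tree_sphere \<Delta> (Suc k)"
    unfolding nonroots_tree_ball by (auto simp: tree_ball_def tree_sphere_def)
  have disj: "nonroots (tree_ball \<Delta> k) \<inter> tree_sphere \<Delta> (Suc k) = {}"
    unfolding nonroots_tree_ball by (auto simp: tree_ball_def tree_sphere_def)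
  have "potts_weight w (tree_ball \<Delta> (Suc k)) ?\<tau> =
      (\<Prod>u\<in>nonroots (tree_ball \<Delta> k). if ?\<tau> (tl u) = ?\<tau> u then w else 1) *
      (\<Prod>u\<in>tree_sphere \<Delta> (Suc k). if ?\<tau> (tl u) = ?\<tau> u then w else 1)"
    unfolding potts_weight_def N
    by (rule prod.union_disjoint[OF finite_nonroots[OF finite_tree_ball] finite_tree_sphere disj])
  also have "(\<Prod>u\<in>nonroots (tree_ball \<Delta> k). if ?\<tau> (tl u) = ?\<tau> u then w else 1) = potts_weight w (tree_ball \<Delta> k) \<sigma>"
    unfolding potts_weight_def
    by (intro prod.cong) (auto simp: nonroots_def tree_ball_def tree_sphere_def override_on_def)
  also have "(\<Prod>u\<in>tree_sphere \<Delta> (Suc k). if ?\<tau> (tl u) = ?\<tau> u then w else 1) =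
      (\<Prod>u\<in>tree_sphere \<Delta> (Suc k). if \<sigma> (tl u) = \<rho> u then w else 1)"
    by (intro prod.cong) (auto simp: tree_sphere_def override_on_def)
  finally show ?thesis .
qed

section \<open>Summing out spheres: messages from partition functions\<close>

lemma sum_edge_weight:
  fixes p :: "nat \<Rightarrow> real"
  assumes "c \<in> {1..q}" "(\<Sum>j\<in>{1..q}. p j) = 1"
  shows "(\<Sum>j\<in>{1..q}. (if c = j then w else 1) * p j) = 1 - (1 - w) * p c"
proof -
  have "(\<Sum>j\<in>{1..q}. (if c = j then w else 1) * p j) = (\<Sum>j\<in>{1..q}. p j - (if c = j then (1 - w) * p j else 0))"
    by (intro sum.cong) (auto simp: algebra_simps)
  also have "\<dots> = 1 - (1 - w) * p c" using assms by (simp add: sum_subtractf)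
  finally show ?thesis .
qed

text \<open>Given the inner configuration the vertices of the outer sphere are independent, so the
  sum factorises. Because the weights p u sum to 1, each vertex u leaves the factor 1 - (1 - w) p u
  at the colour of its parent.\<close>

lemma sphere_elimination:
  assumes p: "\<And>u. u \<in> tree_sphere \<Delta> (Suc k) \<Longrightarrow> (\<Sum>j\<in>{1..q}. p u j) = 1"
    and \<sigma>: "\<And>v. v \<in> tree_sphere \<Delta> k \<Longrightarrow> \<sigma> v \<in> {1..q}"
  shows "(\<Sum>\<rho>\<in>tree_sphere \<Delta> (Suc k) \<rightarrow>\<^sub>E {1..q}.
      potts_weight w (tree_ball \<Delta> (Suc k)) (override_on \<sigma> \<rho> (tree_sphere \<Delta> (Suc k))) *
      (\<Prod>u\<in>tree_sphere \<Delta> (Suc k). p u (\<rho> u))) =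
    potts_weight w (tree_ball \<Delta> k) \<sigma> *
      (\<Prod>v\<in>tree_sphere \<Delta> k. \<Prod>u\<in>tree_children \<Delta> v. 1 - (1 - w) * p u (\<sigma> v))"
proof -
  let ?S = "tree_sphere \<Delta> (Suc k)"
  have "(\<Sum>\<rho>\<in>?S \<rightarrow>\<^sub>E {1..q}. potts_weight w (tree_ball \<Delta> (Suc k)) (override_on \<sigma> \<rho> ?S) * (\<Prod>u\<in>?S. p u (\<rho> u)))
     = potts_weight w (tree_ball \<Delta> k) \<sigma> *
       (\<Sum>\<rho>\<in>?S \<rightarrow>\<^sub>E {1..q}. \<Prod>u\<in>?S. (if \<sigma> (tl u) = \<rho> u then w else 1) * p u (\<rho> u))"
    unfolding potts_weight_tree_ball_Suc by (simp add: sum_distrib_left prod.distrib mult.assoc)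
  also have "(\<Sum>\<rho>\<in>?S \<rightarrow>\<^sub>E {1..q}. \<Prod>u\<in>?S. (if \<sigma> (tl u) = \<rho> u then w else 1) * p u (\<rho> u))
      = (\<Prod>u\<in>?S. \<Sum>j\<in>{1..q}. (if \<sigma> (tl u) = j then w else 1) * p u j)"
    by (rule prod_sum_PiE[symmetric]) (auto simp: finite_tree_sphere)
  also have "\<dots> = (\<Prod>u\<in>?S. 1 - (1 - w) * p u (\<sigma> (tl u)))"
  proof (rule prod.cong[OF refl])
    fix u assume u: "u \<in> ?S"
    then have "tl u \<in> tree_sphere \<Delta> k" by (auto simp: tree_sphere_def tl_in_tree_verts)
    then show "(\<Sum>j\<in>{1..q}. (if \<sigma> (tl u) = j then w else 1) * p u j) = 1 - (1 - w) * p u (\<sigma> (tl u))"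
      using \<sigma> p u by (intro sum_edge_weight) auto
  qed
  also have "\<dots> = (\<Prod>v\<in>tree_sphere \<Delta> k. \<Prod>u\<in>tree_children \<Delta> v. 1 - (1 - w) * p u (\<sigma> (tl u)))"
    unfolding tree_sphere_Suc
    by (rule prod.UNION_disjoint) (auto simp: finite_tree_sphere finite_tree_children tree_children_disjoint)
  also have "\<dots> = (\<Prod>v\<in>tree_sphere \<Delta> k. \<Prod>u\<in>tree_children \<Delta> v. 1 - (1 - w) * p u (\<sigma> v))"
    by (intro prod.cong) (auto simp: tree_children_def)
  finally show ?thesis .
qed

text \<open>The law of the colour of v in the subtree below v alone, when \<open>\<phi>\<close> is
  imposed exactly n generations further down. Height 0 reads off the boundary as a point
  mass.\<close>

primrec tree_msg :: "nat \<Rightarrow> nat \<Rightarrow> real \<Rightarrow> (nat list \<Rightarrow> nat) \<Rightarrow> nat \<Rightarrow> nat list \<Rightarrow> nat \<Rightarrow> real" where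
  "tree_msg q \<Delta> b \<phi> 0 = (\<lambda>v i. if i = \<phi> v then 1 else 0)"
| "tree_msg q \<Delta> b \<phi> (Suc n) = (\<lambda>v. rec_msg {1..q} (tree_children \<Delta> v) b (tree_msg q \<Delta> b \<phi> n))"

lemma tree_msg_prob:
  assumes b: "0 < b" "b < 1" and q: "1 \<le> q" and \<phi>: "\<And>v. v \<in> tree_verts \<Delta> \<Longrightarrow> \<phi> v \<in> {1..q}"
    and v: "v \<in> tree_verts \<Delta>"
  shows "(\<forall>i\<in>{1..q}. 0 \<le> tree_msg q \<Delta> b \<phi> n v i \<and> b * tree_msg q \<Delta> b \<phi> n v i < 1) \<and>
    (\<Sum>i\<in>{1..q}. tree_msg q \<Delta> b \<phi> n v i) = 1"
proof -
  have "(\<forall>i\<in>{1..q}. 0 \<le> tree_msg q \<Delta> b \<phi> n v i) \<and> (\<Sum>i\<in>{1..q}. tree_msg q \<Delta> b \<phi> n v i) = 1"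
    using v
  proof (induction n arbitrary: v)
    case 0
    then show ?case using \<phi>[of v] by simp
  next
    case (Suc n)
    have "b * tree_msg q \<Delta> b \<phi> n u i < 1" if "u \<in> tree_children \<Delta> v" "i \<in> {1..q}" for u i
    proof -
      have "u \<in> tree_verts \<Delta>" using that by (auto simp: tree_children_def)
      then have "tree_msg q \<Delta> b \<phi> n u i \<le> 1"
        using member_le_sum[of i "{1..q}" "tree_msg q \<Delta> b \<phi> n u"] Suc.IH that by auto
      then have "b * tree_msg q \<Delta> b \<phi> n u i \<le> b * 1" using b by (intro mult_left_mono) auto
      then show ?thesis using b by linarith
    qed
    then show ?case
      using rec_msg_prob[of "{1..q}" "tree_children \<Delta> v" b "tree_msg q \<Delta> b \<phi> n"] q finite_tree_children
      by auto
  qed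
  moreover have "b * tree_msg q \<Delta> b \<phi> n v i < 1" if "i \<in> {1..q}" for i
  proof -
    have "tree_msg q \<Delta> b \<phi> n v i \<le> 1"
      using member_le_sum[of i "{1..q}" "tree_msg q \<Delta> b \<phi> n v"] calculation that by auto
    then have "b * tree_msg q \<Delta> b \<phi> n v i \<le> b * 1" using b by (intro mult_left_mono) auto
    then show ?thesis using b by linarith
  qed
  ultimately show ?thesis by blast
qed

text \<open>Of the m shells, the induction hypothesis at k + 1 removes all but the innermost, and
  \<open>sphere_elimination\<close> removes that one. The indicators pinning the outermost sphere to
  \<open>\<phi>\<close> are the messages of height 0, and C gathers the normalisers of the messages,
  which do not depend on \<open>\<sigma>\<close>.\<close>

lemma ball_elimination:
  assumes w: "0 < w" "w < 1" and q: "1 \<le> q" and \<phi>: "\<And>v. v \<in> tree_verts \<Delta> \<Longrightarrow> \<phi> v \<in> {1..q}"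
  shows "\<exists>C>0. \<forall>\<sigma>. (\<forall>v\<in>tree_sphere \<Delta> k. \<sigma> v \<in> {1..q}) \<longrightarrow>
    (\<Sum>\<rho>\<in>(tree_ball \<Delta> (k + m) - tree_ball \<Delta> k) \<rightarrow>\<^sub>E {1..q}.
      potts_weight w (tree_ball \<Delta> (k + m)) (override_on \<sigma> \<rho> (tree_ball \<Delta> (k + m) - tree_ball \<Delta> k)) *
      (\<Prod>u\<in>tree_sphere \<Delta> (k + m).
        if override_on \<sigma> \<rho> (tree_ball \<Delta> (k + m) - tree_ball \<Delta> k) u = \<phi> u then 1 else 0)) =
    C * potts_weight w (tree_ball \<Delta> k) \<sigma> * (\<Prod>v\<in>tree_sphere \<Delta> k. tree_msg q \<Delta> (1 - w) \<phi> m v (\<sigma> v))"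
proof (induction m arbitrary: k)
  case 0
  show ?case by (intro exI[of _ 1]) (simp add: override_on_def)
next
  case (Suc m)
  let ?b = "1 - w"
  let ?B = "tree_sphere \<Delta> (Suc k)"
  let ?N = "k + Suc m"
  let ?A = "tree_ball \<Delta> ?N - tree_ball \<Delta> (Suc k)"
  let ?msg = "tree_msg q \<Delta> ?b \<phi>"
  obtain C where C: "C > 0" and IH: "\<And>\<sigma>. (\<forall>v\<in>?B. \<sigma> v \<in> {1..q}) \<Longrightarrow>
    (\<Sum>\<rho>\<in>?A \<rightarrow>\<^sub>E {1..q}. potts_weight w (tree_ball \<Delta> ?N) (override_on \<sigma> \<rho> ?A) *
      (\<Prod>u\<in>tree_sphere \<Delta> ?N. if override_on \<sigma> \<rho> ?A u = \<phi> u then 1 else 0)) =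
    C * potts_weight w (tree_ball \<Delta> (Suc k)) \<sigma> * (\<Prod>v\<in>?B. ?msg m v (\<sigma> v))"
    using Suc.IH[of "Suc k"] by auto
  define K where "K = (\<Prod>v\<in>tree_sphere \<Delta> k. \<Sum>j\<in>{1..q}. \<Prod>u\<in>tree_children \<Delta> v. 1 - ?b * ?msg m u j)"
  have prob: "\<And>v. v \<in> tree_verts \<Delta> \<Longrightarrow> (\<forall>i\<in>{1..q}. 0 \<le> ?msg m v i \<and> ?b * ?msg m v i < 1) \<and> (\<Sum>i\<in>{1..q}. ?msg m v i) = 1"
    using w by (intro tree_msg_prob \<phi> q) auto
  have pos: "0 < (\<Sum>j\<in>{1..q}. \<Prod>u\<in>tree_children \<Delta> v. 1 - ?b * ?msg m u j)" for v
  proof (intro sum_pos prod_pos)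
    fix j u assume "j \<in> {1..q}" "u \<in> tree_children \<Delta> v"
    then show "0 < 1 - ?b * ?msg m u j" using prob[of u] by (auto simp: tree_children_def)
  qed (use q in auto)
  have "0 < K" unfolding K_def by (intro prod_pos pos)
  moreover have "(\<Sum>\<rho>\<in>(tree_ball \<Delta> ?N - tree_ball \<Delta> k) \<rightarrow>\<^sub>E {1..q}.
      potts_weight w (tree_ball \<Delta> ?N) (override_on \<sigma> \<rho> (tree_ball \<Delta> ?N - tree_ball \<Delta> k)) *
      (\<Prod>u\<in>tree_sphere \<Delta> ?N. if override_on \<sigma> \<rho> (tree_ball \<Delta> ?N - tree_ball \<Delta> k) u = \<phi> u then 1 else 0)) =
    C * K * potts_weight w (tree_ball \<Delta> k) \<sigma> * (\<Prod>v\<in>tree_sphere \<Delta> k. ?msg (Suc m) v (\<sigma> v))"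
    if \<sigma>: "\<forall>v\<in>tree_sphere \<Delta> k. \<sigma> v \<in> {1..q}" for \<sigma>
  proof -
    have AB: "tree_ball \<Delta> ?N - tree_ball \<Delta> k = ?A \<union> ?B" "?A \<inter> ?B = {}"
      by (auto simp: tree_ball_def tree_sphere_def)
    have ov: "override_on \<sigma> (override_on \<tau> \<rho> ?A) (?A \<union> ?B) = override_on (override_on \<sigma> \<tau> ?B) \<rho> ?A" for \<tau> \<rho>
      by (auto simp: override_on_def fun_eq_iff)
    have "(\<Sum>\<rho>\<in>(tree_ball \<Delta> ?N - tree_ball \<Delta> k) \<rightarrow>\<^sub>E {1..q}.
      potts_weight w (tree_ball \<Delta> ?N) (override_on \<sigma> \<rho> (tree_ball \<Delta> ?N - tree_ball \<Delta> k)) *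
      (\<Prod>u\<in>tree_sphere \<Delta> ?N. if override_on \<sigma> \<rho> (tree_ball \<Delta> ?N - tree_ball \<Delta> k) u = \<phi> u then 1 else 0)) =
     (\<Sum>\<tau>\<in>?B \<rightarrow>\<^sub>E {1..q}. \<Sum>\<rho>\<in>?A \<rightarrow>\<^sub>E {1..q}.
       potts_weight w (tree_ball \<Delta> ?N) (override_on (override_on \<sigma> \<tau> ?B) \<rho> ?A) *
      (\<Prod>u\<in>tree_sphere \<Delta> ?N. if override_on (override_on \<sigma> \<tau> ?B) \<rho> ?A u = \<phi> u then 1 else 0))"
      unfolding AB(1) sum_PiE_Un[OF AB(2)] ov ..
    also have "\<dots> = (\<Sum>\<tau>\<in>?B \<rightarrow>\<^sub>E {1..q}. C * (potts_weight w (tree_ball \<Delta> (Suc k)) (override_on \<sigma> \<tau> ?B) *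
        (\<Prod>v\<in>?B. ?msg m v (\<tau> v))))"
    proof (rule sum.cong[OF refl])
      fix \<tau> assume \<tau>: "\<tau> \<in> ?B \<rightarrow>\<^sub>E {1..q}"
      then have "\<forall>v\<in>?B. override_on \<sigma> \<tau> ?B v \<in> {1..q}" by (auto simp: PiE_def Pi_iff)
      note IH[OF this]
      also have "(\<Prod>v\<in>?B. ?msg m v (override_on \<sigma> \<tau> ?B v)) = (\<Prod>v\<in>?B. ?msg m v (\<tau> v))"
        by (intro prod.cong) auto
      finally show "(\<Sum>\<rho>\<in>?A \<rightarrow>\<^sub>E {1..q}.
       potts_weight w (tree_ball \<Delta> ?N) (override_on (override_on \<sigma> \<tau> ?B) \<rho> ?A) *
      (\<Prod>u\<in>tree_sphere \<Delta> ?N. if override_on (override_on \<sigma> \<tau> ?B) \<rho> ?A u = \<phi> u then 1 else 0)) =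
        C * (potts_weight w (tree_ball \<Delta> (Suc k)) (override_on \<sigma> \<tau> ?B) * (\<Prod>v\<in>?B. ?msg m v (\<tau> v)))"
        by (simp only: mult.assoc)
    qed
    also have "\<dots> = C * (potts_weight w (tree_ball \<Delta> k) \<sigma> *
      (\<Prod>v\<in>tree_sphere \<Delta> k. \<Prod>u\<in>tree_children \<Delta> v. 1 - ?b * ?msg m u (\<sigma> v)))"
      unfolding sum_distrib_left[symmetric] using prob \<sigma>
      by (subst sphere_elimination) (auto simp: tree_sphere_def)
    also have "(\<Prod>v\<in>tree_sphere \<Delta> k. \<Prod>u\<in>tree_children \<Delta> v. 1 - ?b * ?msg m u (\<sigma> v)) =
        K * (\<Prod>v\<in>tree_sphere \<Delta> k. ?msg (Suc m) v (\<sigma> v))"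
      unfolding K_def prod.distrib[symmetric]
    proof (rule prod.cong[OF refl])
      fix v
      show "(\<Prod>u\<in>tree_children \<Delta> v. 1 - ?b * ?msg m u (\<sigma> v)) =
        (\<Sum>j\<in>{1..q}. \<Prod>u\<in>tree_children \<Delta> v. 1 - ?b * ?msg m u j) * ?msg (Suc m) v (\<sigma> v)"
        using pos[of v] by (simp add: rec_msg_def)
    qed
    finally show ?thesis by (simp only: mult.assoc mult.left_commute mult.commute)
  qed
  ultimately show ?case using C by (intro exI[of _ "C * K"]) auto
qed

lemma ball_marginal:
  assumes w: "0 < w" "w < 1" and q: "1 \<le> q" and \<phi>: "\<And>v. v \<in> tree_verts \<Delta> \<Longrightarrow> \<phi> v \<in> {1..q}"
    and k: "k \<le> n"
  shows "\<exists>C>0. \<forall>\<sigma>\<in>tree_ball \<Delta> k \<rightarrow>\<^sub>E {1..q}.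
    (\<Sum>\<rho> | \<rho> \<in> tree_ball \<Delta> n \<rightarrow>\<^sub>E {1..q} \<and> restrict \<rho> (tree_ball \<Delta> k) = \<sigma>.
      gibbs_kernel (tree_ball \<Delta> (Suc n)) (tree_ball \<Delta> n) q w \<phi> \<rho>) =
    C * potts_weight w (tree_ball \<Delta> k) \<sigma> *
      (\<Prod>v\<in>tree_sphere \<Delta> k. tree_msg q \<Delta> (1 - w) \<phi> (Suc n - k) v (\<sigma> v))"
proof -
  let ?U = "tree_ball \<Delta> (Suc n)" and ?A = "tree_ball \<Delta> n" and ?K = "tree_ball \<Delta> k"
  let ?D = "?U - ?K" and ?S = "tree_sphere \<Delta> (Suc n)"
  define Z where "Z = (\<Sum>\<rho>'\<in>?A \<rightarrow>\<^sub>E {1..q}. potts_weight w ?U (override_on \<phi> \<rho>' ?A))"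
  have "(\<lambda>x\<in>?A. 1) \<in> ?A \<rightarrow>\<^sub>E {1..q}" using q by auto
  then have "?A \<rightarrow>\<^sub>E {1..q} \<noteq> {}" by blast
  then have Z: "0 < Z" unfolding Z_def using w
    by (intro sum_pos potts_weight_pos finite_PiE) (auto simp: finite_tree_ball)
  have n: "k + (Suc n - k) = Suc n" using k by simp
  obtain C where C: "C > 0" and elim: "\<And>\<sigma>. (\<forall>v\<in>tree_sphere \<Delta> k. \<sigma> v \<in> {1..q}) \<Longrightarrow>
    (\<Sum>\<rho>\<in>?D \<rightarrow>\<^sub>E {1..q}. potts_weight w ?U (override_on \<sigma> \<rho> ?D) *
      (\<Prod>u\<in>?S. if override_on \<sigma> \<rho> ?D u = \<phi> u then 1 else 0)) =
    C * potts_weight w ?K \<sigma> * (\<Prod>v\<in>tree_sphere \<Delta> k. tree_msg q \<Delta> (1 - w) \<phi> (Suc n - k) v (\<sigma> v))"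
    using ball_elimination[where \<Delta> = \<Delta> and \<phi> = \<phi> and k = k and m = "Suc n - k", OF w q \<phi>] unfolding n by blast
  have sub: "?K \<subseteq> ?A" "?A \<subseteq> ?U" "?S \<inter> ?A = {}" "?U = ?A \<union> ?S" "?S \<subseteq> ?D"
    using k by (auto simp: tree_ball_def tree_sphere_def)
  have "(\<Sum>\<rho> | \<rho> \<in> ?A \<rightarrow>\<^sub>E {1..q} \<and> restrict \<rho> ?K = \<sigma>. gibbs_kernel ?U ?A q w \<phi> \<rho>) =
    C / Z * potts_weight w ?K \<sigma> * (\<Prod>v\<in>tree_sphere \<Delta> k. tree_msg q \<Delta> (1 - w) \<phi> (Suc n - k) v (\<sigma> v))"
    if \<sigma>: "\<sigma> \<in> ?K \<rightarrow>\<^sub>E {1..q}" for \<sigma>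
  proof -
    \<comment> \<open>The fixed outer sphere becomes part of the summation variable, pinned to
      \<open>\<phi>\<close>, which is the form that \<open>ball_elimination\<close> treats.\<close>
    have "(\<Sum>\<rho> | \<rho> \<in> ?A \<rightarrow>\<^sub>E {1..q} \<and> restrict \<rho> ?K = \<sigma>. potts_weight w ?U (override_on \<phi> \<rho> ?A)) =
      (\<Sum>\<rho> | \<rho> \<in> ?D \<rightarrow>\<^sub>E {1..q} \<and> (\<forall>u\<in>?S. \<rho> u = \<phi> u). potts_weight w ?U (override_on \<sigma> \<rho> ?D))"
    proof (rule sum.reindex_bij_witness[where i = "\<lambda>\<rho>. restrict (override_on \<sigma> \<rho> ?D) ?A"
          and j = "\<lambda>\<rho>. restrict (override_on \<phi> \<rho> ?A) ?D"], goal_cases)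
      case (1 \<rho>)
      then have s: "\<sigma> = restrict \<rho> ?K" by simp
      show ?case using 1 sub unfolding s
        by (auto simp: override_on_def fun_eq_iff PiE_def extensional_def restrict_def)
    next
      case (2 \<rho>)
      then have "override_on \<phi> \<rho> ?A x \<in> {1..q}" if "x \<in> ?D" for x
        using that \<phi>[of x] tree_ball_subset[of \<Delta> "Suc n"] by (auto simp: override_on_def PiE_def Pi_iff)
      then have "restrict (override_on \<phi> \<rho> ?A) ?D \<in> ?D \<rightarrow>\<^sub>E {1..q}" by auto
      moreover have "\<forall>u\<in>?S. restrict (override_on \<phi> \<rho> ?A) ?D u = \<phi> u"
        using sub by (auto simp: override_on_def)
      ultimately show ?case by blast
    next
      case (3 \<rho>)
      then show ?case using sub
        by (auto simp: override_on_def fun_eq_iff PiE_def extensional_def restrict_def)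
    next
      case (4 \<rho>)
      have "override_on \<sigma> \<rho> ?D x \<in> {1..q}" if "x \<in> ?A" for x
        using that 4 \<sigma> sub by (auto simp: override_on_def PiE_def Pi_iff)
      then have "restrict (override_on \<sigma> \<rho> ?D) ?A \<in> ?A \<rightarrow>\<^sub>E {1..q}" by auto
      moreover have "restrict (restrict (override_on \<sigma> \<rho> ?D) ?A) ?K = \<sigma>"
        using \<sigma> sub by (auto simp: override_on_def fun_eq_iff PiE_def extensional_def restrict_def)
      ultimately show ?case by blast
    next
      case (5 \<rho>)
      show ?case
      proof (rule potts_weight_cong)
        fix u assume u: "u \<in> ?U"
        have "\<sigma> u = \<rho> u" if "u \<in> ?K" using 5 that by (metis (mono_tags, lifting) mem_Collect_eq restrict_apply')
        then show "override_on \<sigma> (restrict (override_on \<phi> \<rho> ?A) ?D) ?D u = override_on \<phi> \<rho> ?A u"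
          using u sub by (auto simp: override_on_def)
      qed
    qed
    also have "\<dots> = (\<Sum>\<rho>\<in>?D \<rightarrow>\<^sub>E {1..q}. if (\<forall>u\<in>?S. \<rho> u = \<phi> u) then potts_weight w ?U (override_on \<sigma> \<rho> ?D) else 0)"
      by (subst sum.inter_filter[symmetric]) (auto intro!: finite_PiE simp: finite_tree_ball)
    also have "\<dots> = (\<Sum>\<rho>\<in>?D \<rightarrow>\<^sub>E {1..q}. potts_weight w ?U (override_on \<sigma> \<rho> ?D) *
      (\<Prod>u\<in>?S. if override_on \<sigma> \<rho> ?D u = \<phi> u then 1 else 0))"
    proof (rule sum.cong[OF refl])
      fix \<rho>
      have "(\<Prod>u\<in>?S. if override_on \<sigma> \<rho> ?D u = \<phi> u then 1 else 0) = (\<Prod>u\<in>?S. if \<rho> u = \<phi> u then 1 else (0::real))"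
        using sub by (intro prod.cong) (auto simp: override_on_def)
      also have "\<dots> = (if (\<forall>u\<in>?S. \<rho> u = \<phi> u) then 1 else 0)"
        by (auto simp: finite_tree_sphere intro: prod.neutral)
      finally show "(if (\<forall>u\<in>?S. \<rho> u = \<phi> u) then potts_weight w ?U (override_on \<sigma> \<rho> ?D) else 0) =
        potts_weight w ?U (override_on \<sigma> \<rho> ?D) * (\<Prod>u\<in>?S. if override_on \<sigma> \<rho> ?D u = \<phi> u then 1 else 0)"
        by simp
    qed
    also have "\<dots> = C * potts_weight w ?K \<sigma> * (\<Prod>v\<in>tree_sphere \<Delta> k. tree_msg q \<Delta> (1 - w) \<phi> (Suc n - k) v (\<sigma> v))"
      using \<sigma> by (intro elim) (auto simp: PiE_def Pi_iff tree_ball_def tree_sphere_def)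
    finally show ?thesis
      unfolding gibbs_kernel_def Z_def[symmetric] sum_divide_distrib[symmetric] by simp
  qed
  then show ?thesis using C Z by (intro exI[of _ "C / Z"]) auto
qed

section \<open>Ball marginals forget the boundary\<close>

lemma normalised_ratio_bound:
  fixes a g y :: "'a \<Rightarrow> real"
  assumes X: "finite X" and a: "\<And>x. x \<in> X \<Longrightarrow> 0 < a x" and g: "\<And>x. x \<in> X \<Longrightarrow> l \<le> g x" "\<And>x. x \<in> X \<Longrightarrow> g x \<le> u"
    and l: "0 < l" and y: "\<And>x. x \<in> X \<Longrightarrow> y x = C * (a x * g x)" "(\<Sum>x\<in>X. y x) = 1" and x: "x \<in> X"
  shows "\<bar>y x - a x / (\<Sum>x\<in>X. a x)\<bar> \<le> u / l - 1"
proof -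
  define A where "A = (\<Sum>x\<in>X. a x)"
  define G where "G = (\<Sum>x\<in>X. a x * g x)"
  have A: "0 < A" unfolding A_def using a X x by (intro sum_pos) auto
  have lu: "l \<le> u" using g[OF x] by linarith
  have aA: "a x \<le> A" unfolding A_def using member_le_sum[of x X a] a X x by (auto simp: less_imp_le)
  have GlA: "l * A \<le> G" unfolding G_def A_def sum_distrib_left
    using mult_left_mono[OF g(1) less_imp_le[OF a]] by (intro sum_mono) (simp add: mult.commute)
  have GuA: "G \<le> u * A" unfolding G_def A_def sum_distrib_left
    using mult_left_mono[OF g(2) less_imp_le[OF a]] by (intro sum_mono) (simp add: mult.commute)
  have G: "0 < G" using GlA mult_pos_pos[OF l A] by linarith
  have "(\<Sum>x\<in>X. y x) = (\<Sum>x\<in>X. C * (a x * g x))" using y(1) by (intro sum.cong) auto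
  then have "C * G = 1" using y(2) by (simp add: G_def sum_distrib_left)
  then have yx: "y x = a x * g x / G" using y(1)[OF x] G by (simp add: field_simps)
  define r where "r = a x / A"
  have r: "0 \<le> r" "r \<le> 1" using aA A a[OF x] by (auto simp: r_def)
  have "y x \<le> a x * u / (l * A)"
    unfolding yx using a[OF x] g[OF x] G GlA l A lu by (intro frac_le mult_left_mono) auto
  also have "\<dots> = r * (u / l)" by (simp add: r_def)
  finally have up: "y x \<le> r * (u / l)" .
  have "r * (l / u) = a x * l / (u * A)" by (simp add: r_def)
  also have "\<dots> \<le> y x"
    unfolding yx using a[OF x] g[OF x] G GuA l A by (intro frac_le mult_left_mono) auto
  finally have low: "r * (l / u) \<le> y x" .
  have ul: "1 \<le> u / l" using lu l by simp
  \<comment> \<open>By this inequality 1 - l/u \<le> u/l - 1, so one error term covers the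
    deviations on both sides.\<close>
  have "l / u + u / l \<ge> 2"
  proof -
    have "0 \<le> (u - l)\<^sup>2" by simp
    then have "2 * (u * l) \<le> l * l + u * u" by (simp add: power2_eq_square algebra_simps)
    then show ?thesis using l lu by (simp add: field_simps)
  qed
  moreover have "r * (u / l - 1) \<le> 1 * (u / l - 1)" using r ul by (intro mult_right_mono) auto
  moreover have "r * (1 - l / u) \<le> 1 * (1 - l / u)" using r l lu by (intro mult_right_mono) auto
  ultimately show ?thesis using up low unfolding A_def[symmetric] r_def[symmetric] abs_le_iff
    by (simp add: algebra_simps)
qed

lemma exists_ratio_power_close:
  assumes "0 < (\<eta>::real)"
  shows "\<exists>\<epsilon>. 0 < \<epsilon> \<and> \<epsilon> < 1 \<and> (1 + \<epsilon>) ^ M / (1 - \<epsilon>) ^ M - 1 < \<eta>"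
proof -
  have "((\<lambda>\<epsilon>::real. (1 + \<epsilon>) ^ M / (1 - \<epsilon>) ^ M - 1) \<longlongrightarrow> (1 + 0) ^ M / (1 - 0) ^ M - 1) (at_right 0)"
    by (intro tendsto_intros) auto
  then have "\<forall>\<^sub>F \<epsilon> in at_right 0. (1 + \<epsilon>) ^ M / (1 - \<epsilon>) ^ M - 1 < \<eta>"
    using assms by (simp add: order_tendsto_iff)
  moreover have "\<forall>\<^sub>F \<epsilon> in at_right 0. \<epsilon> < (1::real)"
    using eventually_at_right_real[of 0 "1::real"] by (auto elim: eventually_mono)
  moreover have "\<forall>\<^sub>F \<epsilon> in at_right 0. (0::real) < \<epsilon>" by (simp add: eventually_at_right_less)
  ultimately have "\<forall>\<^sub>F \<epsilon> in at_right 0. 0 < \<epsilon> \<and> \<epsilon> < 1 \<and> (1 + \<epsilon>) ^ M / (1 - \<epsilon>) ^ M - 1 < \<eta>"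
    by eventually_elim auto
  then show ?thesis using eventually_happens'[of "at_right (0::real)"] by (auto simp: trivial_limit_at_right_real)
qed

text \<open>With nearly uniform messages the product over the sphere hardly depends on
  \<open>\<sigma>\<close>, and what remains is the ball with free boundary. The number M of factors
  is fixed before n, so \<epsilon> can be chosen to keep the product of all M errors below
  \<eta>.\<close>

lemma uniform_mixing:
  assumes q: "2 \<le> q" and \<Delta>: "20000 * real q ^ 4 \<le> real (\<Delta> - 1)" "1 \<le> \<Delta>"
    and w: "0 < w" "w < 1" "(1 - w) * real \<Delta> \<le> real q" and k: "1 \<le> k" and \<eta>: "0 < \<eta>"
  shows "\<exists>n\<ge>k. \<forall>\<phi>. (\<forall>v\<in>tree_verts \<Delta>. \<phi> v \<in> {1..q}) \<longrightarrow> (\<forall>\<sigma>\<in>tree_ball \<Delta> k \<rightarrow>\<^sub>E {1..q}.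
    \<bar>(\<Sum>\<rho> | \<rho> \<in> tree_ball \<Delta> n \<rightarrow>\<^sub>E {1..q} \<and> restrict \<rho> (tree_ball \<Delta> k) = \<sigma>.
      gibbs_kernel (tree_ball \<Delta> (Suc n)) (tree_ball \<Delta> n) q w \<phi> \<rho>)
     - potts_weight w (tree_ball \<Delta> k) \<sigma> / (\<Sum>\<sigma>\<in>tree_ball \<Delta> k \<rightarrow>\<^sub>E {1..q}. potts_weight w (tree_ball \<Delta> k) \<sigma>)\<bar> \<le> \<eta>)"
proof -
  let ?b = "1 - w"
  define M where "M = card (tree_sphere \<Delta> k)"
  obtain \<epsilon> where \<epsilon>: "0 < \<epsilon>" "\<epsilon> < 1" "(1 + \<epsilon>) ^ M / (1 - \<epsilon>) ^ M - 1 < \<eta>"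
    using exists_ratio_power_close[OF \<eta>] by blast
  \<comment> \<open>The root has \<Delta> children and is left out; every other vertex has exactly
    \<Delta> - 1, as the recursion requires. With k \<ge> 1 the sphere of radius k avoids the
    root.\<close>
  define P where "P n p \<longleftrightarrow> (\<exists>\<phi> v. (\<forall>v\<in>tree_verts \<Delta>. \<phi> v \<in> {1..q}) \<and> v \<in> tree_verts \<Delta> \<and> v \<noteq> [] \<and>
    p = tree_msg q \<Delta> ?b \<phi> n v)" for n p
  have "\<exists>N. \<forall>n\<ge>N. \<forall>p. P n p \<longrightarrow> (\<forall>i\<in>{1..q}. \<bar>real (card {1..q}) * p i - 1\<bar> \<le> \<epsilon>)"
  proof (rule message_contraction[where b = ?b and d = "\<Delta> - 1"])
    show "\<And>p. P 0 p \<Longrightarrow> (\<forall>i\<in>{1..q}. 0 \<le> p i) \<and> (\<Sum>i\<in>{1..q}. p i) = 1"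
      using tree_msg_prob[of ?b q \<Delta> _ _ 0] w q unfolding P_def by fastforce
    show "\<exists>(S :: nat list set) ps. finite S \<and> card S = \<Delta> - 1 \<and> (\<forall>s\<in>S. P n (ps s)) \<and> p = rec_msg {1..q} S ?b ps"
      if p: "P (Suc n) p" for n p
    proof -
      obtain \<phi> v where v: "\<forall>v\<in>tree_verts \<Delta>. \<phi> v \<in> {1..q}" "v \<in> tree_verts \<Delta>" "v \<noteq> []"
        "p = tree_msg q \<Delta> ?b \<phi> (Suc n) v"
        using p unfolding P_def by blast
      have "\<forall>s\<in>tree_children \<Delta> v. P n (tree_msg q \<Delta> ?b \<phi> n s)"
        unfolding P_def using v(1) by (auto simp: tree_children_def)
      moreover have "p = rec_msg {1..q} (tree_children \<Delta> v) ?b (tree_msg q \<Delta> ?b \<phi> n)" using v(4) by simp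
      ultimately show ?thesis using card_tree_children[OF v(2,3)] finite_tree_children by blast
    qed
    show "?b * (real (\<Delta> - 1) + 1) \<le> real (card {1..q})" using w \<Delta>(2) by (simp add: of_nat_diff)
  qed (use q \<Delta> w \<epsilon> in auto)
  then obtain N where N0: "\<And>n p. N \<le> n \<Longrightarrow> P n p \<Longrightarrow> \<forall>i\<in>{1..q}. \<bar>real (card {1..q}) * p i - 1\<bar> \<le> \<epsilon>"
    by blast
  have N: "\<bar>real q * tree_msg q \<Delta> ?b \<phi> n v i - 1\<bar> \<le> \<epsilon>"
    if "N \<le> n" "\<forall>v\<in>tree_verts \<Delta>. \<phi> v \<in> {1..q}" "v \<in> tree_verts \<Delta>" "v \<noteq> []" "i \<in> {1..q}" for n \<phi> v i
  proof -
    have "P n (tree_msg q \<Delta> ?b \<phi> n v)" unfolding P_def using that by blast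
    from N0[OF that(1) this] show ?thesis using that(5) by simp
  qed
  \<comment> \<open>The messages on the sphere of radius k then have height Suc n - k = N +
    1.\<close>
  define n where "n = k + N"
  let ?X = "tree_ball \<Delta> k \<rightarrow>\<^sub>E {1..q}"
  have finX: "finite ?X" by (intro finite_PiE) (auto simp: finite_tree_ball)
  show ?thesis
  proof (intro exI[of _ n] conjI allI impI ballI)
    show "k \<le> n" by (simp add: n_def)
    fix \<phi> \<sigma> assume \<phi>: "\<forall>v\<in>tree_verts \<Delta>. \<phi> v \<in> {1..q}" and \<sigma>: "\<sigma> \<in> ?X"
    define y where "y \<sigma> = (\<Sum>\<rho> | \<rho> \<in> tree_ball \<Delta> n \<rightarrow>\<^sub>E {1..q} \<and> restrict \<rho> (tree_ball \<Delta> k) = \<sigma>.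
      gibbs_kernel (tree_ball \<Delta> (Suc n)) (tree_ball \<Delta> n) q w \<phi> \<rho>)" for \<sigma>
    \<comment> \<open>Multiplying each message by q brings every factor close to 1; the power of q
      goes into the proportionality constant.\<close>
    define g where "g \<sigma> = (\<Prod>v\<in>tree_sphere \<Delta> k. real q * tree_msg q \<Delta> ?b \<phi> (Suc n - k) v (\<sigma> v))" for \<sigma>
    obtain C where C: "\<And>\<sigma>. \<sigma> \<in> ?X \<Longrightarrow> y \<sigma> = C * potts_weight w (tree_ball \<Delta> k) \<sigma> *
      (\<Prod>v\<in>tree_sphere \<Delta> k. tree_msg q \<Delta> ?b \<phi> (Suc n - k) v (\<sigma> v))"
      using ball_marginal[where w = w and q = q and \<Delta> = \<Delta> and \<phi> = \<phi> and k = k and n = n] w q \<phi>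
      unfolding y_def n_def by auto
    have yg: "y \<sigma> = (C / real q ^ M) * (potts_weight w (tree_ball \<Delta> k) \<sigma> * g \<sigma>)" if "\<sigma> \<in> ?X" for \<sigma>
      using C[OF that] q by (simp add: g_def prod.distrib M_def)
    have msg: "1 - \<epsilon> \<le> real q * tree_msg q \<Delta> ?b \<phi> (Suc n - k) v (\<sigma> v)"
      "real q * tree_msg q \<Delta> ?b \<phi> (Suc n - k) v (\<sigma> v) \<le> 1 + \<epsilon>"
      if "v \<in> tree_sphere \<Delta> k" "\<sigma> \<in> ?X" for v \<sigma>
    proof -
      have "v \<noteq> []" "v \<in> tree_verts \<Delta>" "\<sigma> v \<in> {1..q}"
        using that k by (auto simp: tree_sphere_def tree_ball_def PiE_def Pi_iff)
      then have "\<bar>real q * tree_msg q \<Delta> ?b \<phi> (Suc n - k) v (\<sigma> v) - 1\<bar> \<le> \<epsilon>"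
        using \<phi> by (intro N) (auto simp: n_def)
      then show "1 - \<epsilon> \<le> real q * tree_msg q \<Delta> ?b \<phi> (Suc n - k) v (\<sigma> v)"
        "real q * tree_msg q \<Delta> ?b \<phi> (Suc n - k) v (\<sigma> v) \<le> 1 + \<epsilon>" by linarith+
    qed
    have gl: "(1 - \<epsilon>) ^ M \<le> g \<sigma>" if "\<sigma> \<in> ?X" for \<sigma>
      unfolding M_def g_def prod_constant[symmetric] using msg(1)[OF _ that] \<epsilon> by (intro prod_mono) auto
    have gu: "g \<sigma> \<le> (1 + \<epsilon>) ^ M" if "\<sigma> \<in> ?X" for \<sigma>
      unfolding M_def g_def prod_constant[symmetric]
    proof (intro prod_mono conjI)
      fix v assume v: "v \<in> tree_sphere \<Delta> k"
      show "0 \<le> real q * tree_msg q \<Delta> ?b \<phi> (Suc n - k) v (\<sigma> v)" using msg(1)[OF v that] \<epsilon> by linarith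
      show "real q * tree_msg q \<Delta> ?b \<phi> (Suc n - k) v (\<sigma> v) \<le> 1 + \<epsilon>" using msg(2)[OF v that] .
    qed
    have "(\<Sum>\<sigma>\<in>?X. y \<sigma>) = (\<Sum>\<rho>\<in>tree_ball \<Delta> n \<rightarrow>\<^sub>E {1..q}. gibbs_kernel (tree_ball \<Delta> (Suc n)) (tree_ball \<Delta> n) q w \<phi> \<rho>)"
      unfolding y_def
    proof (rule sum.group)
      show "finite (tree_ball \<Delta> n \<rightarrow>\<^sub>E {1..q})" by (intro finite_PiE) (auto simp: finite_tree_ball)
      show "(\<lambda>\<rho>. restrict \<rho> (tree_ball \<Delta> k)) ` (tree_ball \<Delta> n \<rightarrow>\<^sub>E {1..q}) \<subseteq> ?X"
        by (auto simp: n_def tree_ball_def PiE_def Pi_iff)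
    qed (rule finX)
    also have "\<dots> = 1" using w q by (intro gibbs_kernel_sum finite_tree_ball) auto
    finally have sumy: "(\<Sum>\<sigma>\<in>?X. y \<sigma>) = 1" .
    have "\<bar>y \<sigma> - potts_weight w (tree_ball \<Delta> k) \<sigma> / (\<Sum>\<sigma>\<in>?X. potts_weight w (tree_ball \<Delta> k) \<sigma>)\<bar>
        \<le> (1 + \<epsilon>) ^ M / (1 - \<epsilon>) ^ M - 1"
      using normalised_ratio_bound[OF finX potts_weight_pos[OF w(1)] gl gu _ yg sumy \<sigma>] \<epsilon> by simp
    then show "\<bar>(\<Sum>\<rho> | \<rho> \<in> tree_ball \<Delta> n \<rightarrow>\<^sub>E {1..q} \<and> restrict \<rho> (tree_ball \<Delta> k) = \<sigma>.
      gibbs_kernel (tree_ball \<Delta> (Suc n)) (tree_ball \<Delta> n) q w \<phi> \<rho>)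
     - potts_weight w (tree_ball \<Delta> k) \<sigma> / (\<Sum>\<sigma>\<in>?X. potts_weight w (tree_ball \<Delta> k) \<sigma>)\<bar> \<le> \<eta>"
      using \<epsilon>(3) unfolding y_def by linarith
  qed
qed

section \<open>Marginals of Gibbs measures\<close>

lemma coordinate_measurable_restr_algebra:
  assumes "u \<in> W" "W \<subseteq> V"
  shows "(\<lambda>\<Phi>. \<Phi> u) \<in> measurable (restr_algebra V q W) (count_space UNIV)"
proof -
  have 1: "(\<lambda>\<Phi>. restrict \<Phi> W) \<in> measurable (restr_algebra V q W) (config_space W q)"
    unfolding restr_algebra_def
    using assms(2) by (intro measurable_vimage_algebra1) (auto simp: space_PiM PiE_def Pi_iff)
  have 2: "(\<lambda>\<Phi>. \<Phi> u) \<in> measurable (config_space W q) (count_space {1..q})"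
    using assms(1) by (rule measurable_component_singleton)
  have 3: "(\<lambda>x. x) \<in> measurable (count_space {1..q}) (count_space (UNIV :: nat set))" by simp
  have "(\<lambda>\<Phi>. restrict \<Phi> W u) \<in> measurable (restr_algebra V q W) (count_space UNIV)"
    by (rule measurable_compose[OF measurable_compose[OF 1 2] 3])
  then show ?thesis using assms by simp
qed

lemma kernel_measurable:
  assumes meas: "\<And>u. u \<in> U - A \<Longrightarrow> (\<lambda>\<Phi>. \<Phi> u) \<in> measurable M (count_space (UNIV :: nat set))"
  shows "(\<lambda>\<phi>. gibbs_kernel U A q w \<phi> \<rho>) \<in> borel_measurable M"
proof -
  have val: "(\<lambda>\<phi>. override_on \<phi> \<rho> A u) \<in> measurable M (count_space UNIV)" if "u \<in> U" for u \<rho>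
    using meas[of u] that by (cases "u \<in> A") auto
  have "(\<lambda>\<phi>. if override_on \<phi> \<rho> A x = override_on \<phi> \<rho> A y then w else 1) \<in> borel_measurable M"
    if "x \<in> U" "y \<in> U" for x y \<rho>
  proof (rule measurable_compose_countable[OF _ val[OF that(1)]])
    fix i :: nat
    have "(\<lambda>j::nat. if i = j then w else 1) \<in> measurable (count_space UNIV) borel" by simp
    from measurable_compose[OF val[OF that(2)] this]
    show "(\<lambda>\<phi>. if i = override_on \<phi> \<rho> A y then w else 1) \<in> borel_measurable M" .
  qed
  then have "(\<lambda>\<phi>. potts_weight w U (override_on \<phi> \<rho> A)) \<in> borel_measurable M" for \<rho>
    unfolding potts_weight_def by (intro borel_measurable_prod) (auto simp: nonroots_def)
  then show ?thesis
    unfolding gibbs_kernel_def by (intro borel_measurable_divide borel_measurable_sum)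
qed

lemma restrict_in_PiE: "B \<subseteq> V \<Longrightarrow> \<Phi> \<in> V \<rightarrow>\<^sub>E X \<Longrightarrow> restrict \<Phi> B \<in> B \<rightarrow>\<^sub>E X"
  by (auto simp: PiE_def Pi_iff)

lemma cylinder_sets:
  assumes "sets \<mu> = sets (config_space V q)" "finite B" "B \<subseteq> V"
  shows "{\<Phi> \<in> space \<mu>. Q (restrict \<Phi> B)} \<in> sets \<mu>"
proof -
  have sp: "space \<mu> = V \<rightarrow>\<^sub>E {1..q}" using sets_eq_imp_space_eq[OF assms(1)] by (simp add: space_PiM)
  have "(\<lambda>\<Phi>. restrict \<Phi> B) \<in> measurable (config_space V q) (config_space B q)"
    using assms by (intro measurable_restrict_subset)
  then have r: "(\<lambda>\<Phi>. restrict \<Phi> B) \<in> measurable \<mu> (config_space B q)"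
    using measurable_cong_sets[OF assms(1) refl] by blast
  have single: "{\<sigma>} \<in> sets (config_space B q)" if "\<sigma> \<in> B \<rightarrow>\<^sub>E {1..q}" for \<sigma>
  proof -
    have "(\<Pi>\<^sub>E i\<in>B. {\<sigma> i}) \<in> sets (config_space B q)"
      using assms that by (intro sets_PiM_I_finite) (auto simp: PiE_def Pi_iff)
    moreover have "(\<Pi>\<^sub>E i\<in>B. {\<sigma> i}) = {\<sigma>}" using that by (intro PiE_singleton) (auto simp: PiE_def)
    ultimately show ?thesis by simp
  qed
  have fin: "finite (B \<rightarrow>\<^sub>E {1..q})" using assms by (intro finite_PiE) auto
  have "(\<Union>\<sigma>\<in>{\<sigma> \<in> B \<rightarrow>\<^sub>E {1..q}. Q \<sigma>}. {\<sigma>}) \<in> sets (config_space B q)"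
    using fin single by (intro sets.finite_UN) auto
  from measurable_sets[OF r this]
  have "(\<lambda>\<Phi>. restrict \<Phi> B) -` {\<sigma> \<in> B \<rightarrow>\<^sub>E {1..q}. Q \<sigma>} \<inter> space \<mu> \<in> sets \<mu>" by simp
  moreover have "(\<lambda>\<Phi>. restrict \<Phi> B) -` {\<sigma> \<in> B \<rightarrow>\<^sub>E {1..q}. Q \<sigma>} \<inter> space \<mu> = {\<Phi> \<in> space \<mu>. Q (restrict \<Phi> B)}"
    using restrict_in_PiE[OF assms(3)] by (auto simp: sp)
  ultimately show ?thesis by simp
qed

lemma measure_cylinder_sum:
  assumes "prob_space \<mu>" "sets \<mu> = sets (config_space V q)" "finite B" "B \<subseteq> V"
  shows "measure \<mu> {\<Phi> \<in> space \<mu>. Q (restrict \<Phi> B)} =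
    (\<Sum>\<sigma> | \<sigma> \<in> B \<rightarrow>\<^sub>E {1..q} \<and> Q \<sigma>. measure \<mu> {\<Phi> \<in> space \<mu>. restrict \<Phi> B = \<sigma>})"
proof -
  interpret prob_space \<mu> by fact
  have sp: "space \<mu> = V \<rightarrow>\<^sub>E {1..q}" using sets_eq_imp_space_eq[OF assms(2)] by (simp add: space_PiM)
  have fin: "finite (B \<rightarrow>\<^sub>E {1..q})" using assms by (intro finite_PiE) auto
  have "{\<Phi> \<in> space \<mu>. Q (restrict \<Phi> B)} =
      (\<Union>\<sigma>\<in>{\<sigma> \<in> B \<rightarrow>\<^sub>E {1..q}. Q \<sigma>}. {\<Phi> \<in> space \<mu>. restrict \<Phi> B = \<sigma>})"
  proof (intro equalityI subsetI)
    fix \<Phi> assume \<Phi>: "\<Phi> \<in> {\<Phi> \<in> space \<mu>. Q (restrict \<Phi> B)}"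
    then have "\<Phi> \<in> V \<rightarrow>\<^sub>E {1..q}" by (simp add: sp)
    from restrict_in_PiE[OF assms(4) this]
    show "\<Phi> \<in> (\<Union>\<sigma>\<in>{\<sigma> \<in> B \<rightarrow>\<^sub>E {1..q}. Q \<sigma>}. {\<Phi> \<in> space \<mu>. restrict \<Phi> B = \<sigma>})"
      using \<Phi> by blast
  qed auto
  also have "measure \<mu> \<dots> = (\<Sum>\<sigma>\<in>{\<sigma> \<in> B \<rightarrow>\<^sub>E {1..q}. Q \<sigma>}. measure \<mu> {\<Phi> \<in> space \<mu>. restrict \<Phi> B = \<sigma>})"
    using fin cylinder_sets[OF assms(2-4), where Q = "\<lambda>\<tau>. \<tau> = \<sigma>" for \<sigma>]
    by (intro finite_measure_finite_Union) (auto simp: disjoint_family_on_def)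
  finally show ?thesis .
qed

lemma gibbs_cond_exp:
  assumes gibbs: "potts_gibbs_measure (tree_verts \<Delta>) (tree_edges \<Delta>) q w \<mu>"
    and \<Delta>: "2 \<le> \<Delta>" and w: "0 < w" and q: "1 \<le> q" and \<rho>: "\<rho> \<in> tree_ball \<Delta> n \<rightarrow>\<^sub>E {1..q}"
  shows "AE \<phi> in \<mu>. real_cond_exp \<mu> (restr_algebra (tree_verts \<Delta>) q (tree_verts \<Delta> - tree_ball \<Delta> n))
      (indicator {\<Phi> \<in> space \<mu>. restrict \<Phi> (tree_ball \<Delta> n) = \<rho>}) \<phi> =
    gibbs_kernel (tree_ball \<Delta> (Suc n)) (tree_ball \<Delta> n) q w \<phi> \<rho>"
proof -
  let ?V = "tree_verts \<Delta>" and ?A = "tree_ball \<Delta> n" and ?U = "tree_ball \<Delta> (Suc n)"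
  let ?F = "restr_algebra ?V q (?V - ?A)"
  let ?P = "\<lambda>\<phi>. \<P>(\<Phi> in potts_measure ?U (induced_edges (tree_edges \<Delta>) ?U) q w. restrict \<Phi> ?A = restrict \<phi> ?A
    \<bar> restrict \<Phi> (tree_sphere \<Delta> (Suc n)) = restrict \<phi> (tree_sphere \<Delta> (Suc n)))"
  define ind where "ind \<rho> = (indicator {\<Phi> \<in> space \<mu>. restrict \<Phi> ?A = \<rho>} :: _ \<Rightarrow> real)" for \<rho>
  define Y where "Y \<rho> = real_cond_exp \<mu> ?F (ind \<rho>)" for \<rho>
  define g where "g \<rho> \<phi> = gibbs_kernel ?U ?A q w \<phi> \<rho>" for \<rho> \<phi>
  have prob: "prob_space \<mu>" and sets: "sets \<mu> = sets (config_space ?V q)"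
    using gibbs by (auto simp: potts_gibbs_measure_def)
  interpret prob_space \<mu> by fact
  have sp: "space \<mu> = ?V \<rightarrow>\<^sub>E {1..q}" using sets_eq_imp_space_eq[OF sets] by (simp add: space_PiM)
  have sub: "subalgebra \<mu> ?F" using sets by (intro subalgebra_restr_algebra) auto
  interpret finite_measure_subalgebra \<mu> ?F by unfold_locales (rule sub)
  have fin: "finite (?A \<rightarrow>\<^sub>E {1..q})" by (intro finite_PiE) (auto simp: finite_tree_ball)
  have ind_sets: "{\<Phi> \<in> space \<mu>. restrict \<Phi> ?A = \<rho>} \<in> sets \<mu>" for \<rho>
    by (rule cylinder_sets[OF sets finite_tree_ball tree_ball_subset])
  have ind_meas [measurable]: "ind \<rho> \<in> borel_measurable \<mu>" for \<rho> unfolding ind_def using ind_sets by simp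
  have ind_int: "integrable \<mu> (ind \<rho>)" for \<rho>
    unfolding ind_def using ind_sets by (intro integrable_real_indicator) (auto simp: emeasure_eq_measure)
  have gF [measurable]: "g \<rho> \<in> borel_measurable ?F" for \<rho>
    unfolding g_def[abs_def]
  proof (rule kernel_measurable)
    fix u assume "u \<in> ?U - ?A"
    then show "(\<lambda>\<Phi>. \<Phi> u) \<in> measurable ?F (count_space UNIV)"
      using tree_ball_subset[of \<Delta> "Suc n"] by (intro coordinate_measurable_restr_algebra) auto
  qed
  have YF [measurable]: "Y \<rho> \<in> borel_measurable ?F" for \<rho> unfolding Y_def by (rule borel_measurable_cond_exp)
  have "AE \<phi> in \<mu>. Y (restrict \<phi> ?A) \<phi> = ?P \<phi>"
    using gibbs[unfolded potts_gibbs_measure_def] finite_tree_ball[of \<Delta> "Suc n"] tree_ball_subset[of \<Delta> "Suc n"]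
    unfolding Y_def ind_def intr_tree_ball[OF \<Delta>, of n, symmetric] bdry_tree_ball[OF \<Delta>, of "Suc n", symmetric]
    by blast
  then have spec: "AE \<phi> in \<mu>. Y (restrict \<phi> ?A) \<phi> = g (restrict \<phi> ?A) \<phi>"
  proof (rule AE_mp[OF _ AE_I2])
    fix \<phi> assume "\<phi> \<in> space \<mu>"
    then have "\<phi> x \<in> {1..q}" if "x \<in> ?U" for x
      using that tree_ball_subset[of \<Delta> "Suc n"] by (auto simp: sp PiE_def Pi_iff)
    then have "?P \<phi>
      = g (restrict \<phi> ?A) \<phi>"
      unfolding g_def using tree_ball_Suc[of \<Delta> n]
      by (intro cond_prob_potts_measure finite_tree_ball tree_ball_subset w q) auto
    then show "Y (restrict \<phi> ?A) \<phi> = ?P \<phi> \<longrightarrow>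
      Y (restrict \<phi> ?A) \<phi> = g (restrict \<phi> ?A) \<phi>" by simp
  qed
  have gpos: "0 < g \<rho> \<phi>" for \<rho> \<phi> unfolding g_def by (rule gibbs_kernel_pos[OF finite_tree_ball w q])
  \<comment> \<open>The Gibbs condition only fixes \<open>Y \<rho>\<close> where the interior configuration is \<open>\<rho>\<close>. As both sides
    are measurable with respect to the exterior, \<open>Y \<rho>\<close> can only take the values \<open>0\<close> and \<open>g \<rho>\<close>;
    since both families sum to \<open>1\<close>, they agree.\<close>
  have Yle: "AE \<phi> in \<mu>. Y \<rho> \<phi> \<le> g \<rho> \<phi>" for \<rho>
  proof -
    \<comment> \<open>\<open>h\<close> marks the points where the two functions differ. Being
      measurable with respect to the exterior, it can be pulled out of the conditional expectation
      of h times the indicator, which is 0 almost everywhere.\<close>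
    define h where "h = (\<lambda>\<phi>. if Y \<rho> \<phi> = g \<rho> \<phi> then 0 else 1 :: real)"
    have h [measurable]: "h \<in> borel_measurable ?F" unfolding h_def by measurable
    then have h' [measurable]: "h \<in> borel_measurable \<mu>" by (rule measurable_from_subalg[OF sub])
    have hint: "integrable \<mu> (\<lambda>\<phi>. h \<phi> * ind \<rho> \<phi>)"
    proof (rule integrable_const_bound[where B = 1])
      show "AE \<phi> in \<mu>. norm (h \<phi> * ind \<rho> \<phi>) \<le> 1"
        by (rule AE_I2) (auto simp: h_def ind_def split: split_indicator)
      show "(\<lambda>\<phi>. h \<phi> * ind \<rho> \<phi>) \<in> borel_measurable \<mu>" by (rule borel_measurable_times[OF h' ind_meas])
    qed
    have "AE \<phi> in \<mu>. h \<phi> * ind \<rho> \<phi> = 0"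
      using spec by eventually_elim (auto simp: h_def ind_def split: split_indicator)
    then have "AE \<phi> in \<mu>. real_cond_exp \<mu> ?F (\<lambda>\<phi>. h \<phi> * ind \<rho> \<phi>) \<phi> = real_cond_exp \<mu> ?F (\<lambda>_. 0) \<phi>"
      by (intro real_cond_exp_cong) auto
    moreover have "AE \<phi> in \<mu>. real_cond_exp \<mu> ?F (\<lambda>_. 0) \<phi> = 0" by (intro real_cond_exp_F_meas) auto
    moreover have "AE \<phi> in \<mu>. real_cond_exp \<mu> ?F (\<lambda>\<phi>. h \<phi> * ind \<rho> \<phi>) \<phi> = h \<phi> * Y \<rho> \<phi>"
      unfolding Y_def by (rule real_cond_exp_mult[OF h ind_meas hint])
    ultimately show ?thesis
    proof eventually_elim
      case (elim \<phi>)
      then have "h \<phi> * Y \<rho> \<phi> = 0" by simp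
      then show ?case using gpos[of \<rho> \<phi>] by (auto simp: h_def split: if_splits)
    qed
  qed
  have "AE \<phi> in \<mu>. real_cond_exp \<mu> ?F (\<lambda>\<phi>. \<Sum>\<rho>\<in>?A \<rightarrow>\<^sub>E {1..q}. ind \<rho> \<phi>) \<phi> = real_cond_exp \<mu> ?F (\<lambda>_. 1) \<phi>"
  proof (rule real_cond_exp_cong)
    show "AE \<phi> in \<mu>. (\<Sum>\<rho>\<in>?A \<rightarrow>\<^sub>E {1..q}. ind \<rho> \<phi>) = 1"
    proof (rule AE_I2)
      fix \<phi> assume \<phi>: "\<phi> \<in> space \<mu>"
      then have r: "restrict \<phi> ?A \<in> ?A \<rightarrow>\<^sub>E {1..q}"
        using tree_ball_subset[of \<Delta> n] by (auto simp: sp PiE_def Pi_iff)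
      have "(\<Sum>\<rho>\<in>?A \<rightarrow>\<^sub>E {1..q}. ind \<rho> \<phi>) = (\<Sum>\<rho>\<in>?A \<rightarrow>\<^sub>E {1..q}. if \<rho> = restrict \<phi> ?A then 1 else 0)"
        using \<phi> by (intro sum.cong) (auto simp: ind_def split: split_indicator)
      then show "(\<Sum>\<rho>\<in>?A \<rightarrow>\<^sub>E {1..q}. ind \<rho> \<phi>) = 1" using r fin by simp
    qed
  qed auto
  moreover have "AE \<phi> in \<mu>. real_cond_exp \<mu> ?F (\<lambda>\<phi>. \<Sum>\<rho>\<in>?A \<rightarrow>\<^sub>E {1..q}. ind \<rho> \<phi>) \<phi> = (\<Sum>\<rho>\<in>?A \<rightarrow>\<^sub>E {1..q}. Y \<rho> \<phi>)"
    unfolding Y_def by (rule real_cond_exp_sum[OF ind_int])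
  moreover have "AE \<phi> in \<mu>. real_cond_exp \<mu> ?F (\<lambda>_. 1) \<phi> = 1" by (intro real_cond_exp_F_meas) auto
  moreover have "AE \<phi> in \<mu>. \<forall>\<rho>\<in>?A \<rightarrow>\<^sub>E {1..q}. Y \<rho> \<phi> \<le> g \<rho> \<phi>"
    using fin Yle by (intro AE_finite_allI)
  ultimately have "AE \<phi> in \<mu>. Y \<rho> \<phi> = g \<rho> \<phi>"
  proof eventually_elim
    case (elim \<phi>)
    have "(\<Sum>\<rho>\<in>?A \<rightarrow>\<^sub>E {1..q}. g \<rho> \<phi> - Y \<rho> \<phi>) = 0"
      using elim gibbs_kernel_sum[where A = ?A and U = ?U and \<phi> = \<phi>, OF finite_tree_ball w q] by (simp add: sum_subtractf g_def)
    then have "\<forall>\<rho>\<in>?A \<rightarrow>\<^sub>E {1..q}. g \<rho> \<phi> - Y \<rho> \<phi> = 0"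
      using elim fin by (subst (asm) sum_nonneg_eq_0_iff) auto
    then show ?case using \<rho> by auto
  qed
  then show ?thesis unfolding Y_def ind_def g_def .
qed

text \<open>By the Gibbs condition on a large ball the marginal is a \<open>\<mu>\<close>-mean of
  kernel probabilities, and uniform mixing puts the integrand within any prescribed \<eta> of
  \<open>?r\<close> for every boundary configuration. Uniqueness results because \<open>?r\<close>
  does not involve \<open>\<mu>\<close>.\<close>

lemma gibbs_ball_marginal:
  assumes gibbs: "potts_gibbs_measure (tree_verts \<Delta>) (tree_edges \<Delta>) q w \<mu>"
    and q: "2 \<le> q" and \<Delta>: "20000 * real q ^ 4 \<le> real (\<Delta> - 1)" "2 \<le> \<Delta>"
    and w: "0 < w" "w < 1" "(1 - w) * real \<Delta> \<le> real q" and k: "1 \<le> k"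
    and \<sigma>: "\<sigma> \<in> tree_ball \<Delta> k \<rightarrow>\<^sub>E {1..q}"
  shows "measure \<mu> {\<Phi> \<in> space \<mu>. restrict \<Phi> (tree_ball \<Delta> k) = \<sigma>} =
    potts_weight w (tree_ball \<Delta> k) \<sigma> / (\<Sum>\<sigma>\<in>tree_ball \<Delta> k \<rightarrow>\<^sub>E {1..q}. potts_weight w (tree_ball \<Delta> k) \<sigma>)"
    (is "?m = ?r")
proof -
  let ?V = "tree_verts \<Delta>"
  have prob: "prob_space \<mu>" and sets: "sets \<mu> = sets (config_space ?V q)"
    using gibbs by (auto simp: potts_gibbs_measure_def)
  interpret prob_space \<mu> by fact
  have sp: "space \<mu> = ?V \<rightarrow>\<^sub>E {1..q}" using sets_eq_imp_space_eq[OF sets] by (simp add: space_PiM)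
  have "\<bar>?m - ?r\<bar> \<le> \<eta>" if \<eta>: "0 < \<eta>" for \<eta>
  proof -
    obtain n where n: "k \<le> n" and mix: "\<And>\<phi>. (\<forall>v\<in>?V. \<phi> v \<in> {1..q}) \<Longrightarrow>
      \<bar>(\<Sum>\<rho> | \<rho> \<in> tree_ball \<Delta> n \<rightarrow>\<^sub>E {1..q} \<and> restrict \<rho> (tree_ball \<Delta> k) = \<sigma>.
        gibbs_kernel (tree_ball \<Delta> (Suc n)) (tree_ball \<Delta> n) q w \<phi> \<rho>) - ?r\<bar> \<le> \<eta>"
      using uniform_mixing[OF q \<Delta>(1) _ w k \<eta>] \<Delta>(2) \<sigma> by (auto simp del: atLeastAtMost_iff)
    let ?A = "tree_ball \<Delta> n" and ?U = "tree_ball \<Delta> (Suc n)"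
    let ?F = "restr_algebra ?V q (?V - ?A)"
    let ?R = "{\<rho>. \<rho> \<in> ?A \<rightarrow>\<^sub>E {1..q} \<and> restrict \<rho> (tree_ball \<Delta> k) = \<sigma>}"
    have sub: "subalgebra \<mu> ?F" using sets by (intro subalgebra_restr_algebra) auto
    interpret finite_measure_subalgebra \<mu> ?F by unfold_locales (rule sub)
    have cyl: "{\<Phi> \<in> space \<mu>. restrict \<Phi> ?A = \<rho>} \<in> sets \<mu>" for \<rho>
      by (rule cylinder_sets[OF sets finite_tree_ball tree_ball_subset])
    let ?ind = "\<lambda>\<rho>. indicator {\<Phi> \<in> space \<mu>. restrict \<Phi> ?A = \<rho>} :: _ \<Rightarrow> real"
    let ?g = "\<lambda>\<rho> \<phi>. gibbs_kernel ?U ?A q w \<phi> \<rho>"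
    have int: "integrable \<mu> (?ind \<rho>)" for \<rho>
      using cyl by (intro integrable_real_indicator) (auto simp: emeasure_eq_measure)
    have gm: "?g \<rho> \<in> borel_measurable \<mu>" for \<rho>
    proof (rule measurable_from_subalg[OF sub], rule kernel_measurable)
      fix u assume "u \<in> ?U - ?A"
      then show "(\<lambda>\<Phi>. \<Phi> u) \<in> measurable ?F (count_space UNIV)"
        using tree_ball_subset[of \<Delta> "Suc n"] by (intro coordinate_measurable_restr_algebra) auto
    qed
    have ae: "AE \<phi> in \<mu>. real_cond_exp \<mu> ?F (?ind \<rho>) \<phi> = ?g \<rho> \<phi>" if "\<rho> \<in> ?R" for \<rho>
      using gibbs_cond_exp[OF gibbs \<Delta>(2) w(1)] q that by auto
    have gint: "integrable \<mu> (?g \<rho>)" "(\<integral>\<phi>. ?g \<rho> \<phi> \<partial>\<mu>) = measure \<mu> {\<Phi> \<in> space \<mu>. restrict \<Phi> ?A = \<rho>}"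
      if "\<rho> \<in> ?R" for \<rho>
    proof -
      have m: "real_cond_exp \<mu> ?F (?ind \<rho>) \<in> borel_measurable \<mu>" by (rule borel_measurable_cond_exp2)
      show "integrable \<mu> (?g \<rho>)"
        using real_cond_exp_int(1)[OF int[of \<rho>]] integrable_cong_AE[OF m gm ae[OF that]] by simp
      have "(\<integral>\<phi>. ?g \<rho> \<phi> \<partial>\<mu>) = (\<integral>\<phi>. real_cond_exp \<mu> ?F (?ind \<rho>) \<phi> \<partial>\<mu>)"
        using integral_cong_AE[OF m gm ae[OF that]] by simp
      also have "\<dots> = (\<integral>\<phi>. ?ind \<rho> \<phi> \<partial>\<mu>)" by (rule real_cond_exp_int(2)[OF int])
      also have "\<dots> = measure \<mu> {\<Phi> \<in> space \<mu>. restrict \<Phi> ?A = \<rho>}" using cyl by simp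
      finally show "(\<integral>\<phi>. ?g \<rho> \<phi> \<partial>\<mu>) = measure \<mu> {\<Phi> \<in> space \<mu>. restrict \<Phi> ?A = \<rho>}" .
    qed
    have kn: "tree_ball \<Delta> k \<subseteq> ?A" using n by (auto simp: tree_ball_def)
    have "?m = measure \<mu> {\<Phi> \<in> space \<mu>. restrict (restrict \<Phi> ?A) (tree_ball \<Delta> k) = \<sigma>}"
      using kn by (simp add: Int_absorb1)
    also have "\<dots> = (\<Sum>\<rho>\<in>?R. measure \<mu> {\<Phi> \<in> space \<mu>. restrict \<Phi> ?A = \<rho>})"
      by (rule measure_cylinder_sum[OF prob sets finite_tree_ball tree_ball_subset])
    also have "\<dots> = (\<integral>\<phi>. (\<Sum>\<rho>\<in>?R. ?g \<rho> \<phi>) \<partial>\<mu>)"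
      using gint by (subst Bochner_Integration.integral_sum) auto
    finally have m: "?m = (\<integral>\<phi>. (\<Sum>\<rho>\<in>?R. ?g \<rho> \<phi>) \<partial>\<mu>)" .
    have sint: "integrable \<mu> (\<lambda>\<phi>. \<Sum>\<rho>\<in>?R. ?g \<rho> \<phi>)"
      using gint(1) by (rule Bochner_Integration.integrable_sum)
    have bd: "\<bar>(\<Sum>\<rho>\<in>?R. ?g \<rho> \<phi>) - ?r\<bar> \<le> \<eta>" if "\<phi> \<in> space \<mu>" for \<phi>
      using that by (intro mix) (auto simp: sp PiE_def Pi_iff)
    have "?m \<le> ?r + \<eta>" unfolding m
    proof (rule integral_le_const[OF sint AE_I2])
      fix \<phi> assume "\<phi> \<in> space \<mu>"
      from bd[OF this] show "(\<Sum>\<rho>\<in>?R. ?g \<rho> \<phi>) \<le> ?r + \<eta>" by linarith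
    qed
    moreover have "?r - \<eta> \<le> ?m" unfolding m
    proof (rule integral_ge_const[OF sint AE_I2])
      fix \<phi> assume "\<phi> \<in> space \<mu>"
      from bd[OF this] show "?r - \<eta> \<le> (\<Sum>\<rho>\<in>?R. ?g \<rho> \<phi>)" by linarith
    qed
    ultimately show ?thesis by linarith
  qed
  then have "\<bar>?m - ?r\<bar> \<le> 0" by (rule field_le_epsilon[of _ 0, simplified])
  then show ?thesis by simp
qed

section \<open>Ball marginals determine the measure\<close>

lemma finite_subset_tree_ball:
  assumes "finite J" "J \<subseteq> tree_verts \<Delta>"
  obtains k where "1 \<le> k" "J \<subseteq> tree_ball \<Delta> k"
proof
  show "1 \<le> Suc (Max (insert 0 (length ` J)))" by simp
  show "J \<subseteq> tree_ball \<Delta> (Suc (Max (insert 0 (length ` J))))"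
    using assms by (auto simp: tree_ball_def intro!: le_SucI Max_ge)
qed

text \<open>Finite-dimensional product cylinders generate the sigma-algebra and are stable under
  intersection; each is a finite disjoint union of cylinders over a ball that contains its
  base.\<close>

lemma measure_eqI_ball_marginals:
  assumes \<mu>: "prob_space \<mu>" "sets \<mu> = sets (config_space (tree_verts \<Delta>) q)"
    and \<nu>: "prob_space \<nu>" "sets \<nu> = sets (config_space (tree_verts \<Delta>) q)"
    and eq: "\<And>k \<sigma>. 1 \<le> k \<Longrightarrow> \<sigma> \<in> tree_ball \<Delta> k \<rightarrow>\<^sub>E {1..q} \<Longrightarrow>
      measure \<mu> {\<Phi> \<in> space \<mu>. restrict \<Phi> (tree_ball \<Delta> k) = \<sigma>} =
      measure \<nu> {\<Phi> \<in> space \<nu>. restrict \<Phi> (tree_ball \<Delta> k) = \<sigma>}"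
  shows "\<mu> = \<nu>"
proof (rule measure_eqI_PiM_infinite[OF \<mu>(2) \<nu>(2)])
  interpret M: prob_space \<mu> by fact
  interpret N: prob_space \<nu> by fact
  let ?V = "tree_verts \<Delta>"
  have sp: "space \<mu> = ?V \<rightarrow>\<^sub>E {1..q}" "space \<nu> = ?V \<rightarrow>\<^sub>E {1..q}"
    using sets_eq_imp_space_eq[OF \<mu>(2)] sets_eq_imp_space_eq[OF \<nu>(2)] by (auto simp: space_PiM)
  show "finite_measure \<mu>" by unfold_locales
  fix A J assume J: "finite J" "J \<subseteq> ?V" and A: "\<And>i. i \<in> J \<Longrightarrow> A i \<in> sets (count_space {1..q})"
  obtain k where k: "1 \<le> k" "J \<subseteq> tree_ball \<Delta> k" using finite_subset_tree_ball[OF J] .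
  let ?B = "tree_ball \<Delta> k"
  let ?Q = "\<lambda>\<sigma>. \<forall>i\<in>J. \<sigma> i \<in> A i"
  have emb: "prod_emb ?V (\<lambda>_. count_space {1..q}) J (Pi\<^sub>E J A) = {\<Phi> \<in> ?V \<rightarrow>\<^sub>E {1..q}. ?Q (restrict \<Phi> ?B)}"
  proof -
    have "restrict \<Phi> J \<in> Pi\<^sub>E J A \<longleftrightarrow> ?Q (restrict \<Phi> ?B)" for \<Phi>
      using k(2) by (auto simp: restrict_PiE_iff dest: subsetD)
    moreover have "prod_emb ?V (\<lambda>_. count_space {1..q}) J (Pi\<^sub>E J A)
        = {\<Phi> \<in> ?V \<rightarrow>\<^sub>E {1..q}. restrict \<Phi> J \<in> Pi\<^sub>E J A}"
      by (auto simp: prod_emb_def)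
    ultimately show ?thesis by (simp only:)
  qed
  have "measure \<mu> {\<Phi> \<in> space \<mu>. ?Q (restrict \<Phi> ?B)} = measure \<nu> {\<Phi> \<in> space \<nu>. ?Q (restrict \<Phi> ?B)}"
    unfolding measure_cylinder_sum[OF \<mu> finite_tree_ball tree_ball_subset, where Q = ?Q]
      measure_cylinder_sum[OF \<nu> finite_tree_ball tree_ball_subset, where Q = ?Q]
    using eq[OF k(1)] by (intro sum.cong) auto
  then show "emeasure \<mu> (prod_emb ?V (\<lambda>_. count_space {1..q}) J (Pi\<^sub>E J A)) =
      emeasure \<nu> (prod_emb ?V (\<lambda>_. count_space {1..q}) J (Pi\<^sub>E J A))"
    unfolding emb sp M.emeasure_eq_measure N.emeasure_eq_measure by simp
qed

section \<open>Existence\<close>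

lemma integral_cylinder:
  fixes h :: "_ \<Rightarrow> real"
  assumes "prob_space \<mu>" "sets \<mu> = sets (config_space V q)" "finite B" "B \<subseteq> V"
    and f: "\<And>\<Phi>. \<Phi> \<in> space \<mu> \<Longrightarrow> f \<Phi> = h (restrict \<Phi> B)"
  shows "integrable \<mu> f" "(\<integral>\<Phi>. f \<Phi> \<partial>\<mu>) = (\<Sum>\<sigma>\<in>B \<rightarrow>\<^sub>E {1..q}. h \<sigma> * measure \<mu> {\<Phi> \<in> space \<mu>. restrict \<Phi> B = \<sigma>})"
proof -
  interpret prob_space \<mu> by fact
  have sp: "space \<mu> = V \<rightarrow>\<^sub>E {1..q}" using sets_eq_imp_space_eq[OF assms(2)] by (simp add: space_PiM)
  have fin: "finite (B \<rightarrow>\<^sub>E {1..q})" using assms by (intro finite_PiE) auto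
  have cyl: "{\<Phi> \<in> space \<mu>. restrict \<Phi> B = \<sigma>} \<in> sets \<mu>" for \<sigma> by (rule cylinder_sets[OF assms(2-4)])
  let ?f = "\<lambda>\<Phi>. \<Sum>\<sigma>\<in>B \<rightarrow>\<^sub>E {1..q}. h \<sigma> * indicator {\<Phi> \<in> space \<mu>. restrict \<Phi> B = \<sigma>} \<Phi>"
  have eq: "f \<Phi> = ?f \<Phi>" if \<Phi>: "\<Phi> \<in> space \<mu>" for \<Phi>
  proof -
    have r: "restrict \<Phi> B \<in> B \<rightarrow>\<^sub>E {1..q}" using restrict_in_PiE[OF assms(4)] \<Phi> unfolding sp by blast
    have "?f \<Phi> = (\<Sum>\<sigma>\<in>B \<rightarrow>\<^sub>E {1..q}. if \<sigma> = restrict \<Phi> B then h \<sigma> else 0)"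
      using \<Phi> by (intro sum.cong) (auto split: split_indicator)
    also have "\<dots> = h (restrict \<Phi> B)" by (simp only: sum.delta[OF fin] r if_True)
    finally show ?thesis using f[OF \<Phi>] by simp
  qed
  have int: "integrable \<mu> (indicator {\<Phi> \<in> space \<mu>. restrict \<Phi> B = \<sigma>} :: _ \<Rightarrow> real)" for \<sigma>
    using cyl by (intro integrable_real_indicator) (auto simp: emeasure_eq_measure)
  have "integrable \<mu> ?f" using int by (intro Bochner_Integration.integrable_sum integrable_mult_right) 
  moreover have "integrable \<mu> f \<longleftrightarrow> integrable \<mu> ?f"
    by (rule Bochner_Integration.integrable_cong[OF refl]) (rule eq)
  ultimately show "integrable \<mu> f" by simp
  have "(\<integral>\<Phi>. f \<Phi> \<partial>\<mu>) = (\<integral>\<Phi>. ?f \<Phi> \<partial>\<mu>)" by (rule Bochner_Integration.integral_cong[OF refl]) (rule eq)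
  also have "\<dots> = (\<Sum>\<sigma>\<in>B \<rightarrow>\<^sub>E {1..q}. \<integral>\<Phi>. h \<sigma> * indicator {\<Phi> \<in> space \<mu>. restrict \<Phi> B = \<sigma>} \<Phi> \<partial>\<mu>)"
    using int by (intro Bochner_Integration.integral_sum integrable_mult_right)
  also have "\<dots> = (\<Sum>\<sigma>\<in>B \<rightarrow>\<^sub>E {1..q}. h \<sigma> * measure \<mu> {\<Phi> \<in> space \<mu>. restrict \<Phi> B = \<sigma>})"
    using cyl by simp
  finally show "(\<integral>\<Phi>. f \<Phi> \<partial>\<mu>) = (\<Sum>\<sigma>\<in>B \<rightarrow>\<^sub>E {1..q}. h \<sigma> * measure \<mu> {\<Phi> \<in> space \<mu>. restrict \<Phi> B = \<sigma>})" .
qed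

text \<open>The functions f and g are turned into finite measures on exterior configurations, the
  images of their densities under restriction to W. These agree on finite cylinders by
  \<open>eq\<close>, hence everywhere, and events of the restricted algebra are preimages under that
  restriction.\<close>

lemma restr_algebra_integral_eqI:
  fixes f g :: "('v \<Rightarrow> nat) \<Rightarrow> real"
  assumes "prob_space \<mu>" and sets: "sets \<mu> = sets (config_space V q)" and W: "W \<subseteq> V"
    and f: "integrable \<mu> f" "\<And>\<Phi>. 0 \<le> f \<Phi>" and g: "integrable \<mu> g" "\<And>\<Phi>. 0 \<le> g \<Phi>"
    and eq: "\<And>J X. finite J \<Longrightarrow> J \<subseteq> W \<Longrightarrow>
      (\<integral>\<Phi>. f \<Phi> * (if \<forall>i\<in>J. \<Phi> i \<in> X i then 1 else 0) \<partial>\<mu>) = (\<integral>\<Phi>. g \<Phi> * (if \<forall>i\<in>J. \<Phi> i \<in> X i then 1 else 0) \<partial>\<mu>)"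
    and S: "S \<in> sets (restr_algebra V q W)"
  shows "(\<integral>\<Phi>\<in>S. f \<Phi> \<partial>\<mu>) = (\<integral>\<Phi>\<in>S. g \<Phi> \<partial>\<mu>)"
proof -
  interpret prob_space \<mu> by fact
  have sp: "space \<mu> = V \<rightarrow>\<^sub>E {1..q}" using sets_eq_imp_space_eq[OF sets] by (simp add: space_PiM)
  let ?r = "\<lambda>\<Phi>. restrict \<Phi> W"
  let ?N = "config_space W q"
  have rm: "?r \<in> measurable \<mu> ?N"
    using measurable_restrict_subset[OF W, of "\<lambda>_. count_space {1..q}"] measurable_cong_sets[OF sets refl] by blast
  define \<nu> where "\<nu> f = distr (density \<mu> (\<lambda>\<Phi>. ennreal (f \<Phi>))) ?N ?r" for f :: "('v \<Rightarrow> nat) \<Rightarrow> real"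
  have em: "emeasure (\<nu> f) T = ennreal (\<integral>\<Phi>. f \<Phi> * indicator (?r -` T \<inter> space \<mu>) \<Phi> \<partial>\<mu>)"
    if T: "T \<in> sets ?N" and f: "integrable \<mu> f" "\<And>\<Phi>. 0 \<le> f \<Phi>" for T f
  proof -
    have m: "?r -` T \<inter> space \<mu> \<in> sets \<mu>" using measurable_sets[OF rm T] .
    have fm: "(\<lambda>\<Phi>. ennreal (f \<Phi>)) \<in> borel_measurable \<mu>" using f(1) by measurable
    have "emeasure (\<nu> f) T = emeasure (density \<mu> (\<lambda>\<Phi>. ennreal (f \<Phi>))) (?r -` T \<inter> space \<mu>)"
      unfolding \<nu>_def using rm T by (subst emeasure_distr) auto
    also have "\<dots> = (\<integral>\<^sup>+\<Phi>. ennreal (f \<Phi>) * indicator (?r -` T \<inter> space \<mu>) \<Phi> \<partial>\<mu>)"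
      by (rule emeasure_density[OF fm m])
    also have "\<dots> = (\<integral>\<^sup>+\<Phi>. ennreal (f \<Phi> * indicator (?r -` T \<inter> space \<mu>) \<Phi>) \<partial>\<mu>)"
      by (intro nn_integral_cong) (auto split: split_indicator)
    also have "\<dots> = ennreal (\<integral>\<Phi>. f \<Phi> * indicator (?r -` T \<inter> space \<mu>) \<Phi> \<partial>\<mu>)"
      using f m by (intro nn_integral_eq_integral integrable_real_mult_indicator) auto
    finally show ?thesis .
  qed
  have "\<nu> f = \<nu> g"
  proof (rule measure_eqI_PiM_infinite)
    show "sets (\<nu> f) = sets ?N" "sets (\<nu> g) = sets ?N" by (simp_all add: \<nu>_def)
    show "finite_measure (\<nu> f)"
    proof (rule finite_measureI)
      have "space (\<nu> f) = space ?N" by (simp add: \<nu>_def)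
      then show "emeasure (\<nu> f) (space (\<nu> f)) \<noteq> \<infinity>" using em[OF sets.top f] by simp
    qed
    fix X J assume J: "finite J" "J \<subseteq> W" and X: "\<And>i. i \<in> J \<Longrightarrow> X i \<in> sets (count_space {1..q})"
    let ?T = "prod_emb W (\<lambda>_. count_space {1..q}) J (Pi\<^sub>E J X)"
    have T: "?T \<in> sets ?N" using J X by (intro sets_PiM_I) auto
    have ind: "indicator (?r -` ?T \<inter> space \<mu>) \<Phi> = (if \<forall>i\<in>J. \<Phi> i \<in> X i then 1 else 0 :: real)" if "\<Phi> \<in> space \<mu>" for \<Phi>
    proof -
      have "\<Phi> \<in> V \<rightarrow>\<^sub>E {1..q}" using that by (simp add: sp)
      from restrict_in_PiE[OF W this] have r: "?r \<Phi> \<in> W \<rightarrow>\<^sub>E {1..q}" .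
      have "restrict (?r \<Phi>) J = restrict \<Phi> J" using J(2) by (simp add: Int_absorb1)
      then have "restrict (?r \<Phi>) J \<in> Pi\<^sub>E J X \<longleftrightarrow> (\<forall>i\<in>J. \<Phi> i \<in> X i)" by (simp only: restrict_PiE_iff)
      moreover have "?r \<Phi> \<in> ?T \<longleftrightarrow> restrict (?r \<Phi>) J \<in> Pi\<^sub>E J X"
        using r unfolding prod_emb_def by (simp only: space_count_space vimage_eq Int_iff simp_thms)
      ultimately show ?thesis using that by (auto split: split_indicator)
    qed
    have "(\<integral>\<Phi>. f \<Phi> * indicator (?r -` ?T \<inter> space \<mu>) \<Phi> \<partial>\<mu>) = (\<integral>\<Phi>. f \<Phi> * (if \<forall>i\<in>J. \<Phi> i \<in> X i then 1 else 0) \<partial>\<mu>)"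
      by (intro Bochner_Integration.integral_cong refl) (simp only: ind)
    also have "\<dots> = (\<integral>\<Phi>. g \<Phi> * (if \<forall>i\<in>J. \<Phi> i \<in> X i then 1 else 0) \<partial>\<mu>)" by (rule eq[OF J])
    also have "\<dots> = (\<integral>\<Phi>. g \<Phi> * indicator (?r -` ?T \<inter> space \<mu>) \<Phi> \<partial>\<mu>)"
      by (intro Bochner_Integration.integral_cong refl) (simp only: ind)
    finally show "emeasure (\<nu> f) ?T = emeasure (\<nu> g) ?T" by (simp only: em[OF T f] em[OF T g])
  qed
  moreover obtain T where T: "T \<in> sets ?N" "S = ?r -` T \<inter> space \<mu>"
  proof -
    have "?r \<in> (V \<rightarrow>\<^sub>E {1..q}) \<rightarrow> space ?N"
      unfolding space_PiM space_count_space using restrict_in_PiE[OF W] by blast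
    then show ?thesis using S that unfolding restr_algebra_def sp by (auto simp: sets_vimage_algebra2)
  qed
  ultimately have "ennreal (\<integral>\<Phi>. f \<Phi> * indicator S \<Phi> \<partial>\<mu>) = ennreal (\<integral>\<Phi>. g \<Phi> * indicator S \<Phi> \<partial>\<mu>)"
    using em[OF T(1) f] em[OF T(1) g] by simp
  then have "(\<integral>\<Phi>. f \<Phi> * indicator S \<Phi> \<partial>\<mu>) = (\<integral>\<Phi>. g \<Phi> * indicator S \<Phi> \<partial>\<mu>)"
    using f g by (subst (asm) ennreal_inj) (auto intro!: integral_nonneg_AE)
  then show ?thesis unfolding set_lebesgue_integral_def by (simp add: mult.commute)
qed

section \<open>The Gibbs condition from the product form of ball weights\<close>

lemma nonroots_interior:
  assumes "u \<in> nonroots V'" "V' \<subseteq> tree_verts \<Delta>" "u \<notin> nonroots U"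
  shows "u \<notin> intr (tree_verts \<Delta>) (tree_edges \<Delta>) U" "tl u \<notin> intr (tree_verts \<Delta>) (tree_edges \<Delta>) U"
proof -
  have u: "u \<in> tree_verts \<Delta>" "u \<noteq> []" "tl u \<in> tree_verts \<Delta>" "u \<notin> U \<or> tl u \<notin> U"
    using assms by (auto simp: nonroots_def)
  have "{tl u, u} \<in> tree_edges \<Delta>" "{u, tl u} \<in> tree_edges \<Delta>"
    using u by (cases u; auto simp: tree_edges_iff)+
  then show "u \<notin> intr (tree_verts \<Delta>) (tree_edges \<Delta>) U" "tl u \<notin> intr (tree_verts \<Delta>) (tree_edges \<Delta>) U"
    using u by (auto simp: intr_def bdry_def)
qed

text \<open>An interior vertex has all its neighbours in U, so an edge of B that is not inside U has
  no endpoint in A, and its weight does not change when A is resampled.\<close>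

lemma potts_weight_split:
  assumes B: "finite B" "B \<subseteq> tree_verts \<Delta>" and U: "U \<subseteq> B"
  defines "A \<equiv> intr (tree_verts \<Delta>) (tree_edges \<Delta>) U"
  shows "potts_weight w B (override_on \<tau> \<rho> A) = potts_weight w U (override_on \<tau> \<rho> A) *
    (\<Prod>u\<in>nonroots B - nonroots U. if \<tau> (tl u) = \<tau> u then w else 1)"
proof -
  have "nonroots U \<subseteq> nonroots B" using U by (auto simp: nonroots_def)
  then have "potts_weight w B (override_on \<tau> \<rho> A) =
      (\<Prod>u\<in>nonroots B - nonroots U. if override_on \<tau> \<rho> A (tl u) = override_on \<tau> \<rho> A u then w else 1) *
      potts_weight w U (override_on \<tau> \<rho> A)"
    unfolding potts_weight_def using finite_nonroots[OF B(1)] by (intro prod.subset_diff)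
  also have "(\<Prod>u\<in>nonroots B - nonroots U. if override_on \<tau> \<rho> A (tl u) = override_on \<tau> \<rho> A u then w else 1) =
      (\<Prod>u\<in>nonroots B - nonroots U. if \<tau> (tl u) = \<tau> u then w else 1)"
  proof (rule prod.cong[OF refl])
    fix u assume "u \<in> nonroots B - nonroots U"
    then have "u \<notin> A" "tl u \<notin> A" unfolding A_def using nonroots_interior[OF _ B(2)] by auto
    then show "(if override_on \<tau> \<rho> A (tl u) = override_on \<tau> \<rho> A u then w else 1) = (if \<tau> (tl u) = \<tau> u then w else 1)"
      by simp
  qed
  finally show ?thesis by (simp only: mult.commute)
qed

text \<open>Within a large ball the weight is the weight of U times a factor of the exterior, so the
  conditional law of the interior is the kernel, whatever the constants C are. The identity defining
  conditional expectation is checked on finite exterior cylinders and extended by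
  \<open>restr_algebra_integral_eqI\<close>.\<close>

lemma gibbs_of_ball_marginals:
  assumes "prob_space \<mu>" and sets: "sets \<mu> = sets (config_space (tree_verts \<Delta>) q)"
    and w: "0 < w" and q: "1 \<le> q"
    and marg: "\<And>k. \<exists>C. \<forall>\<sigma>\<in>tree_ball \<Delta> k \<rightarrow>\<^sub>E {1..q}.
      measure \<mu> {\<Phi> \<in> space \<mu>. restrict \<Phi> (tree_ball \<Delta> k) = \<sigma>} = C * potts_weight w (tree_ball \<Delta> k) \<sigma>"
  shows "potts_gibbs_measure (tree_verts \<Delta>) (tree_edges \<Delta>) q w \<mu>"
  unfolding potts_gibbs_measure_def
proof (intro conjI allI impI)
  show "prob_space \<mu>" "sets \<mu> = sets (config_space (tree_verts \<Delta>) q)" by fact+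
  interpret prob_space \<mu> by fact
  let ?V = "tree_verts \<Delta>"
  have sp: "space \<mu> = ?V \<rightarrow>\<^sub>E {1..q}" using sets_eq_imp_space_eq[OF sets] by (simp add: space_PiM)
  fix U assume "finite U \<and> U \<subseteq> ?V"
  then have U: "finite U" "U \<subseteq> ?V" by auto
  define A where "A = intr ?V (tree_edges \<Delta>) U"
  define B where "B = bdry ?V (tree_edges \<Delta>) U"
  have AB: "A \<union> B = U" "A \<inter> B = {}" by (auto simp: A_def B_def intr_def bdry_def)
  have finA: "finite A" using AB U finite_subset by blast
  have AV: "A \<subseteq> ?V" using AB U by auto
  have finPA: "finite (A \<rightarrow>\<^sub>E {1..q})" using finA by (intro finite_PiE) auto
  let ?F = "restr_algebra ?V q (?V - A)"
  have sub: "subalgebra \<mu> ?F" using sets by (intro subalgebra_restr_algebra) auto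
  interpret finite_measure_subalgebra \<mu> ?F by unfold_locales (rule sub)
  let ?ind = "\<lambda>\<rho>. indicator {\<Phi> \<in> space \<mu>. restrict \<Phi> A = \<rho>} :: _ \<Rightarrow> real"
  let ?g = "\<lambda>\<rho> \<phi>. gibbs_kernel U A q w \<phi> \<rho>"
  have cyl: "{\<Phi> \<in> space \<mu>. restrict \<Phi> A = \<rho>} \<in> sets \<mu>" for \<rho> by (rule cylinder_sets[OF sets finA AV])
  have int_ind: "integrable \<mu> (?ind \<rho>)" for \<rho>
    using cyl by (intro integrable_real_indicator) (auto simp: emeasure_eq_measure)
  have kernel_cong: "gibbs_kernel U A q w \<phi> \<rho> = gibbs_kernel U A q w \<psi> \<rho>"
    if "\<And>x. x \<in> U - A \<Longrightarrow> \<phi> x = \<psi> x" for \<phi> \<psi> \<rho>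
  proof -
    have "potts_weight w U (override_on \<phi> \<rho> A) = potts_weight w U (override_on \<psi> \<rho> A)" for \<rho>
      using that by (intro potts_weight_cong) (auto simp: override_on_def)
    then show ?thesis by (simp add: gibbs_kernel_def)
  qed
  have int_g: "integrable \<mu> (?g \<rho>)" for \<rho>
    by (rule integral_cylinder(1)[OF \<open>prob_space \<mu>\<close> sets U, where h = "?g \<rho>"]) (auto intro!: kernel_cong)
  have "AE \<phi> in \<mu>. real_cond_exp \<mu> ?F (?ind \<rho>) \<phi> = ?g \<rho> \<phi>" if \<rho>: "\<rho> \<in> A \<rightarrow>\<^sub>E {1..q}" for \<rho>
  proof (rule real_cond_exp_charact[OF _ int_ind int_g])
    show "?g \<rho> \<in> borel_measurable ?F"
      using U by (intro kernel_measurable coordinate_measurable_restr_algebra) auto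
    fix S assume S: "S \<in> sets ?F"
    show "(\<integral>\<Phi>\<in>S. ?ind \<rho> \<Phi> \<partial>\<mu>) = (\<integral>\<Phi>\<in>S. ?g \<rho> \<Phi> \<partial>\<mu>)"
    proof (rule restr_algebra_integral_eqI[OF \<open>prob_space \<mu>\<close> sets _ int_ind _ int_g _ _ S])
      show "0 \<le> ?g \<rho> \<Phi>" for \<Phi> using gibbs_kernel_pos[OF finA w q] by (simp add: less_imp_le)
      fix J X assume J: "finite J" "J \<subseteq> ?V - A"
      have "finite (J \<union> U)" "J \<union> U \<subseteq> ?V" using J U by auto
      then obtain k where k: "J \<union> U \<subseteq> tree_ball \<Delta> k" using finite_subset_tree_ball by metis
      let ?B = "tree_ball \<Delta> k"
      let ?C = "?B - A"
      obtain c where c: "\<And>\<sigma>. \<sigma> \<in> ?B \<rightarrow>\<^sub>E {1..q} \<Longrightarrow>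
        measure \<mu> {\<Phi> \<in> space \<mu>. restrict \<Phi> ?B = \<sigma>} = c * potts_weight w ?B \<sigma>"
        using marg by blast
      let ?cyl = "\<lambda>\<Phi> :: nat list \<Rightarrow> nat. if \<forall>i\<in>J. \<Phi> i \<in> X i then 1 else 0 :: real"
      have BAC: "?B = A \<union> ?C" "A \<inter> ?C = {}" using AB k by auto
      define R where "R \<tau> = (\<Prod>u\<in>nonroots ?B - nonroots U. if \<tau> (tl u) = \<tau> u then w else 1)" for \<tau> :: "nat list \<Rightarrow> nat"
      have wt: "potts_weight w ?B (override_on \<tau> \<rho>' A) = potts_weight w U (override_on \<tau> \<rho>' A) * R \<tau>" for \<tau> \<rho>'
        unfolding R_def A_def using k by (intro potts_weight_split finite_tree_ball tree_ball_subset) auto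
      \<comment> \<open>On a ball containing J and U the integral is a finite sum. With the interior
        summed last, the exterior weight and the cylinder condition come out as common factors, the
        latter because J avoids A.\<close>
      have int_cyl: "(\<integral>\<Phi>. f \<Phi> * ?cyl \<Phi> \<partial>\<mu>) = (\<Sum>\<tau>\<in>?C \<rightarrow>\<^sub>E {1..q}. c * R \<tau> * ?cyl \<tau> *
          (\<Sum>\<rho>'\<in>A \<rightarrow>\<^sub>E {1..q}. h (override_on \<tau> \<rho>' A) * potts_weight w U (override_on \<tau> \<rho>' A)))"
        if fh: "\<And>\<Phi>. \<Phi> \<in> space \<mu> \<Longrightarrow> f \<Phi> = h (restrict \<Phi> ?B)" for f h :: "_ \<Rightarrow> real"
      proof -
        have "(\<integral>\<Phi>. f \<Phi> * ?cyl \<Phi> \<partial>\<mu>) = (\<Sum>\<sigma>\<in>?B \<rightarrow>\<^sub>E {1..q}. (h \<sigma> * ?cyl \<sigma>) * measure \<mu> {\<Phi> \<in> space \<mu>. restrict \<Phi> ?B = \<sigma>})"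
        proof (rule integral_cylinder(2)[OF \<open>prob_space \<mu>\<close> sets finite_tree_ball tree_ball_subset])
          fix \<Phi> assume "\<Phi> \<in> space \<mu>"
          moreover have "(\<forall>i\<in>J. restrict \<Phi> ?B i \<in> X i) = (\<forall>i\<in>J. \<Phi> i \<in> X i)"
            using k by (intro ball_cong) auto
          ultimately show "f \<Phi> * ?cyl \<Phi> = h (restrict \<Phi> ?B) * ?cyl (restrict \<Phi> ?B)" using fh by simp
        qed
        also have "\<dots> = (\<Sum>\<sigma>\<in>?B \<rightarrow>\<^sub>E {1..q}. h \<sigma> * ?cyl \<sigma> * (c * potts_weight w ?B \<sigma>))"
          by (intro sum.cong refl) (simp only: c)
        also have "\<dots> = (\<Sum>\<tau>\<in>?C \<rightarrow>\<^sub>E {1..q}. \<Sum>\<rho>'\<in>A \<rightarrow>\<^sub>E {1..q}. h (override_on \<tau> \<rho>' A) *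
            ?cyl (override_on \<tau> \<rho>' A) * (c * potts_weight w ?B (override_on \<tau> \<rho>' A)))"
          by (subst BAC(1)) (rule sum_PiE_Un[OF BAC(2)])
        also have "\<dots> = (\<Sum>\<tau>\<in>?C \<rightarrow>\<^sub>E {1..q}. \<Sum>\<rho>'\<in>A \<rightarrow>\<^sub>E {1..q}. c * R \<tau> * ?cyl \<tau> *
            (h (override_on \<tau> \<rho>' A) * potts_weight w U (override_on \<tau> \<rho>' A)))"
        proof (intro sum.cong refl)
          fix \<tau> \<rho>'
          have "(\<forall>i\<in>J. override_on \<tau> \<rho>' A i \<in> X i) = (\<forall>i\<in>J. \<tau> i \<in> X i)"
            using J by (intro ball_cong) auto
          then show "h (override_on \<tau> \<rho>' A) * ?cyl (override_on \<tau> \<rho>' A) * (c * potts_weight w ?B (override_on \<tau> \<rho>' A)) =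
            c * R \<tau> * ?cyl \<tau> * (h (override_on \<tau> \<rho>' A) * potts_weight w U (override_on \<tau> \<rho>' A))"
            by (simp add: wt)
        qed
        finally show ?thesis by (simp only: sum_distrib_left)
      qed
      \<comment> \<open>The heart of the verification: for a fixed exterior, the weight at
        \<open>\<rho>\<close> is its kernel probability times the total weight over all interior
        configurations.\<close>
      have inner: "(\<Sum>\<rho>'\<in>A \<rightarrow>\<^sub>E {1..q}. (if restrict (override_on \<tau> \<rho>' A) A = \<rho> then 1 else 0) * potts_weight w U (override_on \<tau> \<rho>' A))
        = (\<Sum>\<rho>'\<in>A \<rightarrow>\<^sub>E {1..q}. ?g \<rho> (override_on \<tau> \<rho>' A) * potts_weight w U (override_on \<tau> \<rho>' A))" for \<tau>
      proof -
        have "restrict (override_on \<tau> \<rho>' A) A = \<rho>'" if "\<rho>' \<in> A \<rightarrow>\<^sub>E {1..q}" for \<rho>'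
          using that by (auto simp: fun_eq_iff PiE_def extensional_def)
        then have "(\<Sum>\<rho>'\<in>A \<rightarrow>\<^sub>E {1..q}. (if restrict (override_on \<tau> \<rho>' A) A = \<rho> then 1 else 0) * potts_weight w U (override_on \<tau> \<rho>' A))
          = (\<Sum>\<rho>'\<in>A \<rightarrow>\<^sub>E {1..q}. if \<rho>' = \<rho> then potts_weight w U (override_on \<tau> \<rho>' A) else 0)"
          by (intro sum.cong) (simp_all only: if_distrib if_True if_False mult_1 mult_zero_left split: if_split, auto)
        also have "\<dots> = potts_weight w U (override_on \<tau> \<rho> A)" by (simp only: sum.delta[OF finPA] \<rho> if_True)
        also have "\<dots> = ?g \<rho> \<tau> * (\<Sum>\<rho>'\<in>A \<rightarrow>\<^sub>E {1..q}. potts_weight w U (override_on \<tau> \<rho>' A))"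
          using gibbs_kernel_pos[OF finA w q, of U \<tau> \<rho>] unfolding gibbs_kernel_def by auto
        also have "\<dots> = (\<Sum>\<rho>'\<in>A \<rightarrow>\<^sub>E {1..q}. ?g \<rho> (override_on \<tau> \<rho>' A) * potts_weight w U (override_on \<tau> \<rho>' A))"
          unfolding sum_distrib_left
        proof (intro sum.cong refl)
          fix \<rho>'
          have "?g \<rho> \<tau> = ?g \<rho> (override_on \<tau> \<rho>' A)" by (rule kernel_cong) auto
          then show "?g \<rho> \<tau> * potts_weight w U (override_on \<tau> \<rho>' A) =
            ?g \<rho> (override_on \<tau> \<rho>' A) * potts_weight w U (override_on \<tau> \<rho>' A)" by simp
        qed
        finally show ?thesis .
      qed
      have "(\<integral>\<Phi>. ?ind \<rho> \<Phi> * ?cyl \<Phi> \<partial>\<mu>) = (\<Sum>\<tau>\<in>?C \<rightarrow>\<^sub>E {1..q}. c * R \<tau> * ?cyl \<tau> *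
          (\<Sum>\<rho>'\<in>A \<rightarrow>\<^sub>E {1..q}. (if restrict (override_on \<tau> \<rho>' A) A = \<rho> then 1 else 0) * potts_weight w U (override_on \<tau> \<rho>' A)))"
      proof (rule int_cyl[of "?ind \<rho>" "\<lambda>\<sigma>. if restrict \<sigma> A = \<rho> then 1 else 0"])
        fix \<Phi> assume "\<Phi> \<in> space \<mu>"
        moreover have "restrict (restrict \<Phi> ?B) A = restrict \<Phi> A"
          using AB k by (auto simp: restrict_def fun_eq_iff)
        ultimately show "?ind \<rho> \<Phi> = (if restrict (restrict \<Phi> ?B) A = \<rho> then 1 else 0)" by (simp add: indicator_def)
      qed
      also have "\<dots> = (\<Sum>\<tau>\<in>?C \<rightarrow>\<^sub>E {1..q}. c * R \<tau> * ?cyl \<tau> *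
          (\<Sum>\<rho>'\<in>A \<rightarrow>\<^sub>E {1..q}. ?g \<rho> (override_on \<tau> \<rho>' A) * potts_weight w U (override_on \<tau> \<rho>' A)))"
        by (simp only: inner)
      also have "\<dots> = (\<integral>\<Phi>. ?g \<rho> \<Phi> * ?cyl \<Phi> \<partial>\<mu>)"
      proof (rule int_cyl[of "?g \<rho>" "?g \<rho>", symmetric])
        fix \<Phi>
        show "?g \<rho> \<Phi> = ?g \<rho> (restrict \<Phi> ?B)" using k by (intro kernel_cong) auto
      qed
      finally show "(\<integral>\<Phi>. ?ind \<rho> \<Phi> * ?cyl \<Phi> \<partial>\<mu>) = (\<integral>\<Phi>. ?g \<rho> \<Phi> * ?cyl \<Phi> \<partial>\<mu>)" .
    qed auto
  qed
  then have "AE \<phi> in \<mu>. \<forall>\<rho>\<in>A \<rightarrow>\<^sub>E {1..q}. real_cond_exp \<mu> ?F (?ind \<rho>) \<phi> = ?g \<rho> \<phi>"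
    using finPA by (intro AE_finite_allI)
  then have "AE \<phi> in \<mu>. real_cond_exp \<mu> ?F (?ind (restrict \<phi> A)) \<phi> =
    \<P>(\<Phi> in potts_measure U (induced_edges (tree_edges \<Delta>) U) q w.
            restrict \<Phi> A = restrict \<phi> A \<bar> restrict \<Phi> B = restrict \<phi> B)"
  proof (rule AE_mp[OF _ AE_I2], intro impI)
    fix \<phi> assume \<phi>: "\<phi> \<in> space \<mu>" and ae: "\<forall>\<rho>\<in>A \<rightarrow>\<^sub>E {1..q}. real_cond_exp \<mu> ?F (?ind \<rho>) \<phi> = ?g \<rho> \<phi>"
    have \<phi>V: "\<phi> \<in> ?V \<rightarrow>\<^sub>E {1..q}" using \<phi> by (simp add: sp)
    have "\<phi> x \<in> {1..q}" if "x \<in> U" for x using PiE_mem[OF \<phi>V, of x] that U by blast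
    then have "\<P>(\<Phi> in potts_measure U (induced_edges (tree_edges \<Delta>) U) q w.
            restrict \<Phi> A = restrict \<phi> A \<bar> restrict \<Phi> B = restrict \<phi> B) = ?g (restrict \<phi> A) \<phi>"
      by (rule cond_prob_potts_measure[OF U w q AB])
    then show "real_cond_exp \<mu> ?F (?ind (restrict \<phi> A)) \<phi> =
      \<P>(\<Phi> in potts_measure U (induced_edges (tree_edges \<Delta>) U) q w.
            restrict \<Phi> A = restrict \<phi> A \<bar> restrict \<Phi> B = restrict \<phi> B)"
      using bspec[OF ae restrict_in_PiE[OF AV \<phi>V]] by (simp only:)
  qed
  then show "AE \<phi> in \<mu>.
    real_cond_exp \<mu> (restr_algebra ?V q (?V - intr ?V (tree_edges \<Delta>) U))
     (indicator {\<Phi> \<in> space \<mu>. restrict \<Phi> (intr ?V (tree_edges \<Delta>) U) = restrict \<phi> (intr ?V (tree_edges \<Delta>) U)}) \<phi> =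
    \<P>(\<Phi> in potts_measure U (induced_edges (tree_edges \<Delta>) U) q w.
            restrict \<Phi> (intr ?V (tree_edges \<Delta>) U) = restrict \<phi> (intr ?V (tree_edges \<Delta>) U) \<bar>
            restrict \<Phi> (bdry ?V (tree_edges \<Delta>) U) = restrict \<phi> (bdry ?V (tree_edges \<Delta>) U))"
    unfolding A_def B_def .
qed

text \<open>
  The Gibbs measure is the law of the tree-indexed Markov chain with uniform root. Each vertex
  carries an independent random self-map of the colours, applied to the colour of its parent; the
  dummy colour \<open>0\<close>, which differs from all colours in \<open>{1..q}\<close>, plays the parent of the root.
\<close>

definition chain_prob :: "nat \<Rightarrow> real \<Rightarrow> nat \<Rightarrow> nat \<Rightarrow> real" where
  "chain_prob q w c j = (if c = j then w else 1) / (\<Sum>i\<in>{1..q}. if c = i then w else 1)"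

definition chain_step :: "nat \<Rightarrow> real \<Rightarrow> nat \<Rightarrow> nat measure" where
  "chain_step q w c = point_measure {1..q} (\<lambda>j. ennreal (chain_prob q w c j))"

definition chain_noise :: "nat \<Rightarrow> nat \<Rightarrow> real \<Rightarrow> (nat list \<times> nat \<Rightarrow> nat) measure" where
  "chain_noise \<Delta> q w = (\<Pi>\<^sub>M x\<in>tree_verts \<Delta> \<times> {0..q}. chain_step q w (snd x))"

primrec chain_colour :: "(nat list \<times> nat \<Rightarrow> nat) \<Rightarrow> nat list \<Rightarrow> nat" where
  "chain_colour \<xi> [] = \<xi> ([], 0)"
| "chain_colour \<xi> (i # v) = \<xi> (i # v, chain_colour \<xi> v)"

definition chain_measure :: "nat \<Rightarrow> nat \<Rightarrow> real \<Rightarrow> (nat list \<Rightarrow> nat) measure" where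
  "chain_measure \<Delta> q w =
     distr (chain_noise \<Delta> q w) (config_space (tree_verts \<Delta>) q) (\<lambda>\<xi>. \<lambda>u\<in>tree_verts \<Delta>. chain_colour \<xi> u)"

definition parent_colour :: "(nat list \<Rightarrow> nat) \<Rightarrow> nat list \<Rightarrow> nat" where
  "parent_colour \<sigma> u = (if u = [] then 0 else \<sigma> (tl u))"

lemma chain_prob_nonneg: "0 < w \<Longrightarrow> 0 \<le> chain_prob q w c j"
  unfolding chain_prob_def by (intro divide_nonneg_nonneg sum_nonneg) auto

lemma chain_normaliser_pos: "0 < w \<Longrightarrow> 1 \<le> q \<Longrightarrow> 0 < (\<Sum>i\<in>{1..q}. if c = i then w else 1)" for w :: real and c :: nat
  by (intro sum_pos) auto

lemma measure_chain_step:
  assumes "0 < w" "j \<in> {1..q}"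
  shows "measure (chain_step q w c) {j} = chain_prob q w c j"
proof -
  have "emeasure (chain_step q w c) {j} = ennreal (chain_prob q w c j)"
    unfolding chain_step_def using assms(2) by (subst emeasure_point_measure_finite) auto
  then show ?thesis using chain_prob_nonneg[OF assms(1)] by (simp add: measure_def)
qed

lemma prob_space_chain_step:
  assumes "0 < w" "1 \<le> q"
  shows "prob_space (chain_step q w c)"
proof (rule prob_spaceI)
  have "emeasure (chain_step q w c) (space (chain_step q w c)) = (\<Sum>j\<in>{1..q}. ennreal (chain_prob q w c j))"
    unfolding chain_step_def by (simp add: space_point_measure emeasure_point_measure_finite)
  also have "\<dots> = ennreal (\<Sum>j\<in>{1..q}. chain_prob q w c j)"
    using chain_prob_nonneg[OF assms(1)] by (intro sum_ennreal) auto
  also have "(\<Sum>j\<in>{1..q}. chain_prob q w c j) = 1"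
    unfolding chain_prob_def sum_divide_distrib[symmetric] using chain_normaliser_pos[OF assms, of c] by simp
  finally show "emeasure (chain_step q w c) (space (chain_step q w c)) = 1" by simp
qed

lemma chain_noise_component_measurable:
  assumes "u \<in> tree_verts \<Delta>" "c \<in> {0..q}"
  shows "(\<lambda>\<xi>. \<xi> (u, c)) \<in> measurable (chain_noise \<Delta> q w) (count_space {1..q})"
proof -
  have x: "(u, c) \<in> tree_verts \<Delta> \<times> {0..q}" using assms by simp
  have "(\<lambda>\<xi>. \<xi> (u, c)) \<in> measurable (chain_noise \<Delta> q w) (chain_step q w c)"
    unfolding chain_noise_def
    using measurable_component_singleton[OF x, of "\<lambda>x. chain_step q w (snd x)"] unfolding snd_conv .
  moreover have "measurable (chain_noise \<Delta> q w) (chain_step q w c) =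
      measurable (chain_noise \<Delta> q w) (count_space {1..q})"
    by (rule measurable_cong_sets[OF refl]) (simp add: chain_step_def sets_point_measure)
  ultimately show ?thesis by (simp only:)
qed

lemma chain_colour_measurable:
  assumes "u \<in> tree_verts \<Delta>"
  shows "(\<lambda>\<xi>. chain_colour \<xi> u) \<in> measurable (chain_noise \<Delta> q w) (count_space {1..q})"
  using assms
proof (induction u)
  case Nil
  then show ?case using chain_noise_component_measurable[of "[]" \<Delta> 0 q w] by simp
next
  case (Cons i v)
  have "(\<lambda>\<xi>. \<xi> (i # v, chain_colour \<xi> v)) \<in> measurable (chain_noise \<Delta> q w) (count_space {1..q})"
  proof (rule measurable_compose_countable'[where f = "\<lambda>c \<xi>. \<xi> (i # v, c)" and I = "{1..q}"])
    show "(\<lambda>\<xi>. chain_colour \<xi> v) \<in> measurable (chain_noise \<Delta> q w) (count_space {1..q})"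
      by (rule Cons.IH[OF tree_verts_tl[OF Cons.prems]])
    fix c assume "c \<in> {1..q}"
    then have "c \<in> {0..q}" by simp
    then show "(\<lambda>\<xi>. \<xi> (i # v, c)) \<in> measurable (chain_noise \<Delta> q w) (count_space {1..q})"
      by (rule chain_noise_component_measurable[OF Cons.prems])
  qed simp
  then show ?case by (simp only: chain_colour.simps)
qed

lemma chain_configuration_measurable:
  "(\<lambda>\<xi>. \<lambda>u\<in>tree_verts \<Delta>. chain_colour \<xi> u) \<in> measurable (chain_noise \<Delta> q w) (config_space (tree_verts \<Delta>) q)"
  by (rule measurable_restrict) (rule chain_colour_measurable)

lemma prob_space_chain_noise:
  assumes "0 < w" "1 \<le> q"
  shows "prob_space (chain_noise \<Delta> q w)"
  unfolding chain_noise_def using assms by (intro prob_space_PiM prob_space_chain_step)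

lemma prob_space_chain_measure:
  assumes "0 < w" "1 \<le> q"
  shows "prob_space (chain_measure \<Delta> q w)"
  unfolding chain_measure_def
  by (rule prob_space.prob_space_distr[OF prob_space_chain_noise[OF assms] chain_configuration_measurable])

text \<open>Prescribing the colours on a ball amounts to prescribing one noise coordinate per
  vertex, the one indexed by the prescribed colour of its parent. These coordinates are
  deterministic and distinct, hence independent, although \<open>chain_colour\<close> itself selects
  its coordinates at random.\<close>

lemma measure_chain_cylinder:
  assumes w: "0 < w" and q: "1 \<le> q" and \<sigma>: "\<sigma> \<in> tree_ball \<Delta> k \<rightarrow>\<^sub>E {1..q}"
  shows "measure (chain_measure \<Delta> q w) {\<Phi> \<in> space (chain_measure \<Delta> q w). restrict \<Phi> (tree_ball \<Delta> k) = \<sigma>} =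
    (\<Prod>u\<in>tree_ball \<Delta> k. chain_prob q w (parent_colour \<sigma> u) (\<sigma> u))"
proof -
  let ?B = "tree_ball \<Delta> k" and ?V = "tree_verts \<Delta>" and ?N = "chain_noise \<Delta> q w"
  let ?M = "chain_measure \<Delta> q w"
  let ?x = "\<lambda>u. (u, parent_colour \<sigma> u)"
  let ?J = "?x ` ?B"
  interpret N: product_prob_space "\<lambda>x. chain_step q w (snd x)" "?V \<times> {0..q}"
    unfolding product_prob_space_def product_prob_space_axioms_def product_sigma_finite_def
    using prob_space_chain_step[OF w q] prob_space_imp_sigma_finite by blast
  have sets: "sets ?M = sets (config_space ?V q)" by (simp add: chain_measure_def)
  have spM: "space ?M = ?V \<rightarrow>\<^sub>E {1..q}" by (simp add: chain_measure_def space_PiM)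
  have spN: "space ?N = (\<Pi>\<^sub>E x\<in>?V \<times> {0..q}. {1..q})"
    by (simp add: chain_noise_def space_PiM chain_step_def space_point_measure)
  have tlB: "tl u \<in> ?B" if "u \<in> ?B" for u using that by (auto simp: tree_ball_def tl_in_tree_verts)
  have \<sigma>q: "\<sigma> u \<in> {1..q}" if "u \<in> ?B" for u using PiE_mem[OF \<sigma> that] .
  have pc: "parent_colour \<sigma> u \<in> {0..q}" if "u \<in> ?B" for u
    using \<sigma>q[OF tlB[OF that]] by (simp add: parent_colour_def)
  have J: "?J \<subseteq> ?V \<times> {0..q}" using pc tree_ball_subset[of \<Delta> k] by blast
  have finJ: "finite ?J" by (intro finite_imageI finite_tree_ball)
  \<comment> \<open>The ball is closed under taking parents, so from the root outwards each noise
    value decides the colour of its vertex.\<close>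
  have colour: "(\<forall>u\<in>?B. chain_colour \<xi> u = \<sigma> u) \<longleftrightarrow> (\<forall>u\<in>?B. \<xi> (?x u) = \<sigma> u)" for \<xi>
  proof
    assume *: "\<forall>u\<in>?B. chain_colour \<xi> u = \<sigma> u"
    show "\<forall>u\<in>?B. \<xi> (?x u) = \<sigma> u"
    proof
      fix u assume u: "u \<in> ?B"
      have "chain_colour \<xi> u = \<sigma> u" "chain_colour \<xi> (tl u) = \<sigma> (tl u)"
        using bspec[OF * u] bspec[OF * tlB[OF u]] .
      then show "\<xi> (?x u) = \<sigma> u" by (cases u) (simp_all add: parent_colour_def)
    qed
  next
    assume *: "\<forall>u\<in>?B. \<xi> (?x u) = \<sigma> u"
    have "u \<in> ?B \<Longrightarrow> chain_colour \<xi> u = \<sigma> u" for u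
    proof (induction u)
      case Nil then show ?case using * by (auto simp: parent_colour_def)
    next
      case (Cons i v)
      have "v \<in> ?B" using tlB[OF Cons.prems] by simp
      then have "chain_colour \<xi> v = \<sigma> v" by (rule Cons.IH)
      then show ?case using * Cons.prems by (auto simp: parent_colour_def)
    qed
    then show "\<forall>u\<in>?B. chain_colour \<xi> u = \<sigma> u" by blast
  qed
  let ?E = "{\<Phi> \<in> space ?M. restrict \<Phi> ?B = \<sigma>}"
  have E: "?E \<in> sets (config_space ?V q)"
    using cylinder_sets[OF sets finite_tree_ball tree_ball_subset] unfolding sets .
  have "measure ?M ?E = measure ?N ((\<lambda>\<xi>. \<lambda>u\<in>?V. chain_colour \<xi> u) -` ?E \<inter> space ?N)"
    unfolding chain_measure_def[of \<Delta> q w] using E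
    by (subst measure_distr[OF chain_configuration_measurable]) (simp_all add: chain_measure_def)
  also have "(\<lambda>\<xi>. \<lambda>u\<in>?V. chain_colour \<xi> u) -` ?E \<inter> space ?N =
      prod_emb (?V \<times> {0..q}) (\<lambda>x. chain_step q w (snd x)) ?J (\<Pi>\<^sub>E x\<in>?J. {\<sigma> (fst x)})"
  proof -
    have 1: "(\<lambda>u\<in>?V. chain_colour \<xi> u) \<in> ?E \<longleftrightarrow> (\<forall>u\<in>?B. chain_colour \<xi> u = \<sigma> u)" if "\<xi> \<in> space ?N" for \<xi>
    proof -
      have "(\<lambda>u\<in>?V. chain_colour \<xi> u) \<in> space ?M"
        using measurable_space[OF chain_configuration_measurable that] by (simp add: chain_measure_def)
      moreover have "restrict (\<lambda>u\<in>?V. chain_colour \<xi> u) ?B = \<sigma> \<longleftrightarrow> (\<forall>u\<in>?B. chain_colour \<xi> u = \<sigma> u)"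
      proof -
        have "restrict (\<lambda>u\<in>?V. chain_colour \<xi> u) ?B = restrict (chain_colour \<xi>) ?B"
          using tree_ball_subset[of \<Delta> k] by (auto simp: restrict_def fun_eq_iff)
        moreover have "restrict (chain_colour \<xi>) ?B = \<sigma> \<longleftrightarrow> (\<forall>u\<in>?B. chain_colour \<xi> u = \<sigma> u)"
          using \<sigma> by (auto simp: restrict_def fun_eq_iff PiE_def extensional_def)
        ultimately show ?thesis by simp
      qed
      ultimately show ?thesis by blast
    qed
    have 2: "restrict \<xi> ?J \<in> (\<Pi>\<^sub>E x\<in>?J. {\<sigma> (fst x)}) \<longleftrightarrow> (\<forall>u\<in>?B. \<xi> (?x u) = \<sigma> u)" for \<xi>
      unfolding restrict_PiE_iff by auto
    have 3: "prod_emb (?V \<times> {0..q}) (\<lambda>x. chain_step q w (snd x)) ?J (\<Pi>\<^sub>E x\<in>?J. {\<sigma> (fst x)}) =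
      {\<xi> \<in> space ?N. restrict \<xi> ?J \<in> (\<Pi>\<^sub>E x\<in>?J. {\<sigma> (fst x)})}"
      unfolding prod_emb_def chain_noise_def space_PiM by blast
    show ?thesis
      unfolding 3
    proof (intro set_eqI)
      fix \<xi>
      show "\<xi> \<in> (\<lambda>\<xi>. \<lambda>u\<in>?V. chain_colour \<xi> u) -` ?E \<inter> space ?N \<longleftrightarrow>
        \<xi> \<in> {\<xi> \<in> space ?N. restrict \<xi> ?J \<in> (\<Pi>\<^sub>E x\<in>?J. {\<sigma> (fst x)})}"
      proof (cases "\<xi> \<in> space ?N")
        case True
        then show ?thesis
          unfolding Int_iff vimage_eq mem_Collect_eq
          using 1[OF True, unfolded mem_Collect_eq] 2[of \<xi>] colour[of \<xi>] by argo
      next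
        case False
        then show ?thesis by blast
      qed
    qed
  qed
  also have "measure ?N \<dots> = (\<Prod>x\<in>?J. measure (chain_step q w (snd x)) {\<sigma> (fst x)})"
    unfolding chain_noise_def
    using \<sigma>q by (intro N.measure_PiM_emb[OF J finJ]) (auto simp: chain_step_def sets_point_measure)
  also have "\<dots> = (\<Prod>u\<in>?B. measure (chain_step q w (parent_colour \<sigma> u)) {\<sigma> u})"
    by (subst prod.reindex) (auto simp: inj_on_def)
  also have "\<dots> = (\<Prod>u\<in>?B. chain_prob q w (parent_colour \<sigma> u) (\<sigma> u))"
    using \<sigma>q by (intro prod.cong measure_chain_step w) auto
  finally show ?thesis .
qed

text \<open>By colour symmetry the normaliser z = q - 1 + w is the same for every parent colour in
  {1..q}, so transition probabilities are edge weights up to a constant. The dummy colour 0 matches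
  no colour and makes the root uniform.\<close>

lemma chain_marginal:
  assumes w: "0 < w" and q: "1 \<le> q"
  shows "\<exists>C. \<forall>\<sigma>\<in>tree_ball \<Delta> k \<rightarrow>\<^sub>E {1..q}.
    measure (chain_measure \<Delta> q w) {\<Phi> \<in> space (chain_measure \<Delta> q w). restrict \<Phi> (tree_ball \<Delta> k) = \<sigma>} =
    C * potts_weight w (tree_ball \<Delta> k) \<sigma>"
proof -
  let ?B = "tree_ball \<Delta> k"
  define z where "z = real q - 1 + w"
  have norm: "(\<Sum>i\<in>{1..q}. if c = i then w else 1) = z" if "c \<in> {1..q}" for c
  proof -
    have "(\<Sum>i\<in>{1..q}. if c = i then w else 1) = (\<Sum>i\<in>{1..q}. 1 - (if c = i then 1 - w else 0))"
      by (intro sum.cong) auto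
    then show ?thesis using that by (simp add: sum_subtractf z_def)
  qed
  have nil: "[] \<in> ?B" by (simp add: tree_ball_def Nil_in_tree_verts)
  have "(\<Prod>u\<in>?B. chain_prob q w (parent_colour \<sigma> u) (\<sigma> u)) =
    (1 / q * (1 / z) ^ card (?B - {[]})) * potts_weight w ?B \<sigma>" if \<sigma>: "\<sigma> \<in> ?B \<rightarrow>\<^sub>E {1..q}" for \<sigma>
  proof -
    have "(\<Sum>i\<in>{1..q}. if 0 = i then w else 1) = (\<Sum>i\<in>{1..q}. 1)" by (intro sum.cong) auto
    then have root: "chain_prob q w (parent_colour \<sigma> []) (\<sigma> []) = 1 / q"
      using PiE_mem[OF \<sigma> nil] by (auto simp: chain_prob_def parent_colour_def)
    have "(\<Prod>u\<in>?B - {[]}. chain_prob q w (parent_colour \<sigma> u) (\<sigma> u)) =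
        (\<Prod>u\<in>?B - {[]}. (1 / z) * (if \<sigma> (tl u) = \<sigma> u then w else 1))"
    proof (rule prod.cong[OF refl])
      fix u assume u: "u \<in> ?B - {[]}"
      then have "tl u \<in> ?B" by (auto simp: tree_ball_def tl_in_tree_verts)
      then have "\<sigma> (tl u) \<in> {1..q}" using PiE_mem[OF \<sigma>] by blast
      from norm[OF this] show "chain_prob q w (parent_colour \<sigma> u) (\<sigma> u) = (1 / z) * (if \<sigma> (tl u) = \<sigma> u then w else 1)"
        using u unfolding chain_prob_def parent_colour_def by (simp del: One_nat_def)
    qed
    also have "\<dots> = (1 / z) ^ card (?B - {[]}) * potts_weight w ?B \<sigma>"
      unfolding prod.distrib prod_constant potts_weight_def nonroots_tree_ball ..
    finally show ?thesis using root by (simp add: prod.remove[OF finite_tree_ball nil])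
  qed
  then show ?thesis
    by (intro exI[of _ "1 / q * (1 / z) ^ card (?B - {[]})"] ballI) (simp only: measure_chain_cylinder[OF w q])
qed

lemma chain_measure_gibbs:
  assumes "0 < w" "1 \<le> q"
  shows "potts_gibbs_measure (tree_verts \<Delta>) (tree_edges \<Delta>) q w (chain_measure \<Delta> q w)"
proof (rule gibbs_of_ball_marginals)
  show "prob_space (chain_measure \<Delta> q w)" by (rule prob_space_chain_measure[OF assms])
  show "sets (chain_measure \<Delta> q w) = sets (config_space (tree_verts \<Delta>) q)"
    unfolding chain_measure_def by (rule sets_distr)
  fix k
  show "\<exists>C. \<forall>\<sigma>\<in>tree_ball \<Delta> k \<rightarrow>\<^sub>E {1..q}.
      measure (chain_measure \<Delta> q w) {\<Phi> \<in> space (chain_measure \<Delta> q w). restrict \<Phi> (tree_ball \<Delta> k) = \<sigma>} =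
      C * potts_weight w (tree_ball \<Delta> k) \<sigma>"
    by (rule chain_marginal[OF assms])
qed (use assms in auto)

theorem mainTheorem1:
  fixes q :: nat
  assumes "q \<ge> 5"
  shows "\<exists>\<Delta>\<^sub>0::nat. \<forall>\<Delta>\<ge>\<Delta>\<^sub>0. \<forall>w::real. max 0 (1 - real q / real \<Delta>) \<le> w \<and> w < 1 \<longrightarrow>
           (\<exists>!\<mu>. potts_gibbs_measure (tree_verts \<Delta>) (tree_edges \<Delta>) q w \<mu>)"
proof (intro exI[of _ "20000 * q ^ 4 + 1"] allI impI)
  fix \<Delta> :: nat and w :: real
  \<comment> \<open>The bound concerns the d = \<Delta> - 1 children of a vertex other than the
    root; the added 1 accounts for its parent.\<close>
  assume \<Delta>: "20000 * q ^ 4 + 1 \<le> \<Delta>" and w: "max 0 (1 - real q / real \<Delta>) \<le> w \<and> w < 1"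
  have "q ^ 1 \<le> q ^ 4" using assms by (intro power_increasing) auto
  then have q\<Delta>: "q < \<Delta>" "2 \<le> \<Delta>" using \<Delta> assms by simp_all
  have q2: "2 \<le> q" using assms by simp
  \<comment> \<open>Since q < \<Delta> the threshold 1 - q/\<Delta> is positive, so w > 0 and every
    finite configuration has positive weight.\<close>
  have "real q / real \<Delta> < 1" using q\<Delta> by simp
  then have w0: "0 < w" using w by linarith
  have w1: "(1 - w) * real \<Delta> \<le> real q" using w q\<Delta> by (simp add: field_simps)
  have "20000 * q ^ 4 \<le> \<Delta> - 1" using \<Delta> by simp
  then have \<Delta>': "20000 * real q ^ 4 \<le> real (\<Delta> - 1)"
    using of_nat_mono[of "20000 * q ^ 4" "\<Delta> - 1", where 'a = real] by (simp only: of_nat_mult of_nat_power of_nat_numeral)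
  show "\<exists>!\<mu>. potts_gibbs_measure (tree_verts \<Delta>) (tree_edges \<Delta>) q w \<mu>"
  proof (rule ex_ex1I)
    show "\<exists>\<mu>. potts_gibbs_measure (tree_verts \<Delta>) (tree_edges \<Delta>) q w \<mu>"
      using assms by (intro exI[of _ "chain_measure \<Delta> q w"] chain_measure_gibbs w0) simp
    fix \<mu> \<nu>
    assume \<mu>: "potts_gibbs_measure (tree_verts \<Delta>) (tree_edges \<Delta>) q w \<mu>"
      and \<nu>: "potts_gibbs_measure (tree_verts \<Delta>) (tree_edges \<Delta>) q w \<nu>"
    show "\<mu> = \<nu>"
    proof (rule measure_eqI_ball_marginals)
      fix k \<sigma> assume k: "1 \<le> (k::nat)" "\<sigma> \<in> tree_ball \<Delta> k \<rightarrow>\<^sub>E {1..q}"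
      show "measure \<mu> {\<Phi> \<in> space \<mu>. restrict \<Phi> (tree_ball \<Delta> k) = \<sigma>} =
        measure \<nu> {\<Phi> \<in> space \<nu>. restrict \<Phi> (tree_ball \<Delta> k) = \<sigma>}"
        unfolding gibbs_ball_marginal[OF \<mu> q2 \<Delta>' q\<Delta>(2) w0 conjunct2[OF w] w1 k]
          gibbs_ball_marginal[OF \<nu> q2 \<Delta>' q\<Delta>(2) w0 conjunct2[OF w] w1 k] ..
    qed (use \<mu> \<nu> in \<open>auto simp: potts_gibbs_measure_def\<close>)
  qed
qed

end
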